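(* Let $1\le k<d$, let $X$ be a random vector in $\mathbb{R}^d$ and let $X_1,X_2,\dots$ be i.i.d. copies of $X$. Assume that $\mathrm{E}[\|X\|_2^2]<\infty$, that $\lambda_k>\lambda_{k+1}$, and that for all $i,s\in[d-k]$ and $j,t\in[k]$ the quantity $$\Lambda_{ijst}:=\mathrm{E}\big[\langle u_{k+i},X\rangle\langle u_j,X\rangle\langle u_{k+s},X\rangle\langle u_t,X\rangle\big]$$ is finite. Define $\delta_{ij}:=\lambda_j-\lambda_{k+i}$ for $i\in[d-k]$, $j\in[k]$. Then, as $n\to\infty$, the following hold. (1) Consistency: for all $\varepsilon>0$, $\mathrm{P}(\mathrm{dist}([U_n],[U_*])>\varepsilon)\to 0$. (2) Asymptotic normality: $$\sqrt{n}\cdot \mathrm{lift}_{U_*}(\mathrm{Log}_{[U_*]}([U_n]))\xrightarrow{d}U_*^{\perp}G,$$ where $G$ is a mean zero $(d-k)\times k$ Gaussian matrix (jointly Gaussian entries) with $\mathrm{E}[G_{ij}G_{st}]=\Lambda_{ijst}/(\delta_{ij}\delta_{st})$. (3) Excess risk: $$n\cdot[R([U_n])-R([U_*])]\xrightarrow{d}\tfrac12\|H\|_F^2,$$ where $H$ is a mean zero $(d-k)\times k$ Gaussian matrix (jointly Gaussian entries) with $\mathrm{E}[H_{ij}H_{st}]=\Lambda_{ijst}/\sqrt{\delta_{ij}\delta_{st}}$.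
   Context: Notation: $[m]=\{1,\dots,m\}$; $\|\cdot\|_F$ is the Frobenius norm; $\xrightarrow{d}$ is convergence in distribution. PCA setup. $\Sigma:=\mathrm{E}[XX^T]$ and $\Sigma_n:=n^{-1}\sum_{i=1}^nX_iX_i^T$. $(u_j)_{j=1}^d$ is a fixed orthonormal basis of eigenvectors of $\Sigma$ with eigenvalues $\lambda_1\ge\dots\ge\lambda_d$ (ties broken arbitrarily). $(u_{n,j})_{j=1}^d$ is an orthonormal basis of eigenvectors of $\Sigma_n$, ordered non-increasingly according to their eigenvalues, ties broken arbitrarily (such that $U_n$ below is a random matrix, i.e. measurable). $U_*\in\mathbb{R}^{d\times k}$ has columns $u_1,\dots,u_k$; $U_*^\perp\in\mathbb{R}^{d\times(d-k)}$ has columns $u_{k+1},\dots,u_d$; $U_n\in\mathbb{R}^{d\times k}$ has columns $u_{n,1},\dots,u_{n,k}$. Grassmannian. $\mathrm{St}(d,k)=\{U\in\mathbb{R}^{d\times k}: U^TU=I_k\}$; $\mathrm{Gr}(d,k)=\mathrm{St}(d,k)/\sim$, where $U\sim V$ iff $V=UQ$ for some orthogonal $Q\in\mathbb{R}^{k\times k}$; $[U]$ is the class of $U$. The reconstruction risk is $R([U]):=\tfrac12\mathrm{E}[\|X-UU^TX\|_2^2]$. Principal angles $\theta_j([U],[V])\in[0,\pi/2]$, $j\in[k]$, are defined by $\cos\theta_j([U],[V])=s_j$, with $s_j$ the $j$-th largest singular value of $U^TV$ (so $\theta_k$ is the largest angle). The Riemannian distance is $\mathrm{dist}([U],[V])=\big(\sum_{j=1}^k\theta_j([U],[V])^2\big)^{1/2}$.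 Lifted logarithm. The tangent space $T_{[U]}\mathrm{Gr}(d,k)$ is identified, via the linear isometry $\mathrm{lift}_U$, with $H_U=\{\Delta\in\mathbb{R}^{d\times k}:U^T\Delta=0\}$ equipped with the Frobenius inner product. When $\theta_k([U],[V])<\pi/2$, $\mathrm{lift}_U(\mathrm{Log}_{[U]}([V])):=P\arctan(S)Q^T$, where $(I-UU^T)V(U^TV)^{-1}=PSQ^T$ is a (thin) SVD with $P\in\mathbb{R}^{d\times k}$, $S,Q\in\mathbb{R}^{k\times k}$; this does not depend on the representative $V$ of $[V]$. When $\theta_k([U_*],[U_n])=\pi/2$, $\mathrm{Log}_{[U_*]}([U_n])$ may be defined arbitrarily; this does not affect the validity of the statement. *)

theory Defs
  imports "HOL-Probability.Probability"
begin

section \<open>Indexing\<close>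

text \<open>
  The sets $[d]$, $[k]$, $[d-k]$ are the index types \<open>'d\<close>, \<open>'k\<close>, \<open>'m\<close>, related by
  \<open>CARD('d) = CARD('k) + CARD('m)\<close>; as types are nonempty this gives $1 \le k < d$. The types
  \<open>'k\<close> and \<open>'m\<close> are linearly ordered, and \<open>pos\<close> is the order isomorphism onto $\{1,\dots,n\}$.
  Bases and eigenvalues are indexed by natural numbers $1,\dots,d$.
\<close>

definition pos :: "'n::{finite,linorder} \<Rightarrow> nat" where
  "pos j = card {i. i \<le> j}"

lemma bij_betw_pos: "bij_betw (pos :: 'n::{finite,linorder} \<Rightarrow> nat) UNIV {1..CARD('n)}"
proof -
  have less: "pos i < pos j" if "i < j" for i j :: 'n
  proof -
    have "{l. l \<le> i} \<subset> {l. l \<le> j}"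
    proof
      show "{l. l \<le> i} \<subseteq> {l. l \<le> j}" using that by auto
      have "j \<in> {l. l \<le> j}" "j \<notin> {l. l \<le> i}" using that by auto
      then show "{l. l \<le> i} \<noteq> {l. l \<le> j}" by blast
    qed
    then show ?thesis unfolding pos_def by (intro psubset_card_mono) auto
  qed
  then have inj: "inj (pos :: 'n \<Rightarrow> nat)"
    by (metis injI less_irrefl linorder_neqE)
  have "pos j \<in> {1..CARD('n)}" for j :: 'n
  proof -
    have "0 < card {i. i \<le> j}" unfolding card_gt_0_iff by auto
    then show ?thesis unfolding pos_def by (simp add: card_mono Suc_le_eq)
  qed
  then have "range (pos :: 'n \<Rightarrow> nat) = {1..CARD('n)}"
    by (intro card_subset_eq) (auto simp: card_image inj)
  with inj show ?thesis by (simp add: bij_betw_def)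
qed

text \<open>The matrix with columns $v_{l+1}, v_{l+2}, \dots$, one for each element of \<open>'n\<close>.\<close>

definition cols_from :: "nat \<Rightarrow> (nat \<Rightarrow> real^'d) \<Rightarrow> real^'n::{finite,linorder}^'d" where
  "cols_from l v = (\<chi> r j. v (l + pos j) $ r)"


section \<open>Second moment matrices and eigenbases\<close>

definition outer :: "real^'d \<Rightarrow> real^'d^'d" where
  "outer x = (\<chi> r c. x $ r * x $ c)"

definition second_moment :: "'a measure \<Rightarrow> ('a \<Rightarrow> real^'d) \<Rightarrow> real^'d^'d" where
  "second_moment M X = (\<integral>\<omega>. outer (X \<omega>) \<partial>M)"

definition emp_second_moment :: "(nat \<Rightarrow> 'a \<Rightarrow> real^'d) \<Rightarrow> nat \<Rightarrow> 'a \<Rightarrow> real^'d^'d" where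
  "emp_second_moment Xs n \<omega> = (1 / real n) *\<^sub>R (\<Sum>i=1..n. outer (Xs i \<omega>))"

definition ordered_eigenbasis :: "real^'d^'d \<Rightarrow> (nat \<Rightarrow> real^'d) \<Rightarrow> (nat \<Rightarrow> real) \<Rightarrow> bool" where
  "ordered_eigenbasis A v \<mu> \<longleftrightarrow>
     (\<forall>i\<in>{1..CARD('d)}. \<forall>j\<in>{1..CARD('d)}. v i \<bullet> v j = (if i = j then 1 else 0)) \<and>
     (\<forall>j\<in>{1..CARD('d)}. A *v v j = \<mu> j *\<^sub>R v j) \<and>
     (\<forall>i\<in>{1..CARD('d)}. \<forall>j\<in>{1..CARD('d)}. i \<le> j \<longrightarrow> \<mu> j \<le> \<mu> i)"


section \<open>Singular values\<close>

definition diag_mat :: "real^'k \<Rightarrow> real^'k^'k" where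
  "diag_mat s = (\<chi> i j. if i = j then s $ i else 0)"

text \<open>A thin SVD $A = P\,\mathrm{diag}(s)\,Q^T$, with the singular values in non-increasing order.\<close>

definition thin_svd ::
  "real^'k::{finite,linorder}^'d \<Rightarrow> real^'k::{finite,linorder}^'d \<Rightarrow> real^'k::{finite,linorder} \<Rightarrow> real^'k::{finite,linorder}^'k::{finite,linorder} \<Rightarrow> bool" where
  "thin_svd A P s Q \<longleftrightarrow>
     transpose P ** P = mat 1 \<and> orthogonal_matrix Q \<and>
     (\<forall>j. 0 \<le> s $ j) \<and> (\<forall>i j. i \<le> j \<longrightarrow> s $ j \<le> s $ i) \<and>
     A = P ** diag_mat s ** transpose Q"

definition singular_values :: "real^'k::{finite,linorder}^'k::{finite,linorder} \<Rightarrow> real^'k::{finite,linorder}" where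
  "singular_values A = (SOME s. \<exists>P Q. thin_svd A P s Q)"


section \<open>The Grassmannian\<close>

definition stiefel :: "(real^'k^'d) set" where
  "stiefel = {U. transpose U ** U = mat 1}"

definition gr_rel :: "((real^'k^'d) \<times> (real^'k^'d)) set" where
  "gr_rel = {(U, V). U \<in> stiefel \<and> V \<in> stiefel \<and> (\<exists>Q. orthogonal_matrix Q \<and> V = U ** Q)}"

definition gr :: "real^'k^'d \<Rightarrow> (real^'k^'d) set" where
  "gr U = gr_rel `` {U}"

text \<open>
  Functions on the Grassmannian are evaluated at a chosen representative of each class; none of
  the functions below depends on that choice.
\<close>

definition rep :: "(real^'k^'d) set \<Rightarrow> real^'k^'d" where
  "rep C = (SOME U. U \<in> C)"

lemma equiv_gr_rel: "equiv stiefel (gr_rel :: ((real^'k^'d) \<times> (real^'k^'d)) set)"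
proof (rule equivI)
  show "refl_on stiefel (gr_rel :: ((real^'k^'d) \<times> (real^'k^'d)) set)"
  proof (rule refl_onI)
    fix U :: "real^'k^'d" assume "U \<in> stiefel"
    moreover have "U = U ** mat 1" by simp
    ultimately show "(U, U) \<in> gr_rel"
      unfolding gr_rel_def using orthogonal_matrix_id by blast
  qed
  show "sym (gr_rel :: ((real^'k^'d) \<times> (real^'k^'d)) set)"
  proof (rule symI)
    fix U V :: "real^'k^'d" assume "(U, V) \<in> gr_rel"
    then obtain Q where Q: "U \<in> stiefel" "V \<in> stiefel" "orthogonal_matrix Q" "V = U ** Q"
      by (auto simp: gr_rel_def)
    have "U = V ** transpose Q"
      using Q by (simp add: matrix_mul_assoc[symmetric] orthogonal_matrix_def)
    with Q show "(V, U) \<in> gr_rel"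
      unfolding gr_rel_def using orthogonal_matrix_transpose by blast
  qed
  show "trans (gr_rel :: ((real^'k^'d) \<times> (real^'k^'d)) set)"
  proof (rule transI)
    fix U V W :: "real^'k^'d" assume "(U, V) \<in> gr_rel" "(V, W) \<in> gr_rel"
    then obtain Q Q' where Q: "U \<in> stiefel" "W \<in> stiefel" "orthogonal_matrix Q"
      "orthogonal_matrix Q'" "W = (U ** Q) ** Q'"
      by (auto simp: gr_rel_def)
    have "W = U ** (Q ** Q')" by (simp add: Q(5) matrix_mul_assoc)
    moreover have "orthogonal_matrix (Q ** Q')" using Q by (simp add: orthogonal_matrix_mul)
    ultimately show "(U, W) \<in> gr_rel"
      unfolding gr_rel_def using Q by blast
  qed
qed (auto simp: gr_rel_def)

lemma rep_gr: assumes "U \<in> stiefel" shows "(U, rep (gr U)) \<in> gr_rel"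
proof -
  have "U \<in> gr U"
    using equiv_class_self[OF equiv_gr_rel assms] by (simp add: gr_def)
  then have "rep (gr U) \<in> gr U"
    unfolding rep_def by (rule someI)
  then show ?thesis by (simp add: gr_def)
qed

definition principal_angle ::
  "(real^'k::{finite,linorder}^'d) set \<Rightarrow> (real^'k::{finite,linorder}^'d) set \<Rightarrow> 'k::{finite,linorder} \<Rightarrow> real" where
  "principal_angle A B j = arccos (singular_values (transpose (rep A) ** rep B) $ j)"

text \<open>\<open>Max UNIV\<close> is the last index $k$.\<close>

definition largest_angle ::
  "(real^'k::{finite,linorder}^'d) set \<Rightarrow> (real^'k::{finite,linorder}^'d) set \<Rightarrow> real" where
  "largest_angle A B = principal_angle A B (Max UNIV)"

definition gr_dist ::
  "(real^'k::{finite,linorder}^'d) set \<Rightarrow> (real^'k::{finite,linorder}^'d) set \<Rightarrow> real" where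
  "gr_dist A B = sqrt (\<Sum>j\<in>UNIV. (principal_angle A B j)\<^sup>2)"

text \<open>$\mathrm{lift}_U(\mathrm{Log}_{[U]}(B))$; meaningful when \<open>largest_angle (gr U) B < pi / 2\<close>.\<close>

definition lift_log :: "real^'k::{finite,linorder}^'d \<Rightarrow> (real^'k::{finite,linorder}^'d) set \<Rightarrow> real^'k::{finite,linorder}^'d" where
  "lift_log U B =
     (let V = rep B;
          (P, s, Q) = (SOME (P, s, Q).
             thin_svd ((mat 1 - U ** transpose U) ** V ** matrix_inv (transpose U ** V)) P s Q)
      in P ** diag_mat (\<chi> j. arctan (s $ j)) ** transpose Q)"

definition recon_risk :: "'a measure \<Rightarrow> ('a \<Rightarrow> real^'d) \<Rightarrow> (real^'k^'d) set \<Rightarrow> real" where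
  "recon_risk M X A =
     1/2 * (\<integral>\<omega>. (norm (X \<omega> - (rep A ** transpose (rep A)) *v X \<omega>))\<^sup>2 \<partial>M)"

lemma recon_risk_gr:
  fixes U :: "real^'k^'d"
  assumes "U \<in> stiefel"
  shows "recon_risk M X (gr U) = 1/2 * (\<integral>\<omega>. (norm (X \<omega> - (U ** transpose U) *v X \<omega>))\<^sup>2 \<partial>M)"
proof -
  from rep_gr[OF assms] obtain Q where Q: "orthogonal_matrix Q" "rep (gr U) = U ** Q"
    by (auto simp: gr_rel_def)
  have "rep (gr U) ** transpose (rep (gr U)) = U ** (Q ** transpose Q) ** transpose U"
    by (simp add: Q(2) matrix_transpose_mul matrix_mul_assoc)
  also have "\<dots> = U ** transpose U"
    using Q(1) by (simp add: orthogonal_matrix_def)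
  finally show ?thesis by (simp add: recon_risk_def)
qed


section \<open>Convergence in distribution and Gaussian matrices\<close>

text \<open>
  Convergence in distribution of random elements of a topological space to a limit law \<open>L\<close>,
  by bounded continuous test functions. For real random variables it is the library's
  \<open>weak_conv_m\<close> (lemma below).
\<close>

definition conv_in_distr ::
  "'a measure \<Rightarrow> (nat \<Rightarrow> 'a \<Rightarrow> 'b::topological_space) \<Rightarrow> 'b measure \<Rightarrow> bool" where
  "conv_in_distr M Y L \<longleftrightarrow>
     (\<forall>n. Y n \<in> borel_measurable M) \<and> prob_space L \<and> sets L = sets borel \<and>
     (\<forall>f::'b \<Rightarrow> real. continuous_on UNIV f \<longrightarrow> bounded (range f) \<longrightarrow>
        (\<lambda>n. \<integral>\<omega>. f (Y n \<omega>) \<partial>M) \<longlonglongrightarrow> (\<integral>y. f y \<partial>L))"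

lemma conv_in_distr_iff_weak_conv_m:
  fixes Y :: "nat \<Rightarrow> 'a \<Rightarrow> real"
  assumes "prob_space M" and Y: "\<And>n. Y n \<in> borel_measurable M"
    and "prob_space L" and L: "sets L = sets borel"
  shows "conv_in_distr M Y L \<longleftrightarrow> weak_conv_m (\<lambda>n. distr M borel (Y n)) L"
proof -
  interpret M: prob_space M by fact
  interpret L: real_distribution L
    using assms sets_eq_imp_space_eq[OF L]
    by (auto simp: real_distribution_def real_distribution_axioms_def)
  have rd: "real_distribution (distr M borel (Y n))" for n
    using Y by simp
  have int: "integral\<^sup>L (distr M borel (Y n)) f = (\<integral>\<omega>. f (Y n \<omega>) \<partial>M)"
    if "continuous_on UNIV f" for n and f :: "real \<Rightarrow> real"
    using that Y by (intro integral_distr) (auto intro: borel_measurable_continuous_onI)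
  show ?thesis
  proof
    assume conv: "conv_in_distr M Y L"
    show "weak_conv_m (\<lambda>n. distr M borel (Y n)) L"
    proof (rule integral_bdd_continuous_conv_imp_weak_conv[OF rd L.real_distribution_axioms])
      fix f :: "real \<Rightarrow> real" assume f: "\<And>x. isCont f x" "\<And>x. \<bar>f x\<bar> \<le> 1"
      have c: "continuous_on UNIV f"
        using f(1) by (simp add: continuous_at_imp_continuous_on)
      have "bounded (range f)" using f(2) by (auto simp: bounded_iff)
      with c conv show "(\<lambda>n. integral\<^sup>L (distr M borel (Y n)) f) \<longlonglongrightarrow> integral\<^sup>L L f"
        by (simp add: int conv_in_distr_def)
    qed
  next
    assume w: "weak_conv_m (\<lambda>n. distr M borel (Y n)) L"
    have "(\<lambda>n. \<integral>\<omega>. f (Y n \<omega>) \<partial>M) \<longlonglongrightarrow> (\<integral>y. f y \<partial>L)"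
      if c: "continuous_on UNIV f" and b: "bounded (range f)" for f :: "real \<Rightarrow> real"
    proof -
      from b obtain B where B: "\<And>x. norm (f x) \<le> B" by (auto simp: bounded_iff)
      have "isCont f x" for x
        using c by (simp add: continuous_on_eq_continuous_at)
      from weak_conv_imp_integral_bdd_continuous_conv[OF rd L.real_distribution_axioms w this B]
      show ?thesis by (simp add: int[OF c])
    qed
    with assms show "conv_in_distr M Y L"
      by (simp add: conv_in_distr_def)
  qed
qed

text \<open>The one-dimensional normal law with standard deviation \<open>\<sigma>\<close>; \<open>\<sigma> = 0\<close> is the point mass.\<close>

definition normal_law :: "real \<Rightarrow> real \<Rightarrow> real measure" where
  "normal_law \<mu> \<sigma> =
     (if \<sigma> = 0 then return borel \<mu> else density lborel (normal_density \<mu> \<sigma>))"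

text \<open>
  Joint Gaussianity of the entries: every linear combination of them is normal, possibly
  degenerate.
\<close>

definition gaussian_matrix_law :: "(real^'k^'m) measure \<Rightarrow> bool" where
  "gaussian_matrix_law L \<longleftrightarrow>
     prob_space L \<and> sets L = sets borel \<and>
     (\<forall>a. \<exists>\<mu> \<sigma>. 0 \<le> \<sigma> \<and>
        distr L borel (\<lambda>G. \<Sum>i\<in>UNIV. \<Sum>j\<in>UNIV. a i j * G $ i $ j) = normal_law \<mu> \<sigma>)"

definition centered_gaussian_matrix_law ::
  "(real^'k^'m) measure \<Rightarrow> ('m \<Rightarrow> 'k \<Rightarrow> 'm \<Rightarrow> 'k \<Rightarrow> real) \<Rightarrow> bool" where
  "centered_gaussian_matrix_law L C \<longleftrightarrow>
     gaussian_matrix_law L \<and>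
     (\<forall>i j. (\<integral>G. G $ i $ j \<partial>L) = 0) \<and>
     (\<forall>i j s t. (\<integral>G. G $ i $ j * G $ s $ t \<partial>L) = C i j s t)"

end

theory Submission
  imports Defs
begin

text \<open>
  Write \<open>V\<close>, \<open>W\<close> for the leading and trailing population eigenvectors, \<open>S\<close> for the population
  and \<open>S'\<close> for the sample second moment matrix, \<open>E = S' - S\<close>, and \<open>U\<close> for the empirical leading
  eigenvectors. In the basis \<open>[V, W]\<close> the empirical subspace has blocks \<open>A = V\<^sup>T U\<close> and
  \<open>B = W\<^sup>T U\<close>, and the whole argument is about its graph coordinate \<open>T = B A\<^sup>-\<^sup>1\<close>, which does not
  depend on the choice of the orthonormal basis \<open>U\<close>.

  Consistency. The frame \<open>U\<close> maximises \<open>U \<bullet> S' U\<close> among orthonormal frames and \<open>V\<close> maximises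
  \<open>V \<bullet> S V\<close>, the latter with a quadratic margin given by the eigengap (\<open>ky_fan_gap\<close>). Comparing
  the two gives \<open>gap * |B|\<^sup>2 \<le> 2 k |E|\<close> (\<open>leading_subspace_perturbation\<close>), and \<open>E\<close> tends to \<open>0\<close> by
  the weak law of large numbers. All principal angles are continuous functions of \<open>|B|\<close>.

  Linearisation. Compressing the eigenvalue equation \<open>S' U = U D\<close> to the two blocks yields an exact
  Riccati equation for \<open>T\<close> (\<open>graph_riccati\<close>) whose linear part multiplies the entry \<open>(i, j)\<close> by
  \<open>\<delta> i j\<close> and whose inhomogeneity is \<open>Y = W\<^sup>T E V\<close>. Since \<open>E\<close> and \<open>T\<close> are small, \<open>T i j\<close> equals
  \<open>Y i j / \<delta> i j\<close> up to an error \<open>o(|Y|)\<close>. The lifted logarithm is \<open>W T\<close> up to a cubic error,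
  because it replaces the singular values of \<open>W T\<close> by their arctangents, and twice the excess risk
  is \<open>\<Sum> \<delta> i j * T i j\<^sup>2\<close> up to a quartic error (\<open>risk_expansion\<close>). Both are therefore
  explicit functions of \<open>Y\<close> up to \<open>o(|Y|)\<close> and \<open>o(|Y|\<^sup>2)\<close>.

  Limits. Only the cross block \<open>Y\<close> enters at first order, which is why fourth moments are needed
  for mixed products of leading and trailing coordinates alone. The matrix \<open>sqrt n * Y\<close> is a
  normalised sum of centred, independent, identically distributed matrices and converges to a
  Gaussian law by the multivariate central limit theorem. Slutsky's lemma and the continuous
  mapping theorem transfer this to the logarithm and to the risk.

  The multivariate central limit theorem is deduced from the one-dimensional one by a Cramer-Wold
  theorem, the Gaussian limit is built from independent normals along an eigenbasis of the
  covariance operator, and smallness in probability is expressed through a filter on pairs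
  \<open>(n, \<omega>)\<close>, so that remainder terms are handled by ordinary limit calculus.
\<close>

section \<open>The spectral theorem\<close>

text \<open>
  The first-order condition at a maximum: for \<open>t = a / (\<bar>c\<bar> + 1)\<close> the linear term would win.
\<close>

lemma quadratic_dominates_linear_imp_zero:
  fixes a c :: real
  assumes "\<And>t. 2 * t * a \<le> t\<^sup>2 * c"
  shows "a = 0"
proof (rule ccontr)
  assume "a \<noteq> 0"
  define e where "e = \<bar>c\<bar> + 1"
  have e: "e > 0" "c \<le> e" by (auto simp: e_def)
  have "2 * (a / e) * a \<le> (a / e)\<^sup>2 * c" by (rule assms)
  also have "\<dots> \<le> (a / e)\<^sup>2 * e" using e by (intro mult_left_mono) auto
  also have "\<dots> = (a / e) * a" using e by (simp add: power2_eq_square)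
  finally have "a * a / e \<le> 0" by simp
  moreover have "a * a / e > 0" using \<open>a \<noteq> 0\<close> e
    by (intro divide_pos_pos) (auto simp: zero_less_mult_iff)
  ultimately show False by simp
qed

text \<open>
  A maximiser \<open>v\<close> of \<open>x \<bullet> f x\<close> over the unit sphere of \<open>S\<close> is an eigenvector: the first-order
  condition makes \<open>f v\<close> orthogonal to every \<open>w \<in> S\<close> orthogonal to \<open>v\<close>. The orthogonal complement of
  \<open>v\<close> in \<open>S\<close> is again invariant and has smaller dimension, so that induction over invariant
  subspaces applies.
\<close>

lemma selfadjoint_eigenbasis:
  fixes f :: "'a::euclidean_space \<Rightarrow> 'a"
  assumes lin: "linear f" and sa: "\<And>x y. f x \<bullet> y = x \<bullet> f y"
    and "subspace S" "f ` S \<subseteq> S"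
  shows "\<exists>B. B \<subseteq> S \<and> pairwise orthogonal B \<and> (\<forall>x\<in>B. norm x = 1) \<and> span B = S
    \<and> (\<forall>x\<in>B. f x = (x \<bullet> f x) *\<^sub>R x)"
  using assms(3,4)
proof (induction "dim S" arbitrary: S rule: less_induct)
  case less
  note S = less.prems(1) and inv = less.prems(2)
  show ?case
  proof (cases "S = {0}")
    case True
    then show ?thesis by (intro exI[of _ "{}"]) auto
  next
    case False
    then obtain x0 where x0: "x0 \<in> S" "x0 \<noteq> 0"
      using S subspace_0 by blast
    let ?K = "sphere 0 1 \<inter> S"
    have "compact ?K"
      using closed_subspace[OF S] by (intro compact_Int_closed) auto
    moreover have "x0 /\<^sub>R norm x0 \<in> ?K"
      using x0 S by (auto simp: subspace_scale)
    moreover have "continuous_on ?K (\<lambda>x. x \<bullet> f x)"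
      using linear_continuous_on[of f] lin
      by (intro continuous_intros) (simp add: linear_conv_bounded_linear)
    ultimately obtain v where v: "v \<in> ?K" and vmax: "\<And>y. y \<in> ?K \<Longrightarrow> y \<bullet> f y \<le> v \<bullet> f v"
      using continuous_attains_sup[of ?K "\<lambda>x. x \<bullet> f x"] by blast
    have v1: "norm v = 1" "v \<in> S" "v \<bullet> v = 1" using v by (auto simp: norm_eq_1)
    define \<mu> where "\<mu> = v \<bullet> f v"
    have ray: "x \<bullet> f x \<le> \<mu> * (norm x)\<^sup>2" if "x \<in> S" for x
    proof (cases "x = 0")
      case False
      have "x /\<^sub>R norm x \<in> ?K" using False S that by (auto simp: subspace_scale)
      from vmax[OF this] False show ?thesis
        by (simp add: \<mu>_def linear_cmul[OF lin] field_simps power2_eq_square)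
    qed (simp add: linear_0[OF lin])
    \<comment> \<open>first-order condition at the maximiser\<close>
    have orth: "f v \<bullet> w = 0" if w: "w \<in> S" "w \<bullet> v = 0" for w
    proof (rule quadratic_dominates_linear_imp_zero)
      fix t :: real
      have "v + t *\<^sub>R w \<in> S" using w v1 S by (simp add: subspace_add subspace_scale)
      from ray[OF this]
      have "(v + t *\<^sub>R w) \<bullet> f (v + t *\<^sub>R w) \<le> \<mu> * ((v + t *\<^sub>R w) \<bullet> (v + t *\<^sub>R w))"
        by (simp add: power2_norm_eq_inner)
      moreover have "(v + t *\<^sub>R w) \<bullet> f (v + t *\<^sub>R w) = \<mu> + 2 * t * (f v \<bullet> w) + t\<^sup>2 * (w \<bullet> f w)"
        using sa[of v w]
        by (simp add: linear_add[OF lin] linear_cmul[OF lin] \<mu>_def inner_simps inner_commute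
            power2_eq_square algebra_simps)
      moreover have "(v + t *\<^sub>R w) \<bullet> (v + t *\<^sub>R w) = 1 + t\<^sup>2 * (w \<bullet> w)"
        using w(2) v1(3) by (simp add: inner_simps inner_commute power2_eq_square algebra_simps)
      ultimately have "\<mu> + 2 * t * (f v \<bullet> w) + t\<^sup>2 * (w \<bullet> f w) \<le> \<mu> * (1 + t\<^sup>2 * (w \<bullet> w))"
        by simp
      then show "2 * t * (f v \<bullet> w) \<le> t\<^sup>2 * (\<mu> * (w \<bullet> w) - w \<bullet> f w)"
        by (simp add: algebra_simps)
    qed
    have eig: "f v = \<mu> *\<^sub>R v"
    proof -
      let ?w = "f v - \<mu> *\<^sub>R v"
      have w: "?w \<in> S" "?w \<bullet> v = 0"
        using v1 inv S by (auto simp: subspace_diff subspace_scale image_subset_iff inner_simps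
            \<mu>_def inner_commute)
      have "?w \<bullet> ?w = f v \<bullet> ?w - \<mu> * (?w \<bullet> v)" by (simp add: inner_simps inner_commute algebra_simps)
      then have "?w \<bullet> ?w = 0" using orth[OF w] w(2) by simp
      then show ?thesis by simp
    qed
    define S' where "S' = S \<inter> {x. v \<bullet> x = 0}"
    have S': "subspace S'" unfolding S'_def by (intro subspace_inter S subspace_hyperplane)
    have inv': "f ` S' \<subseteq> S'"
    proof
      fix y assume "y \<in> f ` S'"
      then obtain x where x: "x \<in> S" "v \<bullet> x = 0" "y = f x" by (auto simp: S'_def)
      have "v \<bullet> f x = f v \<bullet> x" by (simp add: sa)
      then show "y \<in> S'" using x inv by (auto simp: S'_def eig)
    qed
    have "v \<in> S - S'" "S' \<subseteq> S" using v1 by (auto simp: S'_def)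
    then have "S' \<subset> S" by blast
    then have "dim S' < dim S"
      using S S' by (intro dim_psubset) (simp add: span_eq_iff[THEN iffD2])
    from less.hyps[OF this S' inv'] obtain B where B: "B \<subseteq> S'" "pairwise orthogonal B"
      "\<forall>x\<in>B. norm x = 1" "span B = S'" "\<forall>x\<in>B. f x = (x \<bullet> f x) *\<^sub>R x" by blast
    have "span (insert v B) = S"
    proof
      show "span (insert v B) \<subseteq> S"
        using B(1) v1 S by (intro span_minimal) (auto simp: S'_def)
      show "S \<subseteq> span (insert v B)"
      proof
        fix x assume x: "x \<in> S"
        have "x - (v \<bullet> x) *\<^sub>R v \<in> S'"
          using x v1 S by (auto simp: S'_def subspace_diff subspace_scale inner_simps)
        then show "x \<in> span (insert v B)" by (auto simp: span_insert B(4))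
      qed
    qed
    moreover have "pairwise orthogonal (insert v B)"
      using B(1,2) by (auto simp: pairwise_insert orthogonal_def S'_def inner_commute)
    ultimately show ?thesis
      using B v1 eig by (intro exI[of _ "insert v B"]) (auto simp: S'_def \<mu>_def)
  qed
qed

section \<open>The Frobenius inner product\<close>

text \<open>
  The inner product of the type \<open>real^'k^'m\<close> is the Frobenius one. The two rules that move a factor
  to the other side of it take the place of cyclic permutations under a trace.
\<close>

lemma inner_matrix_def: "(A :: real^'k^'m) \<bullet> B = (\<Sum>i\<in>UNIV. \<Sum>j\<in>UNIV. A $ i $ j * B $ i $ j)"
  by (simp add: inner_vec_def)

lemma norm_matrix_sq: "(norm (A :: real^'k^'m))\<^sup>2 = (\<Sum>i\<in>UNIV. \<Sum>j\<in>UNIV. (A $ i $ j)\<^sup>2)"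
  unfolding power2_norm_eq_inner inner_matrix_def by (simp add: power2_eq_square)

lemma inner_transpose: "transpose (A :: real^'k^'m) \<bullet> transpose B = A \<bullet> B"
  unfolding inner_matrix_def transpose_def by (subst sum.swap) simp

lemma norm_transpose: "norm (transpose (A :: real^'k^'m)) = norm A"
  by (simp add: norm_eq_sqrt_inner inner_transpose)

lemma inner_mult_left: "(A ** B) \<bullet> C = B \<bullet> (transpose A ** (C :: real^'k^'m))"
proof -
  have "(A ** B) \<bullet> C = (\<Sum>i\<in>UNIV. \<Sum>j\<in>UNIV. \<Sum>l\<in>UNIV. A $ i $ l * B $ l $ j * C $ i $ j)"
    by (simp add: inner_matrix_def matrix_matrix_mult_def sum_distrib_right)
  also have "\<dots> = (\<Sum>i\<in>UNIV. \<Sum>l\<in>UNIV. \<Sum>j\<in>UNIV. A $ i $ l * B $ l $ j * C $ i $ j)"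
    by (intro sum.cong refl sum.swap)
  also have "\<dots> = (\<Sum>l\<in>UNIV. \<Sum>i\<in>UNIV. \<Sum>j\<in>UNIV. A $ i $ l * B $ l $ j * C $ i $ j)"
    by (rule sum.swap)
  also have "\<dots> = (\<Sum>l\<in>UNIV. \<Sum>j\<in>UNIV. \<Sum>i\<in>UNIV. A $ i $ l * B $ l $ j * C $ i $ j)"
    by (intro sum.cong refl sum.swap)
  also have "\<dots> = B \<bullet> (transpose A ** C)"
    by (simp add: inner_matrix_def matrix_matrix_mult_def transpose_def sum_distrib_left mult_ac)
  finally show ?thesis .
qed

lemma inner_mult_right: "(A ** B) \<bullet> C = A \<bullet> ((C :: real^'k^'m) ** transpose B)"
proof -
  have "(A ** B) \<bullet> C = (transpose B ** transpose A) \<bullet> transpose C"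
    by (metis inner_transpose matrix_transpose_mul)
  also have "\<dots> = transpose A \<bullet> transpose (C ** transpose B)"
    by (simp add: inner_mult_left matrix_transpose_mul)
  finally show ?thesis by (simp add: inner_transpose)
qed

lemma norm_matrix_mult_le: "norm ((A :: real^'l^'m) ** (B :: real^'k^'l)) \<le> norm A * norm B"
proof (rule power2_le_imp_le)
  have *: "((A ** B) $ i $ j)\<^sup>2 \<le> (norm (A $ i))\<^sup>2 * (norm (transpose B $ j))\<^sup>2" for i j
  proof -
    have "(A ** B) $ i $ j = A $ i \<bullet> transpose B $ j"
      by (simp add: matrix_matrix_mult_def inner_vec_def transpose_def)
    then have "\<bar>(A ** B) $ i $ j\<bar> \<le> norm (A $ i) * norm (transpose B $ j)"
      by (simp add: Cauchy_Schwarz_ineq2)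
    then show ?thesis
      by (metis abs_ge_zero power2_abs power_mono power_mult_distrib)
  qed
  have sq: "(norm C)\<^sup>2 = (\<Sum>i\<in>UNIV. (norm (C $ i))\<^sup>2)" for C :: "real^'b^'c"
    by (simp add: power2_norm_eq_inner inner_vec_def)
  have "(norm (A ** B))\<^sup>2 \<le> (\<Sum>i\<in>UNIV. \<Sum>j\<in>UNIV. (norm (A $ i))\<^sup>2 * (norm (transpose B $ j))\<^sup>2)"
    unfolding norm_matrix_sq by (intro sum_mono *)
  also have "\<dots> = (norm A)\<^sup>2 * (norm (transpose B))\<^sup>2"
    by (simp add: sq sum_product)
  finally show "(norm (A ** B))\<^sup>2 \<le> (norm A * norm B)\<^sup>2"
    by (simp add: norm_transpose power_mult_distrib)
qed simp

lemma bounded_bilinear_matrix_mult: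
  "bounded_bilinear ((**) :: real^'l^'m \<Rightarrow> real^'k^'l \<Rightarrow> real^'k^'m)"
proof
  show "\<exists>K. \<forall>(A :: real^'l^'m) (B :: real^'k^'l). norm (A ** B) \<le> norm A * norm B * K"
    by (intro exI[of _ 1]) (simp add: norm_matrix_mult_le)
qed (auto simp: matrix_matrix_mult_def vec_eq_iff algebra_simps sum.distrib sum_distrib_left)

text \<open>
  Distributivity, cancellation of zero factors and limit rules for the matrix product.
\<close>

interpretation matrix_mult: bounded_bilinear "(**) :: real^'l^'m \<Rightarrow> real^'k^'l \<Rightarrow> real^'k^'m"
  by (rule bounded_bilinear_matrix_mult)

lemma transpose_add: "transpose (A + B) = transpose A + transpose (B :: real^'k^'m)"
  by (simp add: transpose_def vec_eq_iff)

section \<open>Thin singular value decompositions\<close>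

text \<open>
  Left singular vectors belonging to the singular value \<open>0\<close> are not determined by the matrix; this
  lemma supplies them. One vector is added at a time, orthogonal to the span of the previous ones,
  which is a proper subspace as long as there are fewer than \<open>DIM('a)\<close> of them.
\<close>

lemma orthonormal_family_extend:
  fixes p0 :: "'i \<Rightarrow> 'a::euclidean_space"
  assumes "finite J0" and p0: "\<And>i j. i \<in> J0 \<Longrightarrow> j \<in> J0 \<Longrightarrow> p0 i \<bullet> p0 j = (if i = j then 1 else 0)"
    and "finite D" "J0 \<inter> D = {}" "card (J0 \<union> D) \<le> DIM('a)"
  shows "\<exists>p. (\<forall>j\<in>J0. p j = p0 j) \<and>
    (\<forall>i\<in>J0 \<union> D. \<forall>j\<in>J0 \<union> D. p i \<bullet> p j = (if i = j then 1 else 0))"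
  using assms(3-5)
proof (induction D rule: finite_induct)
  case empty
  then show ?case using p0 by auto
next
  case (insert d D)
  let ?J = "J0 \<union> D"
  have dJ: "d \<notin> ?J" using insert.hyps insert.prems by auto
  have fin: "finite ?J" using assms(1) insert.hyps by simp
  have "Suc (card ?J) = card (J0 \<union> insert d D)" using dJ fin by simp
  then have card: "card ?J < DIM('a)" using insert.prems by linarith
  from insert.IH insert.prems card obtain p where p: "\<forall>j\<in>J0. p j = p0 j"
    "\<forall>i\<in>?J. \<forall>j\<in>?J. p i \<bullet> p j = (if i = j then 1 else 0)" by auto
  have "dim (p ` ?J) \<le> card (p ` ?J)" using fin by (intro dim_le_card') auto
  also have "\<dots> \<le> card ?J" using fin by (rule card_image_le)
  finally obtain x where x: "x \<noteq> 0" "\<And>y. y \<in> span (p ` ?J) \<Longrightarrow> orthogonal x y"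
    using card orthogonal_to_subspace_exists[of "p ` ?J"] by (metis le_less_trans)
  define e where "e = x /\<^sub>R norm x"
  have e: "e \<bullet> e = 1" using x(1) by (simp add: e_def dot_square_norm power2_eq_square)
  have ep: "e \<bullet> p j = 0" if "j \<in> ?J" for j
    using x(2)[of "p j"] that by (auto simp: e_def orthogonal_def span_base)
  have "(p(d := e)) i \<bullet> (p(d := e)) j = (if i = j then 1 else 0)"
    if "i \<in> insert d ?J" "j \<in> insert d ?J" for i j
    using that p(2) dJ e ep by (auto simp: inner_commute)
  moreover have "(p(d := e)) j = p0 j" if "j \<in> J0" for j
    using that p(1) dJ by auto
  ultimately show ?case by (intro exI[of _ "p(d := e)"]) auto
qed

lemma inner_matrix_vector: "((A :: real^'k^'d) *v x) \<bullet> y = x \<bullet> (transpose A *v y)"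
  by (metis dot_lmul_matrix transpose_matrix_vector transpose_transpose)

text \<open>
  The eigenbasis of the spectral theorem, sorted by decreasing eigenvalue and listed along the order
  of the index type by means of \<open>pos\<close>.
\<close>

lemma symmetric_matrix_ordered_eigenbasis:
  fixes S :: "real^'k::{finite,linorder}^'k::{finite,linorder}"
  assumes sym: "transpose S = S"
  shows "\<exists>q \<mu>. (\<forall>i j. q i \<bullet> q j = (if i = j then 1 else 0)) \<and> (\<forall>j. S *v q j = \<mu> j *\<^sub>R q j)
    \<and> (\<forall>i j. (i :: 'k) \<le> j \<longrightarrow> \<mu> j \<le> \<mu> i)"
proof -
  have "((*v) S x) \<bullet> y = x \<bullet> ((*v) S y)" for x y
    by (metis inner_matrix_vector sym)
  from selfadjoint_eigenbasis[OF matrix_vector_mul_linear this, of UNIV] obtain B where B: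
    "pairwise orthogonal B" "\<forall>x\<in>B. norm x = 1" "span B = UNIV"
    "\<forall>x\<in>B. S *v x = (x \<bullet> (S *v x)) *\<^sub>R x"
    by auto
  have ind: "independent B"
    using B(1,2) by (intro pairwise_orthogonal_independent) auto
  then have fin: "finite B" using independent_imp_finite by blast
  have card: "card B = CARD('k)"
    using ind B(3) by (metis dim_UNIV dim_span_eq_card_independent DIM_cart DIM_real mult.right_neutral)
  let ?key = "\<lambda>v. - (v \<bullet> (S *v v))"
  obtain ys where ys: "set ys = B" "distinct ys" using fin finite_distinct_list by blast
  define xs where "xs = sort_key ?key ys"
  have xs: "set xs = B" "distinct xs" "length xs = CARD('k)" "sorted (map ?key xs)"
    using ys card by (auto simp: xs_def distinct_card[symmetric])
  define q where "q j = xs ! (pos j - 1)" for j :: 'k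
  have posr: "pos j \<in> {1..CARD('k)}" for j :: 'k
    using bij_betw_pos[where 'n='k] by (auto simp: bij_betw_def)
  have lt: "pos j - 1 < length xs" for j :: 'k
    using posr[of j] xs(3) by auto
  have inj: "i = j" if "pos i - 1 = pos j - 1" for i j :: 'k
  proof -
    have "pos i = pos j" using that posr[of i] posr[of j] by auto
    then show ?thesis using bij_betw_pos[where 'n='k] by (auto simp: bij_betw_def inj_on_def)
  qed
  have mono: "pos i \<le> pos j" if "i \<le> j" for i j :: 'k
    unfolding pos_def using that by (intro card_mono) auto
  have qB: "q j \<in> B" for j using lt xs(1) by (auto simp: q_def)
  have "q i \<bullet> q j = (if i = j then 1 else 0)" for i j
  proof (cases "i = j")
    case True
    then show ?thesis using B(2) qB by (simp add: norm_eq_1[symmetric])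
  next
    case False
    then have "q i \<noteq> q j"
      using inj lt xs(2) by (auto simp: q_def nth_eq_iff_index_eq)
    then show ?thesis using False B(1) qB by (auto simp: pairwise_def orthogonal_def)
  qed
  moreover have "- ?key (q j) \<le> - ?key (q i)" if "i \<le> j" for i j
    using sorted_nth_mono[OF xs(4), of "pos i - 1" "pos j - 1"] mono[OF that] lt[of i] lt[of j]
    by (simp add: q_def)
  ultimately show ?thesis
    using B(4) qB by (intro exI[of _ q] exI[of _ "\<lambda>j. - ?key (q j)"]) auto
qed

lemma transpose_mult_entry: "(transpose (A :: real^'k^'d) ** B) $ i $ j = column i A \<bullet> column j B"
  by (simp add: matrix_matrix_mult_def transpose_def column_def inner_vec_def)

text \<open>
  The right singular vectors are the eigenvectors of \<open>A\<^sup>T A\<close>, whose images under \<open>A\<close> are pairwise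
  orthogonal. Normalised images are the left singular vectors for positive singular values; the
  remaining ones are an arbitrary orthonormal completion, possible because \<open>CARD('k) \<le> CARD('d)\<close>.
\<close>

lemma thin_svd_exists:
  fixes A :: "real^'k::{finite,linorder}^'d"
  assumes "CARD('k) \<le> CARD('d)"
  shows "\<exists>P s Q. thin_svd A P s Q"
proof -
  have "transpose (transpose A ** A) = transpose A ** A" by (simp add: matrix_transpose_mul)
  from symmetric_matrix_ordered_eigenbasis[OF this] obtain q \<mu> where
    q: "\<And>i j. q i \<bullet> q j = (if i = j then 1 else 0)"
    and eig: "\<And>j. (transpose A ** A) *v q j = \<mu> j *\<^sub>R q j"
    and mono: "\<And>i j. (i :: 'k) \<le> j \<Longrightarrow> \<mu> j \<le> \<mu> i" by metis
  have Aq: "(A *v q i) \<bullet> (A *v q j) = (if i = j then \<mu> j else 0)" for i j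
    using eig[of j] q[of i j]
    by (simp add: inner_matrix_vector matrix_vector_mul_assoc)
  have \<mu>_nonneg: "0 \<le> \<mu> j" for j
    using Aq[of j j] inner_ge_zero[of "A *v q j"] by simp
  define s where "s = (\<chi> j. sqrt (\<mu> j))"
  define J0 where "J0 = {j. \<mu> j > 0}"
  have *: "(A *v q i /\<^sub>R s $ i) \<bullet> (A *v q j /\<^sub>R s $ j) = (if i = j then 1 else 0)"
    if "i \<in> J0" "j \<in> J0" for i j
    using that by (auto simp: Aq s_def J0_def field_simps)
  have "J0 \<inter> - J0 = {}" "card (J0 \<union> - J0) \<le> DIM(real^'d)" using assms by auto
  from orthonormal_family_extend[of J0 "\<lambda>j. A *v q j /\<^sub>R s $ j", OF _ * _ this]
  obtain p where p0: "\<And>j. j \<in> J0 \<Longrightarrow> p j = A *v q j /\<^sub>R s $ j"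
    and p: "\<And>i j. p i \<bullet> p j = (if i = j then 1 else 0)" by auto
  have Aqp: "A *v q j = s $ j *\<^sub>R p j" for j
  proof (cases "j \<in> J0")
    case False
    then have "\<mu> j = 0" using \<mu>_nonneg[of j] by (auto simp: J0_def)
    then show ?thesis using Aq[of j j] by (simp add: s_def)
  qed (auto simp: p0 J0_def s_def)
  define P Q where "P = (\<chi> r j. p j $ r)" and "Q = (\<chi> r j. q j $ r)"
  have col: "column j P = p j" "column j Q = q j" for j
    by (simp_all add: P_def Q_def column_def vec_eq_iff)
  have PP: "transpose P ** P = mat 1"
    by (simp add: vec_eq_iff transpose_mult_entry col p mat_def)
  have QQ: "transpose Q ** Q = mat 1"
    by (simp add: vec_eq_iff transpose_mult_entry col q mat_def)
  then have orth: "orthogonal_matrix Q" by (simp add: orthogonal_matrix)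
  have "(A ** Q) $ r $ j = (P ** diag_mat s) $ r $ j" for r j
  proof -
    have "(A ** Q) $ r $ j = (A *v q j) $ r"
      by (simp add: matrix_matrix_mult_def matrix_vector_mult_def Q_def)
    also have "\<dots> = (P ** diag_mat s) $ r $ j"
      by (simp add: Aqp matrix_matrix_mult_def P_def diag_mat_def if_distrib[of "(*) _"] cong: if_cong)
    finally show ?thesis .
  qed
  then have "A ** Q = P ** diag_mat s" by (simp add: vec_eq_iff)
  then have "A ** (Q ** transpose Q) = P ** diag_mat s ** transpose Q"
    by (simp add: matrix_mul_assoc)
  then have "A = P ** diag_mat s ** transpose Q"
    using orth by (simp add: orthogonal_matrix_def)
  moreover have "0 \<le> s $ j" for j by (simp add: s_def \<mu>_nonneg)
  moreover have "s $ j \<le> s $ i" if "i \<le> j" for i j using mono[OF that] by (simp add: s_def)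
  ultimately show ?thesis using PP orth unfolding thin_svd_def by blast
qed

section \<open>Perturbation of leading eigenspaces\<close>

lemma inner_mat_1: "(mat 1 :: real^'k^'k) \<bullet> mat 1 = real CARD('k)"
  by (simp add: inner_matrix_def mat_def if_distrib cong: if_cong)

lemma norm_isometry_mult:
  assumes "transpose P ** P = mat 1"
  shows "norm ((P :: real^'l^'d) ** (A :: real^'k^'l)) = norm A"
  by (simp add: norm_eq_sqrt_inner inner_mult_left matrix_mul_assoc assms)

lemma norm_mult_isometry_transpose:
  assumes "transpose Q ** Q = mat 1"
  shows "norm ((A :: real^'l^'m) ** transpose (Q :: real^'l^'k)) = norm A"
  by (simp add: norm_eq_sqrt_inner inner_mult_right matrix_mul_assoc[symmetric] assms)

lemma norm_stiefel_sq:
  assumes "transpose U ** U = (mat 1 :: real^'k^'k)"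
  shows "(norm (U :: real^'k^'d))\<^sup>2 = real CARD('k)"
  using norm_isometry_mult[OF assms, of "mat 1 :: real^'k^'k"]
  by (simp add: power2_norm_eq_inner inner_mat_1 norm_eq_sqrt_inner)

text \<open>
  Pythagoras for the orthogonal projection \<open>U U\<^sup>T\<close>. It bounds \<open>U\<^sup>T x\<close> and computes the
  reconstruction error.
\<close>

lemma projection_residual:
  fixes U :: "real^'k^'d"
  assumes "transpose U ** U = mat 1"
  shows "(norm (x - (U ** transpose U) *v x))\<^sup>2 = (norm x)\<^sup>2 - (norm (transpose U *v x))\<^sup>2"
proof -
  let ?y = "(U ** transpose U) *v x"
  have "x \<bullet> ?y = (transpose U *v x) \<bullet> (transpose U *v x)"
    by (metis inner_matrix_vector inner_commute matrix_vector_mul_assoc)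
  moreover have "(U *v z) \<bullet> (U *v z) = z \<bullet> z" for z
  proof -
    have "(U *v z) \<bullet> (U *v z) = z \<bullet> (transpose U *v (U *v z))" by (rule inner_matrix_vector)
    then show ?thesis by (simp only: matrix_vector_mul_assoc assms matrix_vector_mul_lid)
  qed
  from this[of "transpose U *v x"]
  have "?y \<bullet> ?y = (transpose U *v x) \<bullet> (transpose U *v x)"
    by (simp only: matrix_vector_mul_assoc)
  ultimately show ?thesis
    by (simp add: power2_norm_eq_inner inner_diff inner_commute)
qed

lemma norm_transpose_stiefel_le:
  fixes U :: "real^'k^'d"
  assumes "transpose U ** U = mat 1"
  shows "norm (transpose U *v x) \<le> norm x"
  using projection_residual[OF assms, of x]
  by (metis diff_ge_0_iff_ge norm_ge_zero power2_le_imp_le zero_le_power2)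

lemma diag_mat_mult_entry: "(diag_mat s ** A) $ i $ j = s $ i * (A :: real^'k^'m) $ i $ j"
  by (simp add: matrix_matrix_mult_def diag_mat_def if_distrib[of "\<lambda>x. x * _"] cong: if_cong)

lemma mult_diag_mat_entry: "((A :: real^'k^'m) ** diag_mat s) $ i $ j = A $ i $ j * s $ j"
  by (simp add: matrix_matrix_mult_def diag_mat_def if_distrib cong: if_cong)

lemma norm_vec_row_sq: "(norm ((A :: real^'k^'m) $ i))\<^sup>2 = (\<Sum>j\<in>UNIV. (A $ i $ j)\<^sup>2)"
  unfolding power2_norm_eq_inner by (simp add: inner_vec_def power2_eq_square)

lemma norm_sq_rows: "(norm (A :: real^'k^'m))\<^sup>2 = (\<Sum>i\<in>UNIV. (norm (A $ i))\<^sup>2)"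
  by (simp add: norm_matrix_sq norm_vec_row_sq)

lemma inner_diag_mat_mult:
  "(A :: real^'k^'m) \<bullet> (diag_mat s ** A) = (\<Sum>i\<in>UNIV. s $ i * (norm (A $ i))\<^sup>2)"
  by (simp add: inner_matrix_def diag_mat_mult_entry norm_vec_row_sq sum_distrib_left)
    (simp add: power2_eq_square mult_ac)

text \<open>
  An orthonormal basis of eigenvectors of \<open>S\<close>, cut into two blocks of columns. The locale is
  interpreted both for the population and for the sample matrix.
\<close>

locale eigen_splitting =
  fixes V :: "real^'k^'d" and W :: "real^'m^'d"
    and S :: "real^'d^'d" and \<mu> :: "real^'k" and \<nu> :: "real^'m"
  assumes VV: "transpose V ** V = mat 1" and WW: "transpose W ** W = mat 1"
    and VW: "transpose V ** W = 0" and complete: "V ** transpose V + W ** transpose W = mat 1"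
    and SV: "S ** V = V ** diag_mat \<mu>" and SW: "S ** W = W ** diag_mat \<nu>"
begin

lemma WV: "transpose W ** V = 0"
proof -
  have "transpose W ** V = transpose (transpose V ** W)" by (simp add: matrix_transpose_mul)
  then show ?thesis by (simp add: VW) (simp add: transpose_def vec_eq_iff)
qed

lemma decompose: "U = V ** (transpose V ** U) + W ** (transpose W ** (U :: real^'l^'d))"
proof -
  have "U = (V ** transpose V + W ** transpose W) ** U" by (simp add: complete)
  then show ?thesis by (simp add: matrix_mult.add_left matrix_mul_assoc)
qed

lemma norm_decompose: "(norm (U :: real^'l^'d))\<^sup>2 = (norm (transpose V ** U))\<^sup>2 + (norm (transpose W ** U))\<^sup>2"
proof -
  have "U \<bullet> U = (transpose V ** U) \<bullet> (transpose V ** U) + (transpose W ** U) \<bullet> (transpose W ** U)"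
    using arg_cong[OF decompose[of U], of "\<lambda>X. X \<bullet> U"]
    by (simp only: inner_add_left inner_mult_left)
  then show ?thesis by (simp add: power2_norm_eq_inner)
qed

lemma quadratic_form:
  "U \<bullet> (S ** U) = (\<Sum>j\<in>UNIV. \<mu> $ j * (norm ((transpose V ** U) $ j))\<^sup>2)
    + (\<Sum>i\<in>UNIV. \<nu> $ i * (norm ((transpose W ** (U :: real^'l^'d)) $ i))\<^sup>2)"
proof -
  have "S ** U = V ** (diag_mat \<mu> ** (transpose V ** U)) + W ** (diag_mat \<nu> ** (transpose W ** U))"
    using arg_cong[OF decompose[of U], of "\<lambda>X. S ** X"]
    by (simp add: matrix_mult.add_right matrix_mul_assoc SV SW)
  then have "(S ** U) \<bullet> U = (diag_mat \<mu> ** (transpose V ** U)) \<bullet> (transpose V ** U)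
    + (diag_mat \<nu> ** (transpose W ** U)) \<bullet> (transpose W ** U)"
    by (simp only: inner_add_left inner_mult_left)
  then have "U \<bullet> (S ** U) = (transpose V ** U) \<bullet> (diag_mat \<mu> ** (transpose V ** U))
    + (transpose W ** U) \<bullet> (diag_mat \<nu> ** (transpose W ** U))"
    by (simp only: inner_commute)
  then show ?thesis by (simp add: inner_diag_mat_mult)
qed

lemma quadratic_form_top: "V \<bullet> (S ** V) = (\<Sum>j\<in>UNIV. \<mu> $ j)"
proof -
  have "norm ((mat 1 :: real^'k^'k) $ j) = 1" for j
  proof -
    have "(norm ((mat 1 :: real^'k^'k) $ j))\<^sup>2 = 1"
      unfolding norm_vec_row_sq by (simp add: mat_def if_distrib[of "\<lambda>x. x\<^sup>2"] cong: if_cong)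
    then show ?thesis by (simp add: power2_eq_1_iff) (metis norm_ge_zero neg_0_le_iff_le not_one_le_zero)
  qed
  then show ?thesis unfolding quadratic_form VV WV by simp
qed

text \<open>
  The Ky Fan maximum principle with a quantitative margin. The squared row norms of \<open>V\<^sup>T U\<close> are at
  most \<open>1\<close>, and their total deficit from \<open>1\<close> equals the mass \<open>|W\<^sup>T U|\<^sup>2\<close> that was moved to the
  trailing block. Moving a unit of mass costs at least \<open>a - b\<close>. With \<open>a = b\<close> this is optimality of
  \<open>V\<close>, with \<open>a > b\<close> it measures the distance of \<open>U\<close> from the optimum.
\<close>

lemma ky_fan_gap:
  fixes U :: "real^'k^'d"
  assumes U: "transpose U ** U = mat 1"
    and top: "\<And>j. a \<le> \<mu> $ j" and bot: "\<And>i. \<nu> $ i \<le> b"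
  shows "(a - b) * (norm (transpose W ** U))\<^sup>2 \<le> V \<bullet> (S ** V) - U \<bullet> (S ** U)"
proof -
  let ?a = "\<lambda>j. (norm ((transpose V ** U) $ j))\<^sup>2" and ?b = "\<lambda>i. (norm ((transpose W ** U) $ i))\<^sup>2"
  have row: "?a j \<le> 1" for j
  proof -
    have "(transpose V ** U) $ j = transpose U *v column j V"
      by (simp add: vec_eq_iff matrix_matrix_mult_def matrix_vector_mult_def transpose_def
          column_def mult.commute)
    then have "norm ((transpose V ** U) $ j) \<le> norm (column j V)"
      by (simp only: norm_transpose_stiefel_le[OF U])
    also have "norm (column j V) = 1"
      using arg_cong[OF VV, of "\<lambda>A. A $ j $ j"]
      by (simp add: transpose_mult_entry mat_def norm_eq_1)
    finally show ?thesis by (simp add: power_le_one)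
  qed
  have total: "(\<Sum>j\<in>UNIV. 1 - ?a j) = (norm (transpose W ** U))\<^sup>2"
    using norm_decompose[of U] norm_stiefel_sq[OF U]
    by (simp add: sum_subtractf norm_sq_rows[of "transpose V ** U"])
  have "(a - b) * (norm (transpose W ** U))\<^sup>2
      = (\<Sum>j\<in>UNIV. a * (1 - ?a j)) - (\<Sum>i\<in>UNIV. b * ?b i)"
    unfolding sum_distrib_left[symmetric] total
    by (simp add: norm_sq_rows[of "transpose W ** U"] algebra_simps)
  also have "\<dots> \<le> (\<Sum>j\<in>UNIV. \<mu> $ j * (1 - ?a j)) - (\<Sum>i\<in>UNIV. \<nu> $ i * ?b i)"
    using row top bot by (intro diff_mono sum_mono mult_right_mono) auto
  also have "\<dots> = V \<bullet> (S ** V) - U \<bullet> (S ** U)"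
    unfolding quadratic_form_top quadratic_form[of U] by (simp add: algebra_simps sum_subtractf)
  finally show ?thesis .
qed

text \<open>
  A Davis-Kahan type bound obtained from optimality alone: \<open>V'\<close> is at least as good as \<open>V\<close> for \<open>S'\<close>,
  so its loss for \<open>S\<close> is at most the change of the two quadratic forms. The bound is linear in the
  perturbation and quadratic in \<open>W\<^sup>T V'\<close>; it is not of the sharp order, but it is all that
  consistency requires.
\<close>

lemma leading_subspace_perturbation:
  fixes V' :: "real^'k^'d"
  assumes "eigen_splitting V' W' S' \<mu>' \<nu>'"
    and "\<And>j. c \<le> \<mu>' $ j" "\<And>i. \<nu>' $ i \<le> c"
    and top: "\<And>j. a \<le> \<mu> $ j" and bot: "\<And>i. \<nu> $ i \<le> b"
  shows "(a - b) * (norm (transpose W ** V'))\<^sup>2 \<le> 2 * real CARD('k) * norm (S' - S)"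
proof -
  interpret P: eigen_splitting V' W' S' \<mu>' \<nu>' by fact
  have quad: "\<bar>U \<bullet> ((S' - S) ** U)\<bar> \<le> real CARD('k) * norm (S' - S)"
    if U: "transpose U ** U = mat 1" for U :: "real^'k^'d"
  proof -
    have "\<bar>U \<bullet> ((S' - S) ** U)\<bar> \<le> norm U * norm ((S' - S) ** U)" by (rule Cauchy_Schwarz_ineq2)
    also have "\<dots> \<le> norm U * (norm (S' - S) * norm U)"
      by (intro mult_left_mono norm_matrix_mult_le) auto
    also have "\<dots> = real CARD('k) * norm (S' - S)"
      using norm_stiefel_sq[OF U] by (simp add: power2_eq_square mult_ac)
    finally show ?thesis .
  qed
  have "(a - b) * (norm (transpose W ** V'))\<^sup>2 \<le> V \<bullet> (S ** V) - V' \<bullet> (S ** V')"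
    by (rule ky_fan_gap[OF P.VV top bot])
  \<comment> \<open>optimality of \<open>V'\<close> for \<open>S'\<close>: the principle with equal thresholds\<close>
  moreover have "0 \<le> V' \<bullet> (S' ** V') - V \<bullet> (S' ** V)"
    using P.ky_fan_gap[OF VV assms(2,3)] by simp
  ultimately show ?thesis
    using quad[OF VV] quad[OF P.VV] by (simp add: matrix_mult.diff_left inner_diff_right)
qed

end

section \<open>Subspaces as graphs\<close>

text \<open>
  If \<open>V\<^sup>T U\<close> is invertible with inverse \<open>C\<close>, then the span of \<open>U\<close> is the graph
  \<open>{V x + W (T x)}\<close> of the map \<open>T\<close>, an affine chart of the Grassmannian around the span of \<open>V\<close>.
\<close>

locale graph_coordinates = eigen_splitting V W S \<mu> \<nu>
  for V :: "real^'k^'d" and W :: "real^'m^'d" and S \<mu> \<nu> +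
  fixes U :: "real^'k^'d" and C :: "real^'k^'k" and T :: "real^'k^'m"
  assumes U: "transpose U ** U = mat 1"
    and inv: "transpose V ** U ** C = mat 1"
    and T_def: "T = transpose W ** U ** C"
begin

lemma inv': "C ** (transpose V ** U) = mat 1"
  using inv by (simp add: matrix_left_right_inverse)

lemma T_mult: "T ** (transpose V ** U) = transpose W ** U"
  by (simp add: T_def matrix_mul_assoc[symmetric] inv')

lemma graph: "U = (V + W ** T) ** (transpose V ** U)"
  using decompose[of U] by (simp only: matrix_mult.add_left matrix_mul_assoc[symmetric] T_mult)

lemma UC: "U ** C = V + W ** T"
proof -
  have "U ** C = (V + W ** T) ** (transpose V ** U) ** C" by (simp only: graph[symmetric])
  also have "\<dots> = (V + W ** T) ** (transpose V ** U ** C)" by (simp add: matrix_mul_assoc)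
  finally show ?thesis by (simp add: inv)
qed

text \<open>
  With \<open>N = V + W T\<close>, a frame of the same invariant subspace of \<open>S'\<close>, the equation \<open>S' N = N F\<close>
  compressed by \<open>V\<^sup>T\<close> gives \<open>F = V\<^sup>T S' N\<close> and compressed by \<open>W\<^sup>T\<close> gives \<open>W\<^sup>T S' N = T F\<close>.
  Eliminating \<open>F\<close> removes the empirical eigenvalues. The left-hand side below is linear in \<open>T\<close> and
  \<open>S' - S\<close>; every term on the right has a factor \<open>S' - S\<close> and a factor \<open>T\<close>.
\<close>

lemma graph_riccati:
  assumes "S' ** U = U ** D"
  shows "T ** diag_mat \<mu> - diag_mat \<nu> ** T - transpose W ** (S' - S) ** V
    = transpose W ** (S' - S) ** W ** T - T ** (transpose V ** (S' - S) ** V)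
      - T ** (transpose V ** (S' - S) ** W ** T)"
proof -
  define N where "N = V + W ** T"
  define F where "F = transpose V ** U ** D ** C"
  define E where "E = S' - S"
  have VN: "transpose V ** N = mat 1"
    by (simp add: N_def matrix_mult.add_right matrix_mul_assoc VV VW matrix_mult.zero_left)
  have WN: "transpose W ** N = T"
    by (simp add: N_def matrix_mult.add_right matrix_mul_assoc WW WV)
  have "S' ** N = U ** D ** C" by (simp add: N_def UC[symmetric] matrix_mul_assoc assms)
  also have "\<dots> = N ** F"
    using arg_cong[OF graph, of "\<lambda>X. X ** (D ** C)"]
    by (simp only: F_def N_def matrix_mul_assoc)
  finally have SN: "S' ** N = N ** F" .
  have "transpose W ** (S' ** N) = T ** (transpose V ** (S' ** N))"
    by (simp add: SN matrix_mul_assoc VN WN)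
  moreover have "S' ** N = V ** diag_mat \<mu> + W ** diag_mat \<nu> ** T + E ** V + E ** W ** T"
  proof -
    have "S' ** N = S ** N + E ** N" by (simp add: E_def matrix_mult.diff_left)
    then show ?thesis
      by (simp add: N_def matrix_mult.add_right matrix_mul_assoc SV SW)
  qed
  ultimately have "diag_mat \<nu> ** T + transpose W ** E ** V + transpose W ** E ** W ** T
    = T ** (diag_mat \<mu> + transpose V ** E ** V + transpose V ** E ** W ** T)"
    by (simp add: matrix_mult.add_right matrix_mul_assoc VV WW VW WV matrix_mult.zero_left)
  then show ?thesis
    by (simp add: E_def[symmetric] matrix_mult.add_right algebra_simps)
qed

lemma norm_graph_sq: "(norm C)\<^sup>2 = real CARD('k) + (norm T)\<^sup>2"
  using norm_decompose[of "U ** C"] norm_isometry_mult[OF U, of C]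
  by (simp add: matrix_mul_assoc inv T_def[symmetric] power2_norm_eq_inner inner_mat_1)

text \<open>
  Since \<open>U C = V + W T\<close> and \<open>U\<close> is isometric, \<open>|C|\<^sup>2 = k + |T|\<^sup>2\<close>; combine this with
  \<open>|T| \<le> |W\<^sup>T U| |C|\<close>.
\<close>

lemma norm_graph_le:
  "(norm T)\<^sup>2 * (1 - (norm (transpose W ** U))\<^sup>2) \<le> real CARD('k) * (norm (transpose W ** U))\<^sup>2"
proof -
  have "norm T \<le> norm (transpose W ** U) * norm C" unfolding T_def by (rule norm_matrix_mult_le)
  then have "(norm T)\<^sup>2 \<le> (norm (transpose W ** U))\<^sup>2 * (norm C)\<^sup>2"
    by (metis norm_ge_zero power_mono power_mult_distrib)
  then show ?thesis by (simp add: norm_graph_sq algebra_simps)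
qed

text \<open>
  Orthonormality of \<open>U\<close> reads \<open>A\<^sup>T (1 + T\<^sup>T T) A = 1\<close>, so that \<open>M = A A\<^sup>T\<close> is the inverse of
  \<open>1 + T\<^sup>T T\<close>. Both blocks of the quadratic form are functions of \<open>M\<close> and \<open>T\<close>, and expanding \<open>M\<close> to
  second order in \<open>T\<close> leaves the weighted sum of squares.
\<close>

lemma risk_expansion:
  "\<bar>V \<bullet> (S ** V) - U \<bullet> (S ** U) - (\<Sum>i\<in>UNIV. \<Sum>j\<in>UNIV. (\<mu> $ j - \<nu> $ i) * (T $ i $ j)\<^sup>2)\<bar>
    \<le> real CARD('k) * (norm (diag_mat \<mu>) + norm (diag_mat \<nu>)) * norm T ^ 4"
proof -
  define A where "A = transpose V ** U"
  define M where "M = A ** transpose A"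
  define R where "R = transpose T ** T"
  let ?I = "mat 1 :: real^'k^'k"
  have B: "transpose W ** U = T ** A" by (simp add: A_def T_mult)
  have AC: "A ** C = ?I" "C ** A = ?I" using inv inv' by (simp_all add: A_def)
  have "transpose U ** U = transpose A ** A + transpose (T ** A) ** (T ** A)"
  proof -
    have "U = V ** A + W ** (T ** A)" using decompose[of U] by (simp add: A_def[symmetric] B)
    moreover have "transpose (V ** A + W ** (T ** A)) ** (V ** A + W ** (T ** A))
      = transpose A ** (transpose V ** V) ** A + transpose A ** (transpose V ** W) ** (T ** A)
       + (transpose (T ** A) ** (transpose W ** V) ** A + transpose (T ** A) ** (transpose W ** W) ** (T ** A))"
      by (simp add: transpose_add matrix_transpose_mul matrix_mult.add_left matrix_mult.add_right matrix_mul_assoc)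
    ultimately show ?thesis by (simp add: VV WW VW WV matrix_mult.zero_left matrix_mult.zero_right)
  qed
  moreover have "transpose A ** (?I + R) ** A
      = transpose A ** A + transpose (T ** A) ** (T ** A)"
    by (simp add: R_def matrix_transpose_mul matrix_mult.add_left matrix_mult.add_right matrix_mul_assoc)
  ultimately have *: "transpose A ** (?I + R) ** A = ?I" using U by simp
  have "transpose A ** (?I + R) = transpose A ** (?I + R) ** (A ** C)" by (simp add: AC)
  also have "\<dots> = C" by (simp only: matrix_mul_assoc * matrix_mul_lid)
  finally have "transpose A ** (?I + R) = C" .
  then have "M ** (?I + R) = ?I" by (simp add: M_def matrix_mul_assoc[symmetric] AC)
  then have IM: "?I - M = M ** R" by (simp add: matrix_mult.add_right algebra_simps)
  then have IM2: "R - M ** R = M ** R ** R"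
    by (metis matrix_mult.diff_left matrix_mul_lid)
  \<comment> \<open>both error terms are of fourth order in \<open>T\<close>\<close>
  have normR: "norm R \<le> (norm T)\<^sup>2"
    unfolding R_def using norm_matrix_mult_le[of "transpose T" T]
    by (simp add: norm_transpose power2_eq_square)
  have normM: "norm M \<le> real CARD('k)"
  proof -
    have "(norm A)\<^sup>2 \<le> real CARD('k)"
      using norm_decompose[of U] norm_stiefel_sq[OF U] by (simp add: A_def)
    moreover have "norm M \<le> (norm A)\<^sup>2"
      unfolding M_def using norm_matrix_mult_le[of A "transpose A"]
      by (simp add: norm_transpose power2_eq_square)
    ultimately show ?thesis by simp
  qed
  have quad1: "A \<bullet> (diag_mat \<mu> ** A) = diag_mat \<mu> \<bullet> M"
    unfolding M_def by (metis inner_commute inner_mult_right transpose_transpose)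
  have quad2: "(T ** A) \<bullet> (diag_mat \<nu> ** (T ** A)) = diag_mat \<nu> \<bullet> (T ** M ** transpose T)"
  proof -
    have "(T ** A) \<bullet> (diag_mat \<nu> ** (T ** A)) = diag_mat \<nu> \<bullet> ((T ** A) ** transpose (T ** A))"
      by (metis inner_commute inner_mult_right transpose_transpose)
    then show ?thesis by (simp add: M_def matrix_transpose_mul matrix_mul_assoc)
  qed
  have US: "U \<bullet> (S ** U) = diag_mat \<mu> \<bullet> M + diag_mat \<nu> \<bullet> (T ** M ** transpose T)"
    unfolding quadratic_form inner_diag_mat_mult[symmetric] A_def[symmetric] B quad1 quad2 ..
  have VS: "V \<bullet> (S ** V) = diag_mat \<mu> \<bullet> ?I"
    unfolding quadratic_form_top
    by (simp add: inner_matrix_def diag_mat_def mat_def if_distrib cong: if_cong)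
  have main1: "diag_mat \<mu> \<bullet> R = (\<Sum>i\<in>UNIV. \<Sum>j\<in>UNIV. \<mu> $ j * (T $ i $ j)\<^sup>2)"
  proof -
    have "diag_mat \<mu> \<bullet> R = transpose T \<bullet> (diag_mat \<mu> ** transpose T)"
      unfolding R_def by (metis inner_commute inner_mult_right transpose_transpose)
    also have "\<dots> = (\<Sum>i\<in>UNIV. \<mu> $ i * (\<Sum>j\<in>UNIV. (T $ j $ i)\<^sup>2))"
      by (simp add: inner_diag_mat_mult norm_vec_row_sq) (simp add: transpose_def)
    also have "\<dots> = (\<Sum>i\<in>UNIV. \<Sum>j\<in>UNIV. \<mu> $ j * (T $ i $ j)\<^sup>2)"
      unfolding sum_distrib_left by (rule sum.swap)
    finally show ?thesis .
  qed
  have main2: "diag_mat \<nu> \<bullet> (T ** transpose T) = (\<Sum>i\<in>UNIV. \<Sum>j\<in>UNIV. \<nu> $ i * (T $ i $ j)\<^sup>2)"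
  proof -
    have "diag_mat \<nu> \<bullet> (T ** transpose T) = T \<bullet> (diag_mat \<nu> ** T)"
      by (metis inner_commute inner_mult_right transpose_transpose)
    then show ?thesis by (simp add: inner_diag_mat_mult norm_vec_row_sq sum_distrib_left)
  qed
  have "V \<bullet> (S ** V) - U \<bullet> (S ** U)
      = diag_mat \<mu> \<bullet> (?I - M) - diag_mat \<nu> \<bullet> (T ** M ** transpose T)"
    by (simp add: US VS inner_diff_right)
  also have "?I - M = R - M ** R ** R" using IM IM2 by (simp add: algebra_simps)
  also have "T ** M ** transpose T = T ** transpose T - T ** (M ** R) ** transpose T"
    unfolding IM[symmetric] by (simp add: matrix_mult.diff_left matrix_mult.diff_right)
  finally have "V \<bullet> (S ** V) - U \<bullet> (S ** U)
      - (\<Sum>i\<in>UNIV. \<Sum>j\<in>UNIV. (\<mu> $ j - \<nu> $ i) * (T $ i $ j)\<^sup>2)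
      = diag_mat \<nu> \<bullet> (T ** (M ** R) ** transpose T) - diag_mat \<mu> \<bullet> (M ** R ** R)"
    by (simp add: inner_diff_right main1 main2 sum_subtractf left_diff_distrib)
  moreover have "\<bar>diag_mat \<nu> \<bullet> (T ** (M ** R) ** transpose T)\<bar>
      \<le> norm (diag_mat \<nu>) * (norm T * (real CARD('k) * (norm T)\<^sup>2) * norm T)"
    by (intro order.trans[OF Cauchy_Schwarz_ineq2] mult_left_mono order.trans[OF norm_matrix_mult_le]
        mult_mono mult_nonneg_nonneg normM normR norm_ge_zero) (auto simp: norm_transpose)
  moreover have "\<bar>diag_mat \<mu> \<bullet> (M ** R ** R)\<bar>
      \<le> norm (diag_mat \<mu>) * (real CARD('k) * (norm T)\<^sup>2 * (norm T)\<^sup>2)"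
    by (intro order.trans[OF Cauchy_Schwarz_ineq2] mult_left_mono order.trans[OF norm_matrix_mult_le]
        mult_mono mult_nonneg_nonneg normM normR norm_ge_zero) auto
  moreover have "norm (diag_mat \<nu>) * (norm T * (real CARD('k) * (norm T)\<^sup>2) * norm T)
      + norm (diag_mat \<mu>) * (real CARD('k) * (norm T)\<^sup>2 * (norm T)\<^sup>2)
      = real CARD('k) * (norm (diag_mat \<mu>) + norm (diag_mat \<nu>)) * norm T ^ 4"
    by (simp add: algebra_simps power2_eq_square power4_eq_xxxx)
  ultimately show ?thesis by linarith
qed

end

section \<open>Eigenbases, principal angles and the lifted logarithm\<close>

lemma column_cols_from: "column j (cols_from l v) = v (l + pos j)"
  by (simp add: column_def cols_from_def vec_eq_iff)

lemma mult_cols_eqI: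
  assumes "\<And>j. S *v column j V = s $ j *\<^sub>R column j V"
  shows "S ** V = (V :: real^'k^'d) ** diag_mat s"
proof -
  have "(S ** V) $ r $ j = (V ** diag_mat s) $ r $ j" for r j
  proof -
    have "(S ** V) $ r $ j = (S *v column j V) $ r"
      by (simp add: matrix_matrix_mult_def matrix_vector_mult_def column_def)
    then show ?thesis by (simp add: assms mult_diag_mat_entry) (simp add: column_def)
  qed
  then show ?thesis by (simp add: vec_eq_iff)
qed

lemma mult_transpose_vector:
  "(V ** transpose V) *v x = (\<Sum>j\<in>UNIV. (x \<bullet> column j V) *\<^sub>R column j (V :: real^'k^'d))"
proof -
  have "(V ** transpose V) *v x = V *v (\<chi> j. x \<bullet> column j V)"
  proof -
    have "transpose V *v x = (\<chi> j. x \<bullet> column j V)"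
      unfolding vec_eq_iff matrix_vector_mult_def transpose_def column_def inner_vec_def
      by (simp add: mult.commute)
    then show ?thesis by (simp only: matrix_vector_mul_assoc[symmetric])
  qed
  then show ?thesis by (simp add: matrix_mult_sum scalar_mult_eq_scaleR)
qed

lemma sum_pos_shift:
  "(\<Sum>j\<in>UNIV. g (l + pos (j :: 'n::{finite,linorder}))) = (\<Sum>i\<in>{l + 1..l + CARD('n)}. g i)"
proof (rule sum.reindex_bij_betw)
  have "bij_betw ((+) l) {1..CARD('n)} {l + 1..l + CARD('n)}"
    by (auto simp: bij_betw_def image_add_atLeastAtMost)
  from bij_betw_trans[OF bij_betw_pos this]
  show "bij_betw (\<lambda>j :: 'n. l + pos j) UNIV {l + 1..l + CARD('n)}"
    by (simp add: o_def)
qed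

text \<open>
  Orthogonality relations and eigenvalue equations are immediate from the columns; completeness
  \<open>V V\<^sup>T + W W\<^sup>T = 1\<close> holds because \<open>CARD('d)\<close> orthonormal vectors span the space.
\<close>

lemma eigenbasis_splitting:
  fixes S :: "real^'d^'d"
  assumes dim: "CARD('d) = CARD('k::{finite,linorder}) + CARD('m::{finite,linorder})"
    and eig: "ordered_eigenbasis S v \<mu>"
  shows "eigen_splitting (cols_from 0 v :: real^'k::{finite,linorder}^'d) (cols_from CARD('k) v :: real^'m::{finite,linorder}^'d) S
    (\<chi> j. \<mu> (pos j)) (\<chi> i. \<mu> (CARD('k) + pos i))"
proof -
  let ?V = "cols_from 0 v :: real^'k::{finite,linorder}^'d" and ?W = "cols_from CARD('k) v :: real^'m::{finite,linorder}^'d"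
  have orth: "v i \<bullet> v j = (if i = j then 1 else 0)" if "i \<in> {1..CARD('d)}" "j \<in> {1..CARD('d)}" for i j
    using eig that unfolding ordered_eigenbasis_def by blast
  have ev: "S *v v j = \<mu> j *\<^sub>R v j" if "j \<in> {1..CARD('d)}" for j
    using eig that unfolding ordered_eigenbasis_def by blast
  have rk: "pos j \<in> {1..CARD('k)}" for j :: 'k
    using bij_betw_pos[where 'n='k] by (auto simp: bij_betw_def)
  have rm: "pos j \<in> {1..CARD('m)}" for j :: 'm
    using bij_betw_pos[where 'n='m] by (auto simp: bij_betw_def)
  have ik: "pos j \<in> {1..CARD('d)}" for j :: 'k using rk[of j] dim by auto
  have im: "CARD('k) + pos j \<in> {1..CARD('d)}" for j :: 'm using rm[of j] dim by auto
  have injk: "pos i = pos j \<longleftrightarrow> i = j" for i j :: 'k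
    using bij_betw_pos[where 'n='k] by (auto simp: bij_betw_def inj_on_def)
  have injm: "pos i = pos j \<longleftrightarrow> i = j" for i j :: 'm
    using bij_betw_pos[where 'n='m] by (auto simp: bij_betw_def inj_on_def)
  have ne: "pos i \<noteq> CARD('k) + pos j" for i :: 'k and j :: 'm
    using rk[of i] rm[of j] by auto
  show ?thesis
  proof
    show "transpose ?V ** ?V = mat 1"
      by (simp add: vec_eq_iff transpose_mult_entry column_cols_from orth[OF ik ik] injk mat_def)
    show "transpose ?W ** ?W = mat 1"
      by (simp add: vec_eq_iff transpose_mult_entry column_cols_from orth[OF im im] injm mat_def)
    show "transpose ?V ** ?W = 0"
      by (simp add: vec_eq_iff transpose_mult_entry column_cols_from orth[OF ik im] ne)
    show "S ** ?V = ?V ** diag_mat (\<chi> j. \<mu> (pos j))"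
      by (rule mult_cols_eqI) (simp add: column_cols_from ev[OF ik])
    show "S ** ?W = ?W ** diag_mat (\<chi> i. \<mu> (CARD('k) + pos i))"
      by (rule mult_cols_eqI) (simp add: column_cols_from ev[OF im])
    show "?V ** transpose ?V + ?W ** transpose ?W = mat 1"
    proof -
      let ?B = "v ` {1..CARD('d)}"
      have inj: "inj_on v {1..CARD('d)}"
        by (rule inj_onI) (metis orth zero_neq_one)
      have pw: "pairwise orthogonal ?B"
        using orth by (auto simp: pairwise_def orthogonal_def)
      have n1: "norm b = 1" if "b \<in> ?B" for b using that orth by (auto simp: norm_eq_1)
      have "0 \<notin> ?B" using n1[of 0] by fastforce
      then have ind: "independent ?B" by (rule pairwise_orthogonal_independent[OF pw])
      have "card ?B = DIM(real^'d)" using inj by (simp add: card_image)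
      then have sp: "span ?B = UNIV"
        using ind card_eq_dim[of ?B "UNIV :: (real^'d) set"] by (auto simp: dim_UNIV)
      have "(?V ** transpose ?V + ?W ** transpose ?W) *v x = mat 1 *v x" for x
      proof -
        have "(?V ** transpose ?V + ?W ** transpose ?W) *v x
          = (\<Sum>i\<in>{0 + 1..0 + CARD('k)}. (x \<bullet> v i) *\<^sub>R v i)
          + (\<Sum>i\<in>{CARD('k) + 1..CARD('k) + CARD('m)}. (x \<bullet> v i) *\<^sub>R v i)"
          unfolding sum_pos_shift[symmetric]
          by (simp add: matrix_vector_mult_add_rdistrib mult_transpose_vector column_cols_from)
        also have "\<dots> = (\<Sum>i\<in>{1..CARD('d)}. (x \<bullet> v i) *\<^sub>R v i)"
          unfolding dim by (subst sum.union_disjoint[symmetric]) (auto intro!: sum.cong)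
        also have "\<dots> = (\<Sum>b\<in>?B. (x \<bullet> b) *\<^sub>R b)" using inj by (simp add: sum.reindex)
        also have "\<dots> = x" using pw n1 sp by (intro orthonormal_basis_expand) auto
        finally show ?thesis by simp
      qed
      then show ?thesis by (simp add: matrix_eq)
    qed
  qed
qed

lemma norm_diag_mat: "norm (diag_mat s) = norm (s :: real^'k)"
proof (rule power2_eq_imp_eq)
  have entry: "(diag_mat s $ i $ j)\<^sup>2 = (if i = j then (s $ i)\<^sup>2 else 0)" for i j
    by (simp add: diag_mat_def)
  have "(norm (diag_mat s))\<^sup>2 = (\<Sum>i\<in>UNIV. (s $ i)\<^sup>2)"
    by (simp add: norm_matrix_sq entry)
  also have "\<dots> = (norm s)\<^sup>2"
    unfolding power2_norm_eq_inner by (simp add: inner_vec_def power2_eq_square)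
  finally show "(norm (diag_mat s))\<^sup>2 = (norm s)\<^sup>2" .
qed auto

lemma thin_svd_norm:
  assumes "thin_svd A P s Q"
  shows "norm (P ** diag_mat t ** transpose Q) = norm t"
  using assms
  by (simp add: thin_svd_def orthogonal_matrix norm_mult_isometry_transpose norm_isometry_mult norm_diag_mat)

text \<open>
  The lower bound is cheap: the derivative of \<open>s^3 - s + arctan s\<close> is nonnegative.
\<close>

lemma arctan_cubic:
  fixes s :: real
  assumes "0 \<le> s"
  shows "arctan s \<le> s" "s - arctan s \<le> s ^ 3"
proof -
  have "(\<lambda>x. x - arctan x) 0 \<le> (\<lambda>x. x - arctan x) s"
    using assms
  proof (rule DERIV_nonneg_imp_nondecreasing)
    fix x :: real
    have "((\<lambda>x. x - arctan x) has_real_derivative (1 - inverse (1 + x\<^sup>2))) (at x)"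
      by (auto intro!: derivative_eq_intros)
    moreover have "0 \<le> 1 - inverse (1 + x\<^sup>2)" by (simp add: inverse_le_1_iff)
    ultimately show "\<exists>y. ((\<lambda>x. x - arctan x) has_real_derivative y) (at x) \<and> 0 \<le> y" by blast
  qed
  then show "arctan s \<le> s" by simp
  have "(\<lambda>x. x ^ 3 - x + arctan x) 0 \<le> (\<lambda>x. x ^ 3 - x + arctan x) s"
    using assms
  proof (rule DERIV_nonneg_imp_nondecreasing)
    fix x :: real
    have "((\<lambda>x. x ^ 3 - x + arctan x) has_real_derivative (3 * x\<^sup>2 - 1 + inverse (1 + x\<^sup>2))) (at x)"
      by (auto intro!: derivative_eq_intros)
    moreover have "0 \<le> 3 * x\<^sup>2 - 1 + inverse (1 + x\<^sup>2)"
    proof -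
      have p: "0 < 1 + x\<^sup>2" by (simp add: add_pos_nonneg)
      then have "3 * x\<^sup>2 - 1 + inverse (1 + x\<^sup>2) = (2 * x\<^sup>2 + 3 * x\<^sup>2 * x\<^sup>2) / (1 + x\<^sup>2)"
        by (simp add: field_simps)
      also have "\<dots> \<ge> 0" using p by (intro divide_nonneg_pos) auto
      finally show ?thesis .
    qed
    ultimately show "\<exists>y. ((\<lambda>x. x ^ 3 - x + arctan x) has_real_derivative y) (at x) \<and> 0 \<le> y" by blast
  qed
  then show "s - arctan s \<le> s ^ 3" by simp
qed

lemma matrix_inv_eqI:
  fixes A B :: "real^'k^'k"
  assumes "A ** B = mat 1"
  shows "matrix_inv A = B"
proof -
  have BA: "B ** A = mat 1" using assms matrix_left_right_inverse by blast
  have inv: "A ** matrix_inv A = mat 1 \<and> matrix_inv A ** A = mat 1"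
    unfolding matrix_inv_def by (rule someI[of _ B]) (simp add: assms BA)
  have "matrix_inv A = (B ** A) ** matrix_inv A" by (simp only: BA matrix_mul_lid)
  also have "\<dots> = B ** (A ** matrix_inv A)" by (rule matrix_mul_assoc[symmetric])
  also have "\<dots> = B" using inv by (simp only: matrix_mul_rid)
  finally show ?thesis .
qed

text \<open>
  The matrix whose singular value decomposition defines the logarithm is exactly \<open>W T\<close>, for every
  representative of the class of \<open>U\<close>. Whichever decomposition is chosen, the logarithm and \<open>W T\<close>
  share their singular vectors and differ by \<open>arctan s - s\<close> on the diagonal.
\<close>

lemma lift_log_graph:
  fixes V U :: "real^'k::{finite,linorder}^'d" and T :: "real^'k::{finite,linorder}^'m"
  assumes "graph_coordinates V W S \<mu> \<nu> U C T" and card: "CARD('k) \<le> CARD('d)"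
  shows "norm (lift_log V (gr U) - W ** T) \<le> norm T ^ 3"
proof -
  interpret graph_coordinates V W S \<mu> \<nu> U C T by fact
  have "U \<in> stiefel" by (simp add: stiefel_def U)
  from rep_gr[OF this] obtain Q where Q: "orthogonal_matrix Q" "rep (gr U) = U ** Q"
    by (auto simp: gr_rel_def)
  have QQ: "Q ** transpose Q = mat 1" using Q(1) by (simp add: orthogonal_matrix_def)
  have inv_eq: "matrix_inv (transpose V ** (U ** Q)) = transpose Q ** C"
  proof (rule matrix_inv_eqI)
    have "transpose V ** (U ** Q) ** (transpose Q ** C) = transpose V ** U ** (Q ** transpose Q) ** C"
      by (simp add: matrix_mul_assoc)
    then show "transpose V ** (U ** Q) ** (transpose Q ** C) = mat 1" by (simp add: QQ inv)
  qed
  have proj: "mat 1 - V ** transpose V = W ** transpose W"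
    using complete by (simp add: algebra_simps)
  have "(mat 1 - V ** transpose V) ** (U ** Q) ** (transpose Q ** C)
      = W ** transpose W ** U ** (Q ** transpose Q) ** C"
    by (simp only: proj matrix_mul_assoc)
  then have WT: "(mat 1 - V ** transpose V) ** rep (gr U) ** matrix_inv (transpose V ** rep (gr U)) = W ** T"
    unfolding Q(2) inv_eq by (simp add: QQ T_def matrix_mul_assoc)
  define svd where "svd = (SOME (P, s, Q). thin_svd (W ** T) P s Q)"
  have "\<exists>x. case x of (P, s, Q) \<Rightarrow> thin_svd (W ** T) P s Q"
    using thin_svd_exists[OF card, of "W ** T"] by auto
  then have "case svd of (P, s, Q) \<Rightarrow> thin_svd (W ** T) P s Q"
    unfolding svd_def by (rule someI_ex)
  then obtain P s Q' where svd: "svd = (P, s, Q')" "thin_svd (W ** T) P s Q'"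
    by (cases svd) auto
  have lift: "lift_log V (gr U) = P ** diag_mat (\<chi> j. arctan (s $ j)) ** transpose Q'"
    unfolding lift_log_def Let_def WT svd_def[symmetric] svd(1) by simp
  have WT': "W ** T = P ** diag_mat s ** transpose Q'" using svd(2) by (simp add: thin_svd_def)
  then have norm_s: "norm s = norm T"
    using thin_svd_norm[OF svd(2), of s] norm_isometry_mult[OF WW, of T] by simp
  let ?t = "(\<chi> j. arctan (s $ j)) - s"
  have "lift_log V (gr U) - W ** T = P ** diag_mat ?t ** transpose Q'"
  proof -
    have "diag_mat ?t = diag_mat (\<chi> j. arctan (s $ j)) - diag_mat s"
      by (simp add: diag_mat_def vec_eq_iff)
    then show ?thesis by (simp add: lift WT' matrix_mult.diff_left matrix_mult.diff_right)
  qed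
  then have "norm (lift_log V (gr U) - W ** T) = norm ?t"
    using thin_svd_norm[OF svd(2)] by simp
  also have "\<dots> \<le> norm ((norm s)\<^sup>2 *\<^sub>R s)"
  proof (rule norm_le_componentwise_cart)
    fix j
    have s0: "0 \<le> s $ j" using svd(2) by (simp add: thin_svd_def)
    have "norm (?t $ j) \<le> s $ j ^ 3" using arctan_cubic[OF s0] by simp
    also have "\<dots> = (s $ j)\<^sup>2 * s $ j" by (simp add: power2_eq_square power3_eq_cube)
    also have "\<dots> \<le> (norm s)\<^sup>2 * s $ j"
      using s0 component_le_norm_cart[of s j] by (intro mult_right_mono power_mono) auto
    finally show "norm (?t $ j) \<le> norm (((norm s)\<^sup>2 *\<^sub>R s) $ j)" using s0 by simp
  qed
  also have "\<dots> = norm T ^ 3" by (simp add: norm_s power2_eq_square power3_eq_cube)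
  finally show ?thesis .
qed

lemma stiefel_mult_orthogonal:
  assumes "transpose U ** U = mat 1" "orthogonal_matrix Q"
  shows "transpose (U ** Q) ** (U ** Q) = (mat 1 :: real^'k^'k)"
proof -
  have "transpose (U ** Q) ** (U ** Q) = transpose Q ** (transpose U ** U) ** Q"
    by (simp add: matrix_transpose_mul matrix_mul_assoc)
  then show ?thesis using assms by (simp add: orthogonal_matrix)
qed

lemma stiefel_overlap_entry_le:
  fixes U V :: "real^'k^'d"
  assumes "transpose U ** U = mat 1" "transpose V ** V = mat 1"
  shows "(transpose V ** U) $ i $ j \<le> 1"
proof -
  have "norm (column i V) = 1" "norm (column j U) = 1"
    using arg_cong[OF assms(1), of "\<lambda>A. A $ j $ j"] arg_cong[OF assms(2), of "\<lambda>A. A $ i $ i"]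
    by (simp_all add: transpose_mult_entry mat_def norm_eq_1)
  then show ?thesis
    using norm_cauchy_schwarz[of "column i V" "column j U"] by (simp add: transpose_mult_entry)
qed

text \<open>
  For whichever decomposition the choice operator picks, \<open>\<Sum> s j\<^sup>2\<close> is the squared norm of the
  overlap matrix, which does not depend on representatives, and each \<open>s j\<close> is at most \<open>1\<close> as
  an inner product of unit vectors. Hence each single deficit \<open>1 - s j\<^sup>2\<close> is bounded by their sum.
\<close>

lemma singular_values_overlap:
  fixes U V :: "real^'k::{finite,linorder}^'d"
  assumes U: "transpose U ** U = mat 1" and V: "transpose V ** V = mat 1"
    and s: "s = singular_values (transpose (rep (gr V)) ** rep (gr U))"
  shows "0 \<le> s $ j" "s $ j \<le> 1" "1 - (s $ j)\<^sup>2 \<le> real CARD('k) - (norm (transpose V ** U))\<^sup>2"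
proof -
  have "U \<in> stiefel" "V \<in> stiefel" using U V by (simp_all add: stiefel_def)
  then obtain Q1 Q2 where Q: "orthogonal_matrix Q1" "rep (gr V) = V ** Q1"
    "orthogonal_matrix Q2" "rep (gr U) = U ** Q2"
    using rep_gr[of U] rep_gr[of V] by (auto simp: gr_rel_def)
  define N where "N = transpose (V ** Q1) ** (U ** Q2)"
  have "\<exists>s P Q. thin_svd N P s Q" using thin_svd_exists[of N] by blast
  then have "\<exists>P Q. thin_svd N P (singular_values N) Q"
    unfolding singular_values_def by (rule someI_ex[where P = "\<lambda>s. \<exists>P Q. thin_svd N P s Q"])
  moreover have "s = singular_values N" unfolding s Q N_def ..
  ultimately have "\<exists>P Q. thin_svd N P s Q" by simp
  then obtain P Q' where svd: "thin_svd N P s Q'" by blast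
  have Neq: "N = P ** diag_mat s ** transpose Q'" and PP: "orthogonal_matrix P"
    and QQ: "orthogonal_matrix Q'" and s0: "\<And>j. 0 \<le> s $ j"
    using svd by (simp_all add: thin_svd_def orthogonal_matrix)
  show "0 \<le> s $ j" by (rule s0)
  have le1: "s $ j \<le> 1" for j
  proof -
    have "transpose (V ** Q1 ** P) ** (U ** Q2 ** Q') = transpose P ** N ** Q'"
      by (simp add: N_def matrix_transpose_mul matrix_mul_assoc)
    also have "\<dots> = (transpose P ** P) ** diag_mat s ** (transpose Q' ** Q')"
      by (simp add: Neq matrix_mul_assoc)
    also have "\<dots> = diag_mat s" using PP QQ by (simp add: orthogonal_matrix)
    finally have "(transpose (V ** Q1 ** P) ** (U ** Q2 ** Q')) $ j $ j = s $ j"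
      by (simp add: diag_mat_def)
    then show ?thesis
      using stiefel_overlap_entry_le[of "U ** Q2 ** Q'" "V ** Q1 ** P" j j] U V Q PP QQ
      by (simp add: stiefel_mult_orthogonal)
  qed
  then show "s $ j \<le> 1" .
  have "norm s = norm N" using thin_svd_norm[OF svd, of s] Neq by simp
  also have "N = transpose Q1 ** (transpose V ** U) ** transpose (transpose Q2)"
    by (simp add: N_def matrix_transpose_mul matrix_mul_assoc)
  also have "norm \<dots> = norm (transpose Q1 ** (transpose V ** U))"
    using Q(3) by (intro norm_mult_isometry_transpose) (simp add: orthogonal_matrix_def)
  also have "\<dots> = norm (transpose V ** U)"
    using Q(1) by (intro norm_isometry_mult) (simp add: orthogonal_matrix_def)
  finally have ns: "norm s = norm (transpose V ** U)" .
  have "1 - (s $ j)\<^sup>2 \<le> (\<Sum>j\<in>UNIV. 1 - (s $ j)\<^sup>2)"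
    using s0 le1 by (intro member_le_sum) (auto simp: power_le_one)
  also have "\<dots> = real CARD('k) - (norm s)\<^sup>2"
    unfolding power2_norm_eq_inner by (simp add: inner_vec_def sum_subtractf power2_eq_square)
  finally show "1 - (s $ j)\<^sup>2 \<le> real CARD('k) - (norm (transpose V ** U))\<^sup>2" by (simp add: ns)
qed

lemma principal_angle_le:
  fixes U V :: "real^'k::{finite,linorder}^'d"
  assumes U: "transpose U ** U = mat 1" and V: "transpose V ** V = mat 1"
    and \<eta>: "real CARD('k) - (norm (transpose V ** U))\<^sup>2 \<le> \<eta>" "\<eta> \<le> 1"
  shows "0 \<le> principal_angle (gr V) (gr U) j" "principal_angle (gr V) (gr U) j \<le> arccos (sqrt (1 - \<eta>))"
proof -
  let ?s = "singular_values (transpose (rep (gr V)) ** rep (gr U))"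
  note s = singular_values_overlap[OF U V refl, of j]
  show "0 \<le> principal_angle (gr V) (gr U) j"
    using s unfolding principal_angle_def by (intro arccos_lbound) auto
  have "1 - \<eta> \<le> (?s $ j)\<^sup>2" using s(3) \<eta> by simp
  then have "sqrt (1 - \<eta>) \<le> ?s $ j" using s(1) by (simp add: real_le_lsqrt)
  moreover have "0 \<le> sqrt (1 - \<eta>)" using \<eta> by simp
  ultimately show "principal_angle (gr V) (gr U) j \<le> arccos (sqrt (1 - \<eta>))"
    using s(2) unfolding principal_angle_def by (intro arccos_le_arccos) linarith+
qed

lemma gr_dist_le:
  fixes U V :: "real^'k::{finite,linorder}^'d"
  assumes "transpose U ** U = mat 1" "transpose V ** V = mat 1"
    and "real CARD('k) - (norm (transpose V ** U))\<^sup>2 \<le> \<eta>" "\<eta> \<le> 1"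
  shows "0 \<le> gr_dist (gr V) (gr U)" "gr_dist (gr V) (gr U) \<le> sqrt (real CARD('k)) * arccos (sqrt (1 - \<eta>))"
proof -
  note pa = principal_angle_le[OF assms]
  have "(\<Sum>j\<in>UNIV. (principal_angle (gr V) (gr U) j)\<^sup>2) \<le> (\<Sum>j\<in>(UNIV :: 'k set). (arccos (sqrt (1 - \<eta>)))\<^sup>2)"
    using pa by (intro sum_mono power_mono) auto
  also have "\<dots> = real CARD('k) * (arccos (sqrt (1 - \<eta>)))\<^sup>2" by simp
  finally have "gr_dist (gr V) (gr U) \<le> sqrt (real CARD('k) * (arccos (sqrt (1 - \<eta>)))\<^sup>2)"
    unfolding gr_dist_def by (rule real_sqrt_le_mono)
  also have "\<dots> = sqrt (real CARD('k)) * arccos (sqrt (1 - \<eta>))"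
    using order.trans[OF pa] by (simp add: real_sqrt_mult abs_of_nonneg)
  finally show "gr_dist (gr V) (gr U) \<le> sqrt (real CARD('k)) * arccos (sqrt (1 - \<eta>))" .
qed (simp add: gr_dist_def sum_nonneg)

section \<open>The reconstruction risk as a quadratic form\<close>

lemma norm_outer: "norm (outer x) = (norm (x :: real^'d))\<^sup>2"
proof (rule power2_eq_imp_eq)
  have "(norm x)\<^sup>2 = (\<Sum>r\<in>UNIV. (x $ r)\<^sup>2)"
    unfolding power2_norm_eq_inner by (simp add: inner_vec_def power2_eq_square)
  then have "((norm x)\<^sup>2)\<^sup>2 = (\<Sum>i\<in>UNIV. \<Sum>j\<in>UNIV. (x $ i)\<^sup>2 * (x $ j)\<^sup>2)"
    unfolding power2_eq_square[of "(norm x)\<^sup>2"] by (simp only: sum_product)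
  then show "(norm (outer x))\<^sup>2 = ((norm x)\<^sup>2)\<^sup>2"
    unfolding norm_matrix_sq outer_def by (simp add: power_mult_distrib)
qed auto

lemma continuous_on_outer: "continuous_on UNIV (outer :: real^'d \<Rightarrow> real^'d^'d)"
  unfolding outer_def by (intro continuous_intros continuous_on_vec_lambda)

lemma measurable_outer [measurable]: "outer \<in> borel_measurable borel"
  by (rule borel_measurable_continuous_onI[OF continuous_on_outer])

lemma integrable_outer:
  fixes X :: "'a \<Rightarrow> real^'d"
  assumes "X \<in> borel_measurable M" "integrable M (\<lambda>\<omega>. (norm (X \<omega>))\<^sup>2)"
  shows "integrable M (\<lambda>\<omega>. outer (X \<omega>))"
  using assms(2) by (rule Bochner_Integration.integrable_bound) (use assms(1) in \<open>auto simp: norm_outer\<close>)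

lemma mult_outer_mult_entry:
  "(transpose W ** outer x ** V) $ i $ j = (column i W \<bullet> x) * (column j V \<bullet> x)"
proof -
  have "(transpose W ** outer x ** V) $ i $ j
    = (\<Sum>c\<in>UNIV. \<Sum>r\<in>UNIV. (W $ r $ i * x $ r) * (V $ c $ j * x $ c))"
    by (simp add: matrix_matrix_mult_def transpose_def outer_def sum_distrib_right sum_distrib_left mult_ac)
  also have "\<dots> = (column i W \<bullet> x) * (column j V \<bullet> x)"
    by (subst sum.swap) (simp add: column_def inner_vec_def sum_product)
  finally show ?thesis .
qed

lemma inner_outer_mult: "U \<bullet> (outer x ** U) = (norm (transpose U *v x))\<^sup>2"
proof -
  have "U \<bullet> (outer x ** U) = (\<Sum>j\<in>UNIV. \<Sum>r\<in>UNIV. U $ r $ j * (outer x ** U) $ r $ j)"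
    unfolding inner_matrix_def by (rule sum.swap)
  also have "\<dots> = (\<Sum>j\<in>UNIV. (\<Sum>r\<in>UNIV. U $ r $ j * x $ r) * (\<Sum>c\<in>UNIV. U $ c $ j * x $ c))"
    unfolding sum_product
    by (simp add: matrix_matrix_mult_def outer_def sum_distrib_left mult_ac)
  also have "\<dots> = (norm (transpose U *v x))\<^sup>2"
    unfolding power2_norm_eq_inner inner_vec_def[of "transpose U *v x"]
    unfolding matrix_vector_mult_def transpose_def by simp
  finally show ?thesis .
qed

text \<open>
  By Pythagoras the risk is affine in the second moment matrix, so that excess risks are differences
  of quadratic forms.
\<close>

lemma recon_risk_eq:
  fixes U :: "real^'k^'d"
  assumes X: "X \<in> borel_measurable M" "integrable M (\<lambda>\<omega>. (norm (X \<omega>))\<^sup>2)"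
    and U: "transpose U ** U = mat 1"
  shows "recon_risk M X (gr U) = 1/2 * ((\<integral>\<omega>. (norm (X \<omega>))\<^sup>2 \<partial>M) - U \<bullet> (second_moment M X ** U))"
proof -
  have bl: "bounded_linear (\<lambda>A. U \<bullet> (A ** U))"
    by (rule bounded_linear_compose[OF bounded_linear_inner_right matrix_mult.bounded_linear_left])
  note io = integrable_outer[OF X]
  have "recon_risk M X (gr U) = 1/2 * (\<integral>\<omega>. (norm (X \<omega>))\<^sup>2 - U \<bullet> (outer (X \<omega>) ** U) \<partial>M)"
    using U by (simp add: recon_risk_gr stiefel_def projection_residual inner_outer_mult
        del: transpose_matrix_vector)
  also have "(\<integral>\<omega>. (norm (X \<omega>))\<^sup>2 - U \<bullet> (outer (X \<omega>) ** U) \<partial>M)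
      = (\<integral>\<omega>. (norm (X \<omega>))\<^sup>2 \<partial>M) - (\<integral>\<omega>. U \<bullet> (outer (X \<omega>) ** U) \<partial>M)"
    by (intro Bochner_Integration.integral_diff X integrable_bounded_linear[OF bl io])
  also have "(\<integral>\<omega>. U \<bullet> (outer (X \<omega>) ** U) \<partial>M) = U \<bullet> (second_moment M X ** U)"
    unfolding second_moment_def by (rule integral_bounded_linear[OF bl io])
  finally show ?thesis .
qed

section \<open>First-order expansions of the logarithm and of the risk\<close>

definition scale_entries :: "('m \<Rightarrow> 'k \<Rightarrow> real) \<Rightarrow> real^'k^'m \<Rightarrow> real^'k^'m" where
  "scale_entries c G = (\<chi> i j. c i j * G $ i $ j)"

lemma scale_entries_nth [simp]: "scale_entries c G $ i $ j = c i j * G $ i $ j"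
  by (simp add: scale_entries_def)

lemma linear_scale_entries: "linear (scale_entries c)"
  by (intro linearI) (simp_all add: vec_eq_iff algebra_simps)

text \<open>
  Entrywise multiplication by \<open>\<delta>\<close> is the linear part of the Riccati equation, and multiplication by
  \<open>1 / \<delta>\<close> its inverse, which is bounded by the reciprocal of the eigengap.
\<close>

lemma norm_scale_entries_le:
  assumes "\<And>i j. \<bar>c i j\<bar> \<le> \<kappa>"
  shows "norm (scale_entries c G) \<le> \<kappa> * norm G"
proof (rule power2_le_imp_le)
  have \<kappa>: "0 \<le> \<kappa>" using order.trans[OF abs_ge_zero assms] .
  then show "0 \<le> \<kappa> * norm G" by simp
  have "(scale_entries c G $ i $ j)\<^sup>2 \<le> \<kappa>\<^sup>2 * (G $ i $ j)\<^sup>2" for i j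
    unfolding power_mult_distrib scale_entries_nth using power_mono[OF assms[of i j], of 2] by (intro mult_right_mono) auto
  then show "(norm (scale_entries c G))\<^sup>2 \<le> (\<kappa> * norm G)\<^sup>2"
    unfolding power_mult_distrib norm_matrix_sq sum_distrib_left by (intro sum_mono)
qed

text \<open>
  If \<open>V\<^sup>T U x = 0\<close> then \<open>|x| = |U x| = |W\<^sup>T U x|\<close>, which forces \<open>x = 0\<close> as soon as \<open>|W\<^sup>T U| < 1\<close>.
\<close>

lemma (in eigen_splitting) graph_coordinates_exist:
  assumes U: "transpose U ** U = mat 1" and small: "(norm (transpose W ** U))\<^sup>2 < 1"
  shows "graph_coordinates V W S \<mu> \<nu> U (matrix_inv (transpose V ** U))
    (transpose W ** U ** matrix_inv (transpose V ** U))"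
proof -
  have "x = 0" if x: "(transpose V ** U) *v x = 0" for x
  proof -
    define X :: "real^'k^'k" where "X = (\<chi> i j. x $ i)"
    have AX: "transpose V ** U ** X = 0"
      using x by (simp add: X_def vec_eq_iff matrix_matrix_mult_def matrix_vector_mult_def)
    have "(norm X)\<^sup>2 = (norm (U ** X))\<^sup>2" by (simp add: norm_isometry_mult[OF U])
    also have "\<dots> = (norm (transpose W ** U ** X))\<^sup>2"
      unfolding norm_decompose[of "U ** X"] by (simp add: matrix_mul_assoc AX)
    also have "\<dots> \<le> (norm (transpose W ** U))\<^sup>2 * (norm X)\<^sup>2"
      using norm_matrix_mult_le[of "transpose W ** U" X]
      by (metis norm_ge_zero power_mono power_mult_distrib)
    finally have "(1 - (norm (transpose W ** U))\<^sup>2) * (norm X)\<^sup>2 \<le> 0" by (simp add: algebra_simps)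
    then have "(norm X)\<^sup>2 \<le> 0" using small by (simp add: mult_le_0_iff)
    then have "X = 0" by simp
    then show "x = 0" by (simp add: X_def vec_eq_iff)
  qed
  then have "\<exists>C. C ** (transpose V ** U) = mat 1"
    by (simp add: matrix_left_invertible_ker)
  then obtain C where "(transpose V ** U) ** C = mat 1"
    by (auto simp: matrix_left_right_inverse)
  then have "transpose V ** U ** matrix_inv (transpose V ** U) = mat 1"
    using matrix_inv_eqI by metis
  with U show ?thesis by unfold_locales auto
qed

context graph_coordinates
begin

lemma sylvester_entries:
  "T ** diag_mat \<mu> - diag_mat \<nu> ** T = scale_entries (\<lambda>i j. \<mu> $ j - \<nu> $ i) T"
  by (simp add: vec_eq_iff mult_diag_mat_entry diag_mat_mult_entry algebra_simps)

text \<open>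
  The Riccati remainder is at most \<open>\<rho> |T|\<close>. Once \<open>\<rho>\<close> is below half the eigengap, the remainder can be
  absorbed, which bounds \<open>T\<close> by \<open>Y\<close> and turns the error into \<open>\<rho> |Y|\<close>.
\<close>

lemma graph_first_order:
  assumes eq: "S' ** U = U ** D" and gap: "\<And>i j. \<gamma> \<le> \<mu> $ j - \<nu> $ i" and \<gamma>: "\<gamma> > 0"
    and \<rho>: "\<rho> = norm (transpose W ** (S' - S) ** W) + norm (transpose V ** (S' - S) ** V)
      + norm (transpose V ** (S' - S) ** W) * norm T" "\<rho> \<le> \<gamma> / 2"
    and Y: "Y = transpose W ** (S' - S) ** V"
  shows "\<gamma> * norm T \<le> 2 * norm Y"
    and "norm (scale_entries (\<lambda>i j. \<mu> $ j - \<nu> $ i) T - Y) \<le> 2 / \<gamma> * \<rho> * norm Y"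
proof -
  let ?\<delta> = "\<lambda>i j. \<mu> $ j - \<nu> $ i"
  have \<delta>: "?\<delta> i j > 0" for i j using gap[of j i] \<gamma> by linarith
  have \<rho>0: "0 \<le> \<rho>" by (simp add: \<rho>)
  have "scale_entries ?\<delta> T - Y = transpose W ** (S' - S) ** W ** T - T ** (transpose V ** (S' - S) ** V)
      - T ** (transpose V ** (S' - S) ** W ** T)"
    using graph_riccati[OF eq] unfolding sylvester_entries Y .
  also have "norm \<dots> \<le> norm (transpose W ** (S' - S) ** W) * norm T
      + norm T * norm (transpose V ** (S' - S) ** V)
      + norm T * (norm (transpose V ** (S' - S) ** W) * norm T)"
    by (intro order.trans[OF norm_triangle_ineq4] add_mono norm_matrix_mult_le
        order.trans[OF norm_matrix_mult_le] mult_left_mono) auto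
  also have "\<dots> = \<rho> * norm T" by (simp add: \<rho> algebra_simps)
  finally have R: "norm (scale_entries ?\<delta> T - Y) \<le> \<rho> * norm T" .
  have "T = scale_entries (\<lambda>i j. 1 / ?\<delta> i j) (scale_entries ?\<delta> T)"
    using \<delta> by (simp add: vec_eq_iff less_imp_neq[symmetric])
  moreover have "norm (scale_entries (\<lambda>i j. 1 / ?\<delta> i j) (scale_entries ?\<delta> T))
      \<le> 1 / \<gamma> * norm (scale_entries ?\<delta> T)"
    using \<delta> gap \<gamma> by (intro norm_scale_entries_le) (auto simp: abs_of_pos intro!: divide_left_mono)
  ultimately have "\<gamma> * norm T \<le> norm (scale_entries ?\<delta> T)"
    using \<gamma> by (simp add: field_simps)
  also have "\<dots> \<le> norm Y + norm (scale_entries ?\<delta> T - Y)" by (rule norm_triangle_sub)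
  also have "\<dots> \<le> norm Y + \<gamma> / 2 * norm T"
    using R mult_right_mono[OF \<rho>(2) norm_ge_zero[of T]] by linarith
  finally show T: "\<gamma> * norm T \<le> 2 * norm Y" by simp
  then have "norm T \<le> 2 / \<gamma> * norm Y" using \<gamma> by (simp add: field_simps)
  from mult_left_mono[OF this \<rho>0] R
  show "norm (scale_entries ?\<delta> T - Y) \<le> 2 / \<gamma> * \<rho> * norm Y" by (simp add: mult_ac)
qed

text \<open>
  The quartic error of \<open>risk_expansion\<close> is \<open>|T|\<^sup>2\<close> times \<open>O(|Y|\<^sup>2)\<close>. Replacing \<open>D = \<delta> T\<close> by \<open>Y\<close> in the
  quadratic form with weights \<open>1 / \<delta>\<close> costs \<open>(D - Y) \<bullet> (D + Y) / \<delta>\<close>, where \<open>|D - Y| = O(\<rho> |Y|)\<close> and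
  \<open>|D + Y| \<le> 3 |Y|\<close>.
\<close>

lemma risk_first_order:
  assumes eq: "S' ** U = U ** D" and gap: "\<And>i j. \<gamma> \<le> \<mu> $ j - \<nu> $ i" and \<gamma>: "\<gamma> > 0"
    and \<rho>: "\<rho> = norm (transpose W ** (S' - S) ** W) + norm (transpose V ** (S' - S) ** V)
      + norm (transpose V ** (S' - S) ** W) * norm T" "\<rho> \<le> \<gamma> / 2"
    and Y: "Y = transpose W ** (S' - S) ** V"
  shows "\<bar>V \<bullet> (S ** V) - U \<bullet> (S ** U)
      - (norm (scale_entries (\<lambda>i j. 1 / sqrt (\<mu> $ j - \<nu> $ i)) Y))\<^sup>2\<bar>
    \<le> (real CARD('k) * (norm (diag_mat \<mu>) + norm (diag_mat \<nu>)) * (4 / \<gamma>\<^sup>2) * (norm T)\<^sup>2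
       + 6 / \<gamma>\<^sup>2 * \<rho>) * (norm Y)\<^sup>2"
proof -
  let ?\<delta> = "\<lambda>i j. \<mu> $ j - \<nu> $ i"
  let ?c = "real CARD('k) * (norm (diag_mat \<mu>) + norm (diag_mat \<nu>))"
  have \<delta>: "?\<delta> i j > 0" for i j using gap[of j i] \<gamma> by linarith
  note fo = graph_first_order[OF eq gap \<gamma> \<rho> Y]
  define D where "D = scale_entries ?\<delta> T"
  have DT: "(\<Sum>i\<in>UNIV. \<Sum>j\<in>UNIV. ?\<delta> i j * (T $ i $ j)\<^sup>2) = D \<bullet> scale_entries (\<lambda>i j. 1 / ?\<delta> i j) D"
    using \<delta> by (simp add: inner_matrix_def D_def power2_eq_square less_imp_neq[symmetric] mult_ac)
  have YY: "(norm (scale_entries (\<lambda>i j. 1 / sqrt (?\<delta> i j)) Y))\<^sup>2 = Y \<bullet> scale_entries (\<lambda>i j. 1 / ?\<delta> i j) Y"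
    using \<delta> unfolding norm_matrix_sq inner_matrix_def
    by (simp add: power_mult_distrib power_divide less_imp_le) (simp add: power2_eq_square)
  have "D \<bullet> scale_entries (\<lambda>i j. 1 / ?\<delta> i j) D - Y \<bullet> scale_entries (\<lambda>i j. 1 / ?\<delta> i j) Y
      = (D - Y) \<bullet> scale_entries (\<lambda>i j. 1 / ?\<delta> i j) (D + Y)"
    unfolding inner_matrix_def sum_subtractf[symmetric]
    by (intro sum.cong refl) (simp add: diff_divide_distrib[symmetric] add_divide_distrib[symmetric] algebra_simps)
  also have "\<bar>\<dots>\<bar> \<le> norm (D - Y) * (1 / \<gamma> * norm (D + Y))"
    using \<delta> gap \<gamma>
    by (intro order.trans[OF Cauchy_Schwarz_ineq2] mult_left_mono norm_scale_entries_le)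
      (auto simp: abs_of_pos intro!: divide_left_mono)
  also have "\<dots> \<le> (2 / \<gamma> * \<rho> * norm Y) * (1 / \<gamma> * (3 * norm Y))"
  proof (intro mult_mono mult_left_mono)
    show DY: "norm (D - Y) \<le> 2 / \<gamma> * \<rho> * norm Y" unfolding D_def by (rule fo(2))
    have "norm (D + Y) \<le> norm (D - Y) + 2 * norm Y"
      using norm_triangle_ineq[of "D - Y" "Y + Y"] norm_triangle_ineq[of Y Y] by (simp add: add.commute)
    also have "2 / \<gamma> * \<rho> \<le> 1" using \<rho>(2) \<gamma> by (simp add: field_simps)
    then have "2 / \<gamma> * \<rho> * norm Y \<le> 1 * norm Y" by (intro mult_right_mono) auto
    then have "norm (D - Y) + 2 * norm Y \<le> 3 * norm Y" using DY by linarith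
    finally show "norm (D + Y) \<le> 3 * norm Y" .
  qed (use \<gamma> \<rho> in auto)
  also have "\<dots> = 6 / \<gamma>\<^sup>2 * \<rho> * (norm Y)\<^sup>2" by (simp add: power2_eq_square)
  finally have main: "\<bar>D \<bullet> scale_entries (\<lambda>i j. 1 / ?\<delta> i j) D - Y \<bullet> scale_entries (\<lambda>i j. 1 / ?\<delta> i j) Y\<bar>
      \<le> 6 / \<gamma>\<^sup>2 * \<rho> * (norm Y)\<^sup>2" .
  have "norm T ^ 4 = (norm T)\<^sup>2 * (norm T)\<^sup>2" by (simp flip: power_add)
  also have "\<dots> \<le> (norm T)\<^sup>2 * (4 / \<gamma>\<^sup>2 * (norm Y)\<^sup>2)"
  proof (rule mult_left_mono)
    have "norm T \<le> 2 / \<gamma> * norm Y" using fo(1) \<gamma> by (simp add: field_simps)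
    then have "(norm T)\<^sup>2 \<le> (2 / \<gamma> * norm Y)\<^sup>2" by (intro power_mono) auto
    then show "(norm T)\<^sup>2 \<le> 4 / \<gamma>\<^sup>2 * (norm Y)\<^sup>2" by (simp add: power_mult_distrib power_divide)
  qed simp
  finally have T4: "?c * norm T ^ 4 \<le> ?c * ((norm T)\<^sup>2 * (4 / \<gamma>\<^sup>2 * (norm Y)\<^sup>2))"
    by (intro mult_left_mono) auto
  have "\<bar>V \<bullet> (S ** V) - U \<bullet> (S ** U) - (norm (scale_entries (\<lambda>i j. 1 / sqrt (?\<delta> i j)) Y))\<^sup>2\<bar>
      \<le> ?c * norm T ^ 4 + 6 / \<gamma>\<^sup>2 * \<rho> * (norm Y)\<^sup>2"
    using risk_expansion main unfolding DT YY by linarith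
  also have "\<dots> \<le> ?c * ((norm T)\<^sup>2 * (4 / \<gamma>\<^sup>2 * (norm Y)\<^sup>2)) + 6 / \<gamma>\<^sup>2 * \<rho> * (norm Y)\<^sup>2"
    using T4 by (rule add_right_mono)
  also have "\<dots> = (?c * (4 / \<gamma>\<^sup>2) * (norm T)\<^sup>2 + 6 / \<gamma>\<^sup>2 * \<rho>) * (norm Y)\<^sup>2"
    by (simp only: distrib_right distrib_left mult_ac)
  finally show ?thesis .
qed

end

lemma lift_log_first_order:
  fixes V U :: "real^'k::{finite,linorder}^'d" and T :: "real^'k::{finite,linorder}^'m"
  assumes gc: "graph_coordinates V W S \<mu> \<nu> U C T" and card: "CARD('k) \<le> CARD('d)"
    and eq: "S' ** U = U ** D" and gap: "\<And>i j. \<gamma> \<le> \<mu> $ j - \<nu> $ i" and \<gamma>: "\<gamma> > 0"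
    and \<rho>: "\<rho> = norm (transpose W ** (S' - S) ** W) + norm (transpose V ** (S' - S) ** V)
      + norm (transpose V ** (S' - S) ** W) * norm T" "\<rho> \<le> \<gamma> / 2"
    and Y: "Y = transpose W ** (S' - S) ** V"
  shows "norm (lift_log V (gr U) - W ** scale_entries (\<lambda>i j. 1 / (\<mu> $ j - \<nu> $ i)) Y)
    \<le> (2 / \<gamma> * (norm T)\<^sup>2 + 2 / \<gamma>\<^sup>2 * \<rho>) * norm Y"
proof -
  interpret graph_coordinates V W S \<mu> \<nu> U C T by fact
  let ?\<delta> = "\<lambda>i j. \<mu> $ j - \<nu> $ i"
  have \<delta>: "?\<delta> i j > 0" for i j using gap[of j i] \<gamma> by linarith
  note fo = graph_first_order[OF eq gap \<gamma> \<rho> Y]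
  have "norm T \<le> 2 / \<gamma> * norm Y" using fo(1) \<gamma> by (simp add: field_simps)
  then have "(norm T)\<^sup>2 * norm T \<le> (norm T)\<^sup>2 * (2 / \<gamma> * norm Y)" by (intro mult_left_mono) auto
  then have cube: "norm T ^ 3 \<le> (norm T)\<^sup>2 * (2 / \<gamma> * norm Y)"
    by (simp add: power2_eq_square power3_eq_cube)
  have "T - scale_entries (\<lambda>i j. 1 / ?\<delta> i j) Y
      = scale_entries (\<lambda>i j. 1 / ?\<delta> i j) (scale_entries ?\<delta> T - Y)"
    using \<delta> by (simp add: vec_eq_iff right_diff_distrib less_imp_neq[symmetric])
  also have "norm \<dots> \<le> 1 / \<gamma> * norm (scale_entries ?\<delta> T - Y)"
    using \<delta> gap \<gamma> by (intro norm_scale_entries_le) (auto simp: abs_of_pos intro!: divide_left_mono)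
  also have "\<dots> \<le> 1 / \<gamma> * (2 / \<gamma> * \<rho> * norm Y)" using fo(2) \<gamma> by (intro mult_left_mono) auto
  finally have lin: "norm (T - scale_entries (\<lambda>i j. 1 / ?\<delta> i j) Y) \<le> 1 / \<gamma> * (2 / \<gamma> * \<rho> * norm Y)" .
  have "lift_log V (gr U) - W ** scale_entries (\<lambda>i j. 1 / ?\<delta> i j) Y
      = (lift_log V (gr U) - W ** T) + W ** (T - scale_entries (\<lambda>i j. 1 / ?\<delta> i j) Y)"
    by (simp add: matrix_mult.diff_right)
  then have "norm (lift_log V (gr U) - W ** scale_entries (\<lambda>i j. 1 / ?\<delta> i j) Y)
      \<le> norm (lift_log V (gr U) - W ** T) + norm (T - scale_entries (\<lambda>i j. 1 / ?\<delta> i j) Y)"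
    using norm_triangle_ineq by (metis norm_isometry_mult[OF WW])
  also have "\<dots> \<le> norm T ^ 3 + 1 / \<gamma> * (2 / \<gamma> * \<rho> * norm Y)"
    using lift_log_graph[OF gc card] lin by (intro add_mono)
  also have "\<dots> \<le> (norm T)\<^sup>2 * (2 / \<gamma> * norm Y) + 1 / \<gamma> * (2 / \<gamma> * \<rho> * norm Y)"
    using cube by simp
  also have "\<dots> = (2 / \<gamma> * (norm T)\<^sup>2 + 2 / \<gamma>\<^sup>2 * \<rho>) * norm Y"
    by (simp add: algebra_simps power2_eq_square)
  finally show ?thesis .
qed

lemma largest_angle_less:
  fixes U V :: "real^'k::{finite,linorder}^'d"
  assumes "transpose U ** U = mat 1" "transpose V ** V = mat 1"
    and "real CARD('k) - (norm (transpose V ** U))\<^sup>2 < 1"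
  shows "largest_angle (gr V) (gr U) < pi / 2"
proof -
  let ?\<eta> = "max 0 (real CARD('k) - (norm (transpose V ** U))\<^sup>2)"
  have "largest_angle (gr V) (gr U) \<le> arccos (sqrt (1 - ?\<eta>))"
    unfolding largest_angle_def using assms by (intro principal_angle_le) auto
  also have "\<dots> < arccos 0" using assms by (intro arccos_less_arccos) auto
  finally show ?thesis by simp
qed

section \<open>Convergence in outer probability, tightness and Slutsky\<close>

definition rarely_fails :: "'a measure \<Rightarrow> real \<Rightarrow> ('a \<Rightarrow> bool) \<Rightarrow> bool" where
  "rarely_fails M \<delta> P \<longleftrightarrow> (\<exists>A\<in>sets M. measure M A < \<delta> \<and> (\<forall>\<omega>\<in>space M - A. P \<omega>))"

text \<open>
  A property of pairs \<open>(n, \<omega>)\<close> holds eventually if the outer probability of its failure at time \<open>n\<close>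
  tends to \<open>0\<close>. Convergence along this filter is convergence in probability, without measurability
  requirements; the graph coordinate, which involves a matrix inverse, can be used as it is.
\<close>

definition in_prob :: "'a measure \<Rightarrow> (nat \<times> 'a) filter" where
  "in_prob M = Abs_filter (\<lambda>P. \<forall>\<delta>>0. \<forall>\<^sub>F n in sequentially. rarely_fails M \<delta> (\<lambda>\<omega>. P (n, \<omega>)))"

definition tight_seq :: "'a measure \<Rightarrow> (nat \<Rightarrow> 'a \<Rightarrow> 'b::real_normed_vector) \<Rightarrow> bool" where
  "tight_seq M Y \<longleftrightarrow>
     (\<forall>\<delta>>0. \<exists>R. \<forall>\<^sub>F n in sequentially. rarely_fails M \<delta> (\<lambda>\<omega>. norm (Y n \<omega>) \<le> R))"

lemma rarely_fails_mono:
  assumes "rarely_fails M \<delta> P" "\<And>\<omega>. \<omega> \<in> space M \<Longrightarrow> P \<omega> \<Longrightarrow> Q \<omega>"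
  shows "rarely_fails M \<delta> Q"
  using assms unfolding rarely_fails_def by blast

lemma rarely_fails_of_always:
  assumes "\<delta> > 0" "\<And>\<omega>. \<omega> \<in> space M \<Longrightarrow> P \<omega>"
  shows "rarely_fails M \<delta> P"
  using assms unfolding rarely_fails_def by (intro bexI[of _ "{}"]) auto

lemma rarely_fails_conj:
  assumes "rarely_fails M (\<delta> / 2) P" "rarely_fails M (\<delta> / 2) Q"
  shows "rarely_fails M \<delta> (\<lambda>\<omega>. P \<omega> \<and> Q \<omega>)"
proof -
  from assms obtain A B where "A \<in> sets M" "measure M A < \<delta> / 2" "\<forall>\<omega>\<in>space M - A. P \<omega>"
    "B \<in> sets M" "measure M B < \<delta> / 2" "\<forall>\<omega>\<in>space M - B. Q \<omega>"
    unfolding rarely_fails_def by blast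
  then show ?thesis
    using measure_Un_le[of A M B] unfolding rarely_fails_def by (intro bexI[of _ "A \<union> B"]) auto
qed

lemma rarely_fails_markov:
  fixes f :: "'a \<Rightarrow> real"
  assumes f: "integrable M f" "\<And>\<omega>. 0 \<le> f \<omega>" and "c > 0" and "(\<integral>\<omega>. f \<omega> \<partial>M) < c * \<delta>"
  shows "rarely_fails M \<delta> (\<lambda>\<omega>. f \<omega> < c)"
proof -
  let ?A = "{\<omega> \<in> space M. c \<le> f \<omega>}"
  have [measurable]: "f \<in> borel_measurable M" using f by auto
  have "measure M ?A \<le> (\<integral>\<omega>. f \<omega> \<partial>M) / c"
    using f \<open>c > 0\<close> by (intro integral_Markov_inequality_measure[where A = "space M"]) auto
  also have "\<dots> < \<delta>" using assms(3,4) by (simp add: field_simps)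
  finally show ?thesis
    unfolding rarely_fails_def by (intro bexI[of _ ?A]) auto
qed

context prob_space
begin

text \<open>
  Exceptional sets of measure below \<open>\<delta> / 2\<close> unite to one of measure below \<open>\<delta>\<close>, which makes the
  condition closed under conjunction.
\<close>

lemma eventually_in_prob:
  "eventually P (in_prob M) \<longleftrightarrow>
    (\<forall>\<delta>>0. \<forall>\<^sub>F n in sequentially. rarely_fails M \<delta> (\<lambda>\<omega>. P (n, \<omega>)))"
  unfolding in_prob_def
proof (rule eventually_Abs_filter, rule is_filter.intro)
  let ?ev = "\<lambda>P. \<forall>\<delta>>0. \<forall>\<^sub>F n in sequentially. rarely_fails M \<delta> (\<lambda>\<omega>. P (n, \<omega>))"
  show "?ev (\<lambda>_. True)" by (auto intro!: always_eventually rarely_fails_of_always)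
  fix P Q :: "nat \<times> 'a \<Rightarrow> bool"
  {
    assume PQ: "?ev P" "?ev Q"
    show "?ev (\<lambda>x. P x \<and> Q x)"
    proof (intro allI impI)
      fix \<delta> :: real assume "\<delta> > 0"
      then have "\<delta> / 2 > 0" by simp
      with PQ have "\<forall>\<^sub>F n in sequentially. rarely_fails M (\<delta> / 2) (\<lambda>\<omega>. P (n, \<omega>))"
        "\<forall>\<^sub>F n in sequentially. rarely_fails M (\<delta> / 2) (\<lambda>\<omega>. Q (n, \<omega>))" by blast+
      then show "\<forall>\<^sub>F n in sequentially. rarely_fails M \<delta> (\<lambda>\<omega>. P (n, \<omega>) \<and> Q (n, \<omega>))"
        by eventually_elim (rule rarely_fails_conj)
    qed
  }
  assume PQ: "\<forall>x. P x \<longrightarrow> Q x" and "?ev P"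
  show "?ev Q"
  proof (intro allI impI)
    fix \<delta> :: real assume "\<delta> > 0"
    with \<open>?ev P\<close> have "\<forall>\<^sub>F n in sequentially. rarely_fails M \<delta> (\<lambda>\<omega>. P (n, \<omega>))" by blast
    then show "\<forall>\<^sub>F n in sequentially. rarely_fails M \<delta> (\<lambda>\<omega>. Q (n, \<omega>))"
      by (rule eventually_mono) (use PQ in \<open>blast intro: rarely_fails_mono\<close>)
  qed
qed

lemma eventually_in_probI:
  assumes "\<forall>\<^sub>F n in sequentially. \<forall>\<omega>\<in>space M. P (n, \<omega>)"
  shows "eventually P (in_prob M)"
  unfolding eventually_in_prob using assms
  by (auto elim!: eventually_mono intro!: rarely_fails_of_always)

lemma eventually_in_prob_measure:
  assumes "eventually P (in_prob M)"
  shows "(\<lambda>n. measure M {\<omega> \<in> space M. \<not> P (n, \<omega>)}) \<longlonglongrightarrow> 0"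
proof (rule tendstoI)
  fix e :: real assume "e > 0"
  with assms have "\<forall>\<^sub>F n in sequentially. rarely_fails M e (\<lambda>\<omega>. P (n, \<omega>))"
    unfolding eventually_in_prob by blast
  then show "\<forall>\<^sub>F n in sequentially. dist (measure M {\<omega> \<in> space M. \<not> P (n, \<omega>)}) 0 < e"
  proof eventually_elim
    fix n assume "rarely_fails M e (\<lambda>\<omega>. P (n, \<omega>))"
    then obtain A where A: "A \<in> sets M" "measure M A < e" "\<forall>\<omega>\<in>space M - A. P (n, \<omega>)"
      unfolding rarely_fails_def by blast
    then have "measure M {\<omega> \<in> space M. \<not> P (n, \<omega>)} \<le> measure M A"
      by (intro finite_measure_mono) auto
    with A show "dist (measure M {\<omega> \<in> space M. \<not> P (n, \<omega>)}) 0 < e" by simp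
  qed
qed

lemma tendsto_in_probD:
  assumes "((\<lambda>(n, \<omega>). Z n \<omega>) \<longlongrightarrow> 0) (in_prob M)" "\<epsilon> > 0" "\<delta> > 0"
  shows "\<forall>\<^sub>F n in sequentially. rarely_fails M \<delta> (\<lambda>\<omega>. norm (Z n \<omega>) < \<epsilon>)"
  using tendstoD[OF assms(1,2)] assms(3) unfolding eventually_in_prob by simp

lemma tendsto_in_probI:
  assumes "\<And>\<epsilon> \<delta>. \<epsilon> > 0 \<Longrightarrow> \<delta> > 0 \<Longrightarrow>
    \<forall>\<^sub>F n in sequentially. rarely_fails M \<delta> (\<lambda>\<omega>. norm (Z n \<omega>) < \<epsilon>)"
  shows "((\<lambda>(n, \<omega>). Z n \<omega>) \<longlongrightarrow> 0) (in_prob M)"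
  by (rule tendstoI) (use assms in \<open>simp add: eventually_in_prob\<close>)

lemma integral_bound_of_rarely_fails:
  fixes D :: "'a \<Rightarrow> real"
  assumes [measurable]: "D \<in> borel_measurable M" and bdd: "\<And>\<omega>. \<bar>D \<omega>\<bar> \<le> C"
    and "rarely_fails M \<delta> (\<lambda>\<omega>. \<bar>D \<omega>\<bar> \<le> e)" and "0 \<le> e"
  shows "\<bar>expectation D\<bar> \<le> e + C * \<delta>"
proof -
  obtain A where A [measurable]: "A \<in> sets M"
    and A': "measure M A < \<delta>" "\<forall>\<omega>\<in>space M - A. \<bar>D \<omega>\<bar> \<le> e"
    using assms(3) unfolding rarely_fails_def by blast
  have C: "C \<ge> 0" using bdd[of undefined] by simp
  have "\<bar>expectation D\<bar> \<le> expectation (\<lambda>\<omega>. \<bar>D \<omega>\<bar>)" by (rule integral_abs_bound)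
  also have "\<dots> \<le> expectation (\<lambda>\<omega>. e + C * indicator A \<omega>)"
  proof (rule integral_mono)
    show "integrable M (\<lambda>\<omega>. \<bar>D \<omega>\<bar>)"
      by (rule integrable_const_bound[of _ C]) (auto simp: bdd)
    show "integrable M (\<lambda>\<omega>. e + C * indicator A \<omega>)"
      by (intro Bochner_Integration.integrable_add integrable_const integrable_mult_right)
         (simp add: integrable_indicator_iff emeasure_eq_measure)
    fix \<omega> assume "\<omega> \<in> space M"
    then show "\<bar>D \<omega>\<bar> \<le> e + C * indicator A \<omega>"
      using A'(2) bdd[of \<omega>] \<open>0 \<le> e\<close> by (cases "\<omega> \<in> A") auto
  qed
  also have "\<dots> = e + C * measure M A"
    using sets.sets_into_space[OF A]
    by (subst Bochner_Integration.integral_add)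
       (auto simp: prob_space integrable_indicator_iff emeasure_eq_measure Int_absorb2)
  also have "\<dots> \<le> e + C * \<delta>" using A'(1) C by (intro add_left_mono mult_left_mono) auto
  finally show ?thesis .
qed

lemma bounded_convergence_in_prob:
  fixes D :: "nat \<Rightarrow> 'a \<Rightarrow> real"
  assumes D: "((\<lambda>(n, \<omega>). D n \<omega>) \<longlongrightarrow> 0) (in_prob M)"
    and meas: "\<And>n. D n \<in> borel_measurable M" and bdd: "\<And>n \<omega>. \<bar>D n \<omega>\<bar> \<le> C"
  shows "(\<lambda>n. expectation (D n)) \<longlonglongrightarrow> 0"
proof (rule tendstoI)
  fix e :: real assume e: "e > 0"
  have C: "C \<ge> 0" using bdd[of 0 undefined] by simp
  define \<delta> where "\<delta> = e / (2 * (C + 1))"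
  have \<delta>: "\<delta> > 0" using e C by (simp add: \<delta>_def)
  have "(C + 1) * \<delta> = e / 2" using C by (simp add: \<delta>_def add_nonneg_eq_0_iff divide_simps)
  then have C\<delta>: "C * \<delta> < e / 2" using \<delta> by (simp add: algebra_simps)
  have "e / 2 > 0" using e by simp
  from tendsto_in_probD[OF D this \<delta>]
  show "\<forall>\<^sub>F n in sequentially. dist (expectation (D n)) 0 < e"
  proof eventually_elim
    fix n assume "rarely_fails M \<delta> (\<lambda>\<omega>. norm (D n \<omega>) < e / 2)"
    then have "rarely_fails M \<delta> (\<lambda>\<omega>. \<bar>D n \<omega>\<bar> \<le> e / 2)" by (rule rarely_fails_mono) simp
    then have "\<bar>expectation (D n)\<bar> \<le> e / 2 + C * \<delta>"
      using e by (intro integral_bound_of_rarely_fails[OF meas bdd]) auto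
    with C\<delta> show "dist (expectation (D n)) 0 < e" by simp
  qed
qed

text \<open>
  The rule \<open>o\<^sub>P(1) * O\<^sub>P(1) = o\<^sub>P(1)\<close>.
\<close>

lemma tight_seq_mult_tendsto_0:
  assumes Y: "tight_seq M Y" and Z: "((\<lambda>(n, \<omega>). Z n \<omega>) \<longlongrightarrow> (0 :: real)) (in_prob M)"
  shows "((\<lambda>(n, \<omega>). Z n \<omega> * norm (Y n \<omega>)) \<longlongrightarrow> 0) (in_prob M)"
proof (rule tendsto_in_probI)
  fix e \<delta> :: real assume e: "e > 0" and "\<delta> > 0"
  then have \<delta>: "\<delta> / 2 > 0" by simp
  from Y \<delta> obtain R where R: "\<forall>\<^sub>F n in sequentially. rarely_fails M (\<delta> / 2) (\<lambda>\<omega>. norm (Y n \<omega>) \<le> R)"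
    unfolding tight_seq_def by blast
  have "e / (\<bar>R\<bar> + 1) > 0" using e by (simp add: add_nonneg_pos)
  from R tendsto_in_probD[OF Z this \<delta>]
  show "\<forall>\<^sub>F n in sequentially. rarely_fails M \<delta> (\<lambda>\<omega>. norm (Z n \<omega> * norm (Y n \<omega>)) < e)"
  proof eventually_elim
    fix n
    assume "rarely_fails M (\<delta> / 2) (\<lambda>\<omega>. norm (Y n \<omega>) \<le> R)"
      "rarely_fails M (\<delta> / 2) (\<lambda>\<omega>. norm (Z n \<omega>) < e / (\<bar>R\<bar> + 1))"
    then show "rarely_fails M \<delta> (\<lambda>\<omega>. norm (Z n \<omega> * norm (Y n \<omega>)) < e)"
    proof (rule rarely_fails_mono[OF rarely_fails_conj])
      fix \<omega> assume "norm (Y n \<omega>) \<le> R \<and> norm (Z n \<omega>) < e / (\<bar>R\<bar> + 1)"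
      then have 1: "norm (Y n \<omega>) \<le> \<bar>R\<bar> + 1" and 2: "\<bar>Z n \<omega>\<bar> < e / (\<bar>R\<bar> + 1)" by auto
      have "\<bar>Z n \<omega>\<bar> * norm (Y n \<omega>) \<le> \<bar>Z n \<omega>\<bar> * (\<bar>R\<bar> + 1)"
        using 1 by (intro mult_left_mono) auto
      also have "\<dots> < e / (\<bar>R\<bar> + 1) * (\<bar>R\<bar> + 1)"
        using 2 by (intro mult_strict_right_mono) auto
      finally show "norm (Z n \<omega> * norm (Y n \<omega>)) < e" by (simp add: abs_mult add_nonneg_pos)
    qed
  qed
qed

text \<open>
  The functions \<open>g R\<close> are continuous, bounded, and at least the indicator of \<open>norm x \<ge> R + 1\<close>. Their
  integrals against the limit law vanish as \<open>R\<close> grows, and for fixed \<open>R\<close> the integrals along the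
  sequence converge.
\<close>

lemma conv_in_distr_imp_tight:
  fixes Y :: "nat \<Rightarrow> 'a \<Rightarrow> 'b::real_normed_vector"
  assumes conv: "conv_in_distr M Y L"
  shows "tight_seq M Y"
  unfolding tight_seq_def
proof (intro allI impI)
  fix \<delta> :: real assume \<delta>: "\<delta> > 0"
  from conv have meas [measurable]: "\<And>n. Y n \<in> borel_measurable M"
    and L: "prob_space L" and sL [measurable_cong]: "sets L = sets borel"
    by (auto simp: conv_in_distr_def)
  interpret L: prob_space L by (rule L)
  define g :: "real \<Rightarrow> 'b \<Rightarrow> real" where "g R x = min 1 (max 0 (norm x - R))" for R x
  have g_cont: "continuous_on UNIV (g R)" for R unfolding g_def by (intro continuous_intros)
  have g_bdd: "0 \<le> g R x" "g R x \<le> 1" for R x by (auto simp: g_def)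
  have g_meas [measurable]: "g R \<in> borel_measurable borel" for R
    by (rule borel_measurable_continuous_onI[OF g_cont])
  have "(\<lambda>R. \<integral>x. g (real R) x \<partial>L) \<longlonglongrightarrow> (\<integral>x. 0 \<partial>L)"
  proof (rule integral_dominated_convergence[where w = "\<lambda>_. 1"])
    have "(\<lambda>R. g (real R) x) \<longlonglongrightarrow> 0" for x
    proof (rule tendsto_eventually)
      obtain N where "norm x \<le> real N" using real_arch_simple by blast
      then show "\<forall>\<^sub>F R in sequentially. g (real R) x = 0"
        by (intro eventually_sequentiallyI[of N]) (auto simp: g_def)
    qed
    then show "AE x in L. (\<lambda>R. g (real R) x) \<longlonglongrightarrow> 0" by simp
  qed (auto simp: g_bdd)
  then have "\<forall>\<^sub>F R in sequentially. (\<integral>x. g (real R) x \<partial>L) < \<delta>"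
    using \<delta> by (intro order_tendstoD(2)) auto
  then obtain R :: nat where R: "(\<integral>x. g (real R) x \<partial>L) < \<delta>"
    using eventually_happens'[OF sequentially_bot] by blast
  have "bounded (range (g (real R)))" using g_bdd by (auto simp: bounded_iff intro!: exI[of _ 1])
  with conv g_cont have "(\<lambda>n. \<integral>\<omega>. g (real R) (Y n \<omega>) \<partial>M) \<longlonglongrightarrow> (\<integral>x. g (real R) x \<partial>L)"
    unfolding conv_in_distr_def by blast
  from order_tendstoD(2)[OF this R]
  have "\<forall>\<^sub>F n in sequentially. (\<integral>\<omega>. g (real R) (Y n \<omega>) \<partial>M) < \<delta>" .
  then show "\<exists>R. \<forall>\<^sub>F n in sequentially. rarely_fails M \<delta> (\<lambda>\<omega>. norm (Y n \<omega>) \<le> R)"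
  proof (intro exI[of _ "real R + 1"], elim eventually_mono)
    fix n assume "(\<integral>\<omega>. g (real R) (Y n \<omega>) \<partial>M) < \<delta>"
    then have "rarely_fails M \<delta> (\<lambda>\<omega>. g (real R) (Y n \<omega>) < 1)"
      using g_bdd by (intro rarely_fails_markov) (auto intro!: integrable_const_bound[of _ 1])
    then show "rarely_fails M \<delta> (\<lambda>\<omega>. norm (Y n \<omega>) \<le> real R + 1)"
      by (rule rarely_fails_mono) (auto simp: g_def min_def max_def split: if_splits)
  qed
qed

lemma conv_in_distr_continuous_map:
  fixes Y :: "nat \<Rightarrow> 'a \<Rightarrow> 'b::topological_space" and g :: "'b \<Rightarrow> 'c::topological_space"
  assumes conv: "conv_in_distr M Y L" and g: "continuous_on UNIV g"
  shows "conv_in_distr M (\<lambda>n \<omega>. g (Y n \<omega>)) (distr L borel g)"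
proof -
  have gm: "g \<in> borel_measurable borel" by (rule borel_measurable_continuous_onI[OF g])
  from conv have Y: "\<And>n. Y n \<in> borel_measurable M" and L: "prob_space L" "sets L = sets borel"
    by (auto simp: conv_in_distr_def)
  have gL: "g \<in> borel_measurable L" using gm by (simp add: measurable_cong_sets[OF L(2) refl])
  show ?thesis
    unfolding conv_in_distr_def
  proof (intro conjI allI impI)
    show "(\<lambda>\<omega>. g (Y n \<omega>)) \<in> borel_measurable M" for n by (rule measurable_compose[OF Y gm])
    show "prob_space (distr L borel g)" by (rule prob_space.prob_space_distr[OF L(1) gL])
    fix f :: "'c \<Rightarrow> real" assume f: "continuous_on UNIV f" "bounded (range f)"
    have "continuous_on UNIV (\<lambda>x. f (g x))"
      using continuous_on_compose2[OF f(1) g] by simp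
    moreover have "bounded (range (\<lambda>x. f (g x)))"
      using f(2) by (rule bounded_subset) auto
    ultimately have "(\<lambda>n. \<integral>\<omega>. f (g (Y n \<omega>)) \<partial>M) \<longlonglongrightarrow> (\<integral>x. f (g x) \<partial>L)"
      using conv unfolding conv_in_distr_def by blast
    also have "(\<integral>x. f (g x) \<partial>L) = (\<integral>x. f x \<partial>distr L borel g)"
      using borel_measurable_continuous_onI[OF f(1)] gL by (simp add: integral_distr)
    finally show "(\<lambda>n. \<integral>\<omega>. f (g (Y n \<omega>)) \<partial>M) \<longlonglongrightarrow> (\<integral>x. f x \<partial>distr L borel g)" .
  qed simp
qed

text \<open>
  On a ball of radius \<open>R + 1\<close>, outside of which the sequence rarely is, the test function is uniformly
  continuous.
\<close>

lemma slutsky: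
  fixes Y Z :: "nat \<Rightarrow> 'a \<Rightarrow> 'b::euclidean_space"
  assumes conv: "conv_in_distr M Y L" and Z [measurable]: "\<And>n. Z n \<in> borel_measurable M"
    and diff: "((\<lambda>(n, \<omega>). norm (Z n \<omega> - Y n \<omega>)) \<longlongrightarrow> 0) (in_prob M)"
  shows "conv_in_distr M Z L"
  unfolding conv_in_distr_def
proof (intro conjI allI impI)
  from conv have Y [measurable]: "\<And>n. Y n \<in> borel_measurable M" by (auto simp: conv_in_distr_def)
  show "prob_space L" "sets L = sets borel" using conv by (auto simp: conv_in_distr_def)
  fix f :: "'b \<Rightarrow> real" assume f: "continuous_on UNIV f" "bounded (range f)"
  then obtain C where C: "\<And>x. \<bar>f x\<bar> \<le> C" by (auto simp: bounded_iff)
  have fm [measurable]: "f \<in> borel_measurable borel" by (rule borel_measurable_continuous_onI[OF f(1)])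
  have "((\<lambda>(n, \<omega>). f (Z n \<omega>) - f (Y n \<omega>)) \<longlongrightarrow> 0) (in_prob M)"
  proof (rule tendsto_in_probI)
    fix e \<delta> :: real assume e: "e > 0" and "\<delta> > 0"
    then have \<delta>: "\<delta> / 2 > 0" by simp
    from conv_in_distr_imp_tight[OF conv] \<delta> obtain R where R: "\<forall>\<^sub>F n in sequentially.
      rarely_fails M (\<delta> / 2) (\<lambda>\<omega>. norm (Y n \<omega>) \<le> R)"
      unfolding tight_seq_def by blast
    have "uniformly_continuous_on (cball 0 (R + 1)) f"
      using continuous_on_subset[OF f(1)] by (intro compact_uniformly_continuous) auto
    with e obtain \<eta> where \<eta>: "\<eta> > 0"
      "\<And>x y. x \<in> cball 0 (R + 1) \<Longrightarrow> y \<in> cball 0 (R + 1) \<Longrightarrow> dist y x < \<eta> \<Longrightarrow> dist (f y) (f x) < e"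
      unfolding uniformly_continuous_on_def by metis
    have "min \<eta> 1 > 0" using \<eta>(1) by simp
    from R tendsto_in_probD[OF diff this \<delta>]
    show "\<forall>\<^sub>F n in sequentially. rarely_fails M \<delta> (\<lambda>\<omega>. norm (f (Z n \<omega>) - f (Y n \<omega>)) < e)"
    proof eventually_elim
      fix n
      assume "rarely_fails M (\<delta> / 2) (\<lambda>\<omega>. norm (Y n \<omega>) \<le> R)"
        "rarely_fails M (\<delta> / 2) (\<lambda>\<omega>. norm (norm (Z n \<omega> - Y n \<omega>)) < min \<eta> 1)"
      then show "rarely_fails M \<delta> (\<lambda>\<omega>. norm (f (Z n \<omega>) - f (Y n \<omega>)) < e)"
      proof (rule rarely_fails_mono[OF rarely_fails_conj])
        fix \<omega> assume "norm (Y n \<omega>) \<le> R \<and> norm (norm (Z n \<omega> - Y n \<omega>)) < min \<eta> 1"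
        then have 1: "norm (Y n \<omega>) \<le> R" and 2: "norm (Z n \<omega> - Y n \<omega>) < min \<eta> 1" by auto
        have "norm (Z n \<omega>) \<le> norm (Y n \<omega>) + norm (Z n \<omega> - Y n \<omega>)"
          by (rule norm_triangle_sub)
        then have "dist (f (Z n \<omega>)) (f (Y n \<omega>)) < e"
          using 1 2 by (intro \<eta>(2)) (auto simp: dist_norm)
        then show "norm (f (Z n \<omega>) - f (Y n \<omega>)) < e" by (simp add: dist_norm)
      qed
    qed
  qed
  then have "(\<lambda>n. expectation (\<lambda>\<omega>. f (Z n \<omega>) - f (Y n \<omega>))) \<longlonglongrightarrow> 0"
  proof (rule bounded_convergence_in_prob[where C = "2 * C"])
    show "\<bar>f (Z n \<omega>) - f (Y n \<omega>)\<bar> \<le> 2 * C" for n \<omega>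
      using C[of "Z n \<omega>"] C[of "Y n \<omega>"] by linarith
  qed measurable
  moreover have "(\<lambda>n. expectation (\<lambda>\<omega>. f (Y n \<omega>))) \<longlonglongrightarrow> (\<integral>y. f y \<partial>L)"
    using conv f unfolding conv_in_distr_def by blast
  ultimately have "(\<lambda>n. expectation (\<lambda>\<omega>. f (Z n \<omega>) - f (Y n \<omega>)) + expectation (\<lambda>\<omega>. f (Y n \<omega>)))
      \<longlonglongrightarrow> 0 + (\<integral>y. f y \<partial>L)"
    by (rule tendsto_add)
  moreover have "expectation (\<lambda>\<omega>. f (Z n \<omega>) - f (Y n \<omega>)) + expectation (\<lambda>\<omega>. f (Y n \<omega>))
      = expectation (\<lambda>\<omega>. f (Z n \<omega>))" for n
    by (subst Bochner_Integration.integral_diff) (auto intro!: integrable_const_bound[of _ C] simp: C)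
  ultimately show "(\<lambda>n. expectation (\<lambda>\<omega>. f (Z n \<omega>))) \<longlonglongrightarrow> (\<integral>y. f y \<partial>L)" by simp
qed (rule Z)

end

section \<open>Trigonometric test functions and the Cramer-Wold device\<close>

text \<open>
  These functions depend on one-dimensional projections only, term by term, and product formulas for
  the cosine make them an algebra.
\<close>

inductive trig_poly :: "('e::euclidean_space \<Rightarrow> real) \<Rightarrow> bool" where
  cos: "trig_poly (\<lambda>x. c * cos (x \<bullet> t + a))"
| add: "trig_poly f \<Longrightarrow> trig_poly g \<Longrightarrow> trig_poly (\<lambda>x. f x + g x)"

lemma trig_poly_const: "trig_poly (\<lambda>_. c)"
  using trig_poly.cos[of c 0 0] by simp

lemma trig_poly_sum: "(\<And>i. i \<in> I \<Longrightarrow> trig_poly (f i)) \<Longrightarrow> trig_poly (\<lambda>x. \<Sum>i\<in>I. f i x)"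
  by (induction I rule: infinite_finite_induct) (auto intro: trig_poly_const trig_poly.add)

lemma trig_poly_mult:
  assumes "trig_poly f" "trig_poly g"
  shows "trig_poly (\<lambda>x. f x * g x)"
  using assms(1)
proof induction
  case (cos c t a)
  show ?case using assms(2)
  proof induction
    case (cos d s b)
    have "trig_poly (\<lambda>x. (c * d / 2) * cos (x \<bullet> (t - s) + (a - b)) + (c * d / 2) * cos (x \<bullet> (t + s) + (a + b)))"
      by (intro trig_poly.intros)
    also have "(\<lambda>x. (c * d / 2) * cos (x \<bullet> (t - s) + (a - b)) + (c * d / 2) * cos (x \<bullet> (t + s) + (a + b)))
      = (\<lambda>x. (c * cos (x \<bullet> t + a)) * (d * cos (x \<bullet> s + b)))"
    proof
      fix x
      have "cos (x \<bullet> t + a) * cos (x \<bullet> s + b)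
        = (cos (x \<bullet> (t - s) + (a - b)) + cos (x \<bullet> (t + s) + (a + b))) / 2"
        by (simp add: cos_times_cos inner_simps algebra_simps)
      moreover have "(c * d / 2) * u + (c * d / 2) * v = (c * p) * (d * q)"
        if "p * q = (u + v) / 2" for p q u v
      proof -
        have "(c * p) * (d * q) = c * d * (p * q)" by simp
        then show ?thesis by (simp add: that algebra_simps)
      qed
      ultimately show "(c * d / 2) * cos (x \<bullet> (t - s) + (a - b)) + (c * d / 2) * cos (x \<bullet> (t + s) + (a + b))
        = (c * cos (x \<bullet> t + a)) * (d * cos (x \<bullet> s + b))" by blast
    qed
    finally show ?case .
  next
    case (add f g)
    from trig_poly.add[OF add.IH] show ?case by (simp add: distrib_left)
  qed
next
  case (add f1 f2)
  from trig_poly.add[OF add.IH] show ?case by (simp add: distrib_right)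
qed

lemma trig_poly_polynomial_sin:
  fixes q :: "'e::euclidean_space \<Rightarrow> real"
  assumes "real_polynomial_function q"
  shows "trig_poly (\<lambda>x :: 'e. q (\<Sum>b\<in>Basis. sin (c * (x \<bullet> b)) *\<^sub>R b))"
  using assms
proof induction
  case (linear f)
  interpret f: bounded_linear f by fact
  have "trig_poly (\<lambda>x :: 'e. \<Sum>b\<in>Basis. f b * cos (x \<bullet> (c *\<^sub>R b) + (- pi / 2)))"
    by (intro trig_poly_sum trig_poly.cos)
  moreover have "cos (y + (- pi / 2)) = sin y" for y :: real
    by (simp add: cos_diff)
  ultimately show ?case by (simp add: f.sum f.scaleR mult.commute)
qed (auto intro: trig_poly_const trig_poly.add trig_poly_mult)

lemma (in prob_space) conv_in_distr_const:
  assumes "Y \<in> borel_measurable M"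
  shows "conv_in_distr M (\<lambda>_. Y) (distr M borel Y)"
  unfolding conv_in_distr_def
  using assms prob_space_distr[OF assms]
  by (auto simp: integral_distr borel_measurable_continuous_onI)

lemma (in prob_space) bounded_tail:
  fixes Y :: "'a \<Rightarrow> 'b::real_normed_vector"
  assumes "Y \<in> borel_measurable M" "\<delta> > 0"
  shows "\<exists>R. rarely_fails M \<delta> (\<lambda>\<omega>. norm (Y \<omega>) \<le> R)"
  using conv_in_distr_imp_tight[OF conv_in_distr_const[OF assms(1)]] assms(2)
  by (auto simp: tight_seq_def)

lemma (in prob_space) tight_seq_of_coordinates:
  fixes Y :: "nat \<Rightarrow> 'a \<Rightarrow> 'e::euclidean_space"
  assumes "\<And>b. b \<in> Basis \<Longrightarrow> tight_seq M (\<lambda>n \<omega>. Y n \<omega> \<bullet> b)"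
  shows "tight_seq M Y"
  unfolding tight_seq_def
proof (intro allI impI)
  fix \<delta> :: real assume "\<delta> > 0"
  then have "\<delta> / real DIM('e) > 0" by simp
  with assms have "\<exists>R. \<forall>b\<in>Basis. \<forall>\<^sub>F n in sequentially.
      rarely_fails M (\<delta> / real DIM('e)) (\<lambda>\<omega>. norm (Y n \<omega> \<bullet> b) \<le> R b)"
    unfolding tight_seq_def by (intro bchoice) blast
  then obtain R where R: "\<And>b. b \<in> Basis \<Longrightarrow> \<forall>\<^sub>F n in sequentially.
      rarely_fails M (\<delta> / real DIM('e)) (\<lambda>\<omega>. norm (Y n \<omega> \<bullet> b) \<le> R b)"
    by blast
  then have "\<forall>\<^sub>F n in sequentially. \<forall>b\<in>Basis.
      rarely_fails M (\<delta> / real DIM('e)) (\<lambda>\<omega>. norm (Y n \<omega> \<bullet> b) \<le> R b)"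
    by (intro eventually_ball_finite) auto
  then show "\<exists>R. \<forall>\<^sub>F n in sequentially. rarely_fails M \<delta> (\<lambda>\<omega>. norm (Y n \<omega>) \<le> R)"
  proof (intro exI[of _ "\<Sum>b\<in>Basis. R b"], elim eventually_mono)
    fix n assume "\<forall>b\<in>Basis. rarely_fails M (\<delta> / real DIM('e)) (\<lambda>\<omega>. norm (Y n \<omega> \<bullet> b) \<le> R b)"
    then have "\<exists>A. \<forall>b\<in>Basis. A b \<in> sets M \<and> measure M (A b) < \<delta> / real DIM('e) \<and>
      (\<forall>\<omega>\<in>space M - A b. norm (Y n \<omega> \<bullet> b) \<le> R b)"
      unfolding rarely_fails_def by (intro bchoice) blast
    then obtain A where A: "\<And>b. b \<in> Basis \<Longrightarrow> A b \<in> sets M"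
      "\<And>b. b \<in> Basis \<Longrightarrow> measure M (A b) < \<delta> / real DIM('e)"
      "\<And>b \<omega>. b \<in> Basis \<Longrightarrow> \<omega> \<in> space M - A b \<Longrightarrow> norm (Y n \<omega> \<bullet> b) \<le> R b"
      by blast
    let ?A = "\<Union>b\<in>Basis. A b"
    have "measure M ?A \<le> (\<Sum>b\<in>Basis. measure M (A b))"
      using A(1) by (intro measure_UNION_le) auto
    also have "\<dots> < (\<Sum>b\<in>(Basis :: 'e set). \<delta> / real DIM('e))"
      using A(2) by (intro sum_strict_mono) (simp_all add: nonempty_Basis)
    finally have "measure M ?A < \<delta>" by simp
    moreover have "norm (Y n \<omega>) \<le> (\<Sum>b\<in>Basis. R b)" if "\<omega> \<in> space M - ?A" for \<omega>
      using that A(3) by (intro order.trans[OF norm_le_l1] sum_mono) auto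
    ultimately show "rarely_fails M \<delta> (\<lambda>\<omega>. norm (Y n \<omega>) \<le> (\<Sum>b\<in>Basis. R b))"
      using A(1) unfolding rarely_fails_def by (intro bexI[of _ ?A]) auto
  qed
qed

text \<open>
  The substitution \<open>y b = sin (c * (x \<bullet> b))\<close> maps the whole space onto the cube and is invertible on
  the ball of radius \<open>R\<close>. A polynomial in \<open>y\<close> that is close to \<open>f\<close> on the cube is a trigonometric
  polynomial in \<open>x\<close> that is close to \<open>f\<close> on the ball and bounded on the whole space.
\<close>

lemma trig_poly_approximation:
  fixes f :: "'e::euclidean_space \<Rightarrow> real"
  assumes f: "continuous_on UNIV f" "\<And>x. \<bar>f x\<bar> \<le> C" and "R > 0" "e > 0"
  obtains g where "trig_poly g" "\<And>x. norm x \<le> R \<Longrightarrow> \<bar>f x - g x\<bar> \<le> e" "\<And>x. \<bar>g x\<bar> \<le> C + e"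
proof -
  \<comment> \<open>so that \<open>c * (x \<bullet> b)\<close> stays in \<open>[-pi/2, pi/2]\<close>, where the sine is invertible, for \<open>norm x \<le> R\<close>\<close>
  define c where "c = pi / (2 * R)"
  have c: "c > 0" using assms(3) by (simp add: c_def)
  let ?K = "cbox (- One) One :: 'e set"
  define S where "S x = (\<Sum>b\<in>Basis. sin (c * (x \<bullet> b)) *\<^sub>R b)" for x :: 'e
  define F where "F y = f (\<Sum>b\<in>Basis. (arcsin (y \<bullet> b) / c) *\<^sub>R b)" for y :: 'e
  have "continuous_on ?K F"
    unfolding F_def using c
    by (intro continuous_on_compose2[OF f(1)] continuous_intros) (auto simp: mem_box)
  then obtain q where q: "real_polynomial_function q" "\<And>y. y \<in> ?K \<Longrightarrow> \<bar>F y - q y\<bar> < e"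
    using Stone_Weierstrass_real_polynomial_function[of ?K F e] \<open>e > 0\<close> compact_cbox by blast
  have SK: "S x \<in> ?K" for x by (auto simp: mem_box S_def)
  have FS: "F (S x) = f x" if "norm x \<le> R" for x
  proof -
    have "arcsin (sin (c * (x \<bullet> b))) / c = x \<bullet> b" if b: "b \<in> Basis" for b
    proof -
      have "\<bar>x \<bullet> b\<bar> \<le> R" using Basis_le_norm[OF b, of x] \<open>norm x \<le> R\<close> by simp
      then have "\<bar>c * (x \<bullet> b)\<bar> \<le> c * R" using c by (simp add: abs_mult)
      also have "c * R = pi / 2" using \<open>R > 0\<close> by (simp add: c_def)
      finally have "arcsin (sin (c * (x \<bullet> b))) = c * (x \<bullet> b)" by (intro arcsin_sin) auto
      then show ?thesis using c by simp
    qed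
    then show ?thesis by (simp add: F_def S_def euclidean_representation)
  qed
  show ?thesis
  proof (rule that[of "\<lambda>x. q (S x)"])
    show "trig_poly (\<lambda>x. q (S x))" unfolding S_def by (rule trig_poly_polynomial_sin[OF q(1)])
    show "\<bar>f x - q (S x)\<bar> \<le> e" if "norm x \<le> R" for x
      using q(2)[OF SK, of x] FS[OF that] by simp
    show "\<bar>q (S x)\<bar> \<le> C + e" for x
    proof -
      have "\<bar>F (S x)\<bar> \<le> C" unfolding F_def by (rule f(2))
      then show ?thesis using q(2)[OF SK, of x] by linarith
    qed
  qed
qed

lemma trig_poly_continuous_bounded:
  assumes "trig_poly g"
  shows "continuous_on UNIV g \<and> bounded (range g)"
  using assms
proof induction
  case (cos c t a)
  have "\<bar>c * cos (x \<bullet> t + a)\<bar> \<le> \<bar>c\<bar>" for x by (simp add: abs_mult mult_left_le)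
  then have "bounded (range (\<lambda>x. c * cos (x \<bullet> t + a)))"
    unfolding bounded_iff by (intro exI[of _ "\<bar>c\<bar>"]) auto
  moreover have "continuous_on UNIV (\<lambda>x. c * cos (x \<bullet> t + a))" by (intro continuous_intros)
  ultimately show ?case by blast
next
  case (add g1 g2)
  then have "bounded (range (\<lambda>x. g1 x + g2 x))" by (rule_tac bounded_plus_comp) auto
  with add.IH show ?case by (intro conjI continuous_on_add) auto
qed

lemma (in prob_space) integrable_continuous_bounded:
  fixes f :: "'b::topological_space \<Rightarrow> real"
  assumes "continuous_on UNIV f" "bounded (range f)" "Y \<in> borel_measurable M"
  shows "integrable M (\<lambda>\<omega>. f (Y \<omega>))"
proof -
  from assms(2) obtain B where B: "\<And>x. norm (f x) \<le> B" by (auto simp: bounded_iff)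
  have "(\<lambda>\<omega>. f (Y \<omega>)) \<in> borel_measurable M"
    using assms(1,3) borel_measurable_continuous_onI measurable_compose by blast
  then show ?thesis using B by (intro integrable_const_bound[of _ B]) auto
qed

lemma (in prob_space) trig_poly_conv:
  fixes Y :: "nat \<Rightarrow> 'a \<Rightarrow> 'e::euclidean_space"
  assumes Y: "\<And>n. Y n \<in> borel_measurable M"
    and L: "prob_space L" "sets L = sets borel"
    and lin: "\<And>t. conv_in_distr M (\<lambda>n \<omega>. Y n \<omega> \<bullet> t) (distr L borel (\<lambda>x. x \<bullet> t))"
    and "trig_poly g"
  shows "(\<lambda>n. \<integral>\<omega>. g (Y n \<omega>) \<partial>M) \<longlonglongrightarrow> (\<integral>x. g x \<partial>L)"
  using assms(5)
proof induction
  case (cos c t a)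
  let ?h = "\<lambda>y :: real. c * cos (y + a)"
  have h: "continuous_on UNIV ?h" "bounded (range ?h)"
    using trig_poly_continuous_bounded[OF trig_poly.cos[of c "1 :: real" a]] by simp_all
  have "(\<lambda>x :: 'e. x \<bullet> t) \<in> borel_measurable L" unfolding measurable_cong_sets[OF L(2) refl] by simp
  then have "(\<integral>y. ?h y \<partial>distr L borel (\<lambda>x. x \<bullet> t)) = (\<integral>x. ?h (x \<bullet> t) \<partial>L)"
    by (rule integral_distr) (rule borel_measurable_continuous_onI[OF h(1)])
  moreover from lin[of t] h have "(\<lambda>n. \<integral>\<omega>. ?h (Y n \<omega> \<bullet> t) \<partial>M) \<longlonglongrightarrow> (\<integral>y. ?h y \<partial>distr L borel (\<lambda>x. x \<bullet> t))"
    unfolding conv_in_distr_def by blast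
  ultimately show ?case by (simp only:)
next
  case (add g1 g2)
  note cb = add.hyps[THEN trig_poly_continuous_bounded]
  have id: "(\<lambda>x. x) \<in> borel_measurable L" unfolding measurable_cong_sets[OF L(2) refl] by simp
  have "(\<integral>\<omega>. g1 (Y n \<omega>) + g2 (Y n \<omega>) \<partial>M) = (\<integral>\<omega>. g1 (Y n \<omega>) \<partial>M) + (\<integral>\<omega>. g2 (Y n \<omega>) \<partial>M)" for n
    using cb Y by (intro Bochner_Integration.integral_add integrable_continuous_bounded) auto
  moreover have "(\<integral>x. g1 x + g2 x \<partial>L) = (\<integral>x. g1 x \<partial>L) + (\<integral>x. g2 x \<partial>L)"
    using cb id by (intro Bochner_Integration.integral_add prob_space.integrable_continuous_bounded[OF L(1)]) auto
  ultimately show ?case using tendsto_add[OF add.IH] by simp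
qed

text \<open>
  Convergence of one-dimensional projections gives convergence for trigonometric polynomials and,
  through the coordinates, tightness. Tightness makes it sufficient to approximate a test function on
  a large ball by a uniformly bounded trigonometric polynomial.
\<close>

lemma (in prob_space) cramer_wold:
  fixes Y :: "nat \<Rightarrow> 'a \<Rightarrow> 'e::euclidean_space"
  assumes Y [measurable]: "\<And>n. Y n \<in> borel_measurable M"
    and L: "prob_space L" "sets L = sets borel"
    and lin: "\<And>t. conv_in_distr M (\<lambda>n \<omega>. Y n \<omega> \<bullet> t) (distr L borel (\<lambda>x. x \<bullet> t))"
  shows "conv_in_distr M Y L"
  unfolding conv_in_distr_def
proof (intro conjI allI impI Y L)
  interpret L: prob_space L by (rule L)
  note [measurable_cong] = L(2)
  fix f :: "'e \<Rightarrow> real" assume f: "continuous_on UNIV f" "bounded (range f)"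
  then obtain C where C: "\<And>x. \<bar>f x\<bar> \<le> C" by (auto simp: bounded_iff)
  have [measurable]: "f \<in> borel_measurable borel" by (rule borel_measurable_continuous_onI[OF f(1)])
  have "tight_seq M Y" using conv_in_distr_imp_tight[OF lin] by (rule tight_seq_of_coordinates)
  show "(\<lambda>n. \<integral>\<omega>. f (Y n \<omega>) \<partial>M) \<longlonglongrightarrow> (\<integral>x. f x \<partial>L)"
  proof (rule tendstoI)
    fix e0 :: real assume "e0 > 0"
    define e where "e = e0 / 5"
    have e: "e > 0" using \<open>e0 > 0\<close> by (simp add: e_def)
    have C0: "C \<ge> 0" using C[of undefined] by simp
    define C' where "C' = 2 * C + e"
    have C': "C' > 0" using C0 e by (simp add: C'_def)
    \<comment> \<open>\<open>C'\<close> bounds \<open>f - g\<close> globally, so an exceptional set of measure \<open>\<delta>\<close> costs at most \<open>e\<close>\<close>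
    define \<delta> where "\<delta> = e / C'"
    have \<delta>: "\<delta> > 0" "C' * \<delta> = e" using C' e by (simp_all add: \<delta>_def)
    from \<open>tight_seq M Y\<close> \<delta>(1) obtain R1 where R1: "\<forall>\<^sub>F n in sequentially.
      rarely_fails M \<delta> (\<lambda>\<omega>. norm (Y n \<omega>) \<le> R1)"
      unfolding tight_seq_def by blast
    from L.bounded_tail[of "\<lambda>x. x", OF _ \<delta>(1)] obtain R2
      where R2: "rarely_fails L \<delta> (\<lambda>x. norm x \<le> R2)" by auto
    define R where "R = max 1 (max R1 R2)"
    have R: "R > 0" "R1 \<le> R" "R2 \<le> R" by (auto simp: R_def)
    obtain g where g: "trig_poly g" "\<And>x. norm x \<le> R \<Longrightarrow> \<bar>f x - g x\<bar> \<le> e" "\<And>x. \<bar>g x\<bar> \<le> C + e"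
      using trig_poly_approximation[OF f(1) C R(1) e] by metis
    have [measurable]: "g \<in> borel_measurable borel"
      using trig_poly_continuous_bounded[OF g(1)] by (auto intro: borel_measurable_continuous_onI)
    have fg: "\<bar>f x - g x\<bar> \<le> C'" for x using C[of x] g(3)[of x] by (simp add: C'_def)
    have C2: "\<bar>f x\<bar> \<le> C + e" for x using C[of x] e by simp
    have int: "integrable M (\<lambda>\<omega>. f (Y n \<omega>))" "integrable M (\<lambda>\<omega>. g (Y n \<omega>))" for n
      using C2 g(3) by (auto intro!: integrable_const_bound[of _ "C + e"])
    have intL: "integrable L f" "integrable L g"
      using C2 g(3) by (auto intro!: L.integrable_const_bound[of _ "C + e"])
    have "rarely_fails L \<delta> (\<lambda>x. \<bar>f x - g x\<bar> \<le> e)"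
      using R2 by (rule rarely_fails_mono) (use R(3) g(2) in \<open>meson order_trans\<close>)
    then have "\<bar>\<integral>x. f x - g x \<partial>L\<bar> \<le> e + C' * \<delta>"
      using e by (intro L.integral_bound_of_rarely_fails) (auto intro: fg)
    then have *: "\<bar>(\<integral>x. f x \<partial>L) - (\<integral>x. g x \<partial>L)\<bar> \<le> 2 * e"
      using intL \<delta>(2) by simp
    have "\<forall>\<^sub>F n in sequentially. dist (\<integral>\<omega>. g (Y n \<omega>) \<partial>M) (\<integral>x. g x \<partial>L) < e"
      using tendstoD[OF trig_poly_conv[OF Y L lin g(1)] e] .
    with R1 show "\<forall>\<^sub>F n in sequentially. dist (\<integral>\<omega>. f (Y n \<omega>) \<partial>M) (\<integral>x. f x \<partial>L) < e0"
    proof eventually_elim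
      fix n assume tail: "rarely_fails M \<delta> (\<lambda>\<omega>. norm (Y n \<omega>) \<le> R1)"
        and ** : "dist (\<integral>\<omega>. g (Y n \<omega>) \<partial>M) (\<integral>x. g x \<partial>L) < e"
      have "rarely_fails M \<delta> (\<lambda>\<omega>. \<bar>f (Y n \<omega>) - g (Y n \<omega>)\<bar> \<le> e)"
        using tail by (rule rarely_fails_mono) (use R(2) g(2) in \<open>meson order_trans\<close>)
      then have "\<bar>\<integral>\<omega>. f (Y n \<omega>) - g (Y n \<omega>) \<partial>M\<bar> \<le> e + C' * \<delta>"
        using e by (intro integral_bound_of_rarely_fails) (auto intro: fg)
      then have "\<bar>(\<integral>\<omega>. f (Y n \<omega>) \<partial>M) - (\<integral>\<omega>. g (Y n \<omega>) \<partial>M)\<bar> \<le> 2 * e"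
        using int \<delta>(2) by simp
      with * ** show "dist (\<integral>\<omega>. f (Y n \<omega>) \<partial>M) (\<integral>x. f x \<partial>L) < e0"
        unfolding dist_real_def e_def by linarith
    qed
  qed
qed

section \<open>Gaussian laws with a prescribed covariance\<close>

lemma normal_law_eq_distr:
  assumes "\<sigma> \<ge> 0"
  shows "normal_law 0 \<sigma> = distr std_normal_distribution borel (\<lambda>x. \<sigma> * x)"
proof -
  interpret N: real_distribution std_normal_distribution by (rule real_dist_normal_dist)
  show ?thesis
  proof (cases "\<sigma> = 0")
    case True
    then show ?thesis using N.distr_const[of "0 :: real" borel] by (simp add: normal_law_def)
  next
    case False
    with assms have \<sigma>: "0 < \<sigma>" by simp
    have "distributed std_normal_distribution lborel (\<lambda>x. x) std_normal_density"
      unfolding distributed_def by (simp add: distr_id2)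
    from N.normal_density_affine[OF this, of \<sigma> 0] \<sigma>
    have "distributed std_normal_distribution lborel (\<lambda>x. \<sigma> * x) (normal_density 0 \<sigma>)" by simp
    then have "density lborel (normal_density 0 \<sigma>) = distr std_normal_distribution lborel (\<lambda>x. \<sigma> * x)"
      by (simp add: distributed_def)
    also have "\<dots> = distr std_normal_distribution borel (\<lambda>x. \<sigma> * x)" by (intro distr_cong) auto
    finally show ?thesis using False by (simp add: normal_law_def)
  qed
qed

lemma real_distribution_normal_law:
  assumes "\<sigma> \<ge> 0"
  shows "real_distribution (normal_law 0 \<sigma>)"
proof -
  interpret N: real_distribution std_normal_distribution by (rule real_dist_normal_dist)
  show ?thesis unfolding normal_law_eq_distr[OF assms] by (rule N.real_distribution_distr) simp
qed

lemma char_normal_law: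
  assumes "\<sigma> \<ge> 0"
  shows "char (normal_law 0 \<sigma>) s = complex_of_real (exp (- ((\<sigma> * s)\<^sup>2) / 2))"
proof -
  have "char (normal_law 0 \<sigma>) s = char std_normal_distribution (\<sigma> * s)"
    unfolding normal_law_eq_distr[OF assms] char_def by (subst integral_distr) (auto simp: mult_ac)
  then show ?thesis by (simp add: char_std_normal_distribution)
qed

lemma normal_law_moments:
  assumes "\<sigma> \<ge> 0"
  shows "(\<integral>x. x \<partial>normal_law 0 \<sigma>) = 0" "integrable (normal_law 0 \<sigma>) (\<lambda>x. x\<^sup>2)"
    "(\<integral>x. x\<^sup>2 \<partial>normal_law 0 \<sigma>) = \<sigma>\<^sup>2" "integrable (normal_law 0 \<sigma>) (\<lambda>x. x)"
proof -
  let ?N = "std_normal_distribution"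
  have E1: "(\<integral>x. x \<partial>?N) = 0" using integral_std_normal_distribution_moment_odd[of 1] by simp
  have I1: "integrable ?N (\<lambda>x. x)" using integrable_std_normal_distribution_moment[of 1] by simp
  have E2: "(\<integral>x. x\<^sup>2 \<partial>?N) = 1"
    using std_normal_distribution_even_moments(1)[of 1] by (simp add: fact_numeral)
  have I2: "integrable ?N (\<lambda>x. x\<^sup>2)" by (rule integrable_std_normal_distribution_moment)
  have m: "(\<lambda>x. \<sigma> * x) \<in> borel_measurable ?N" by simp
  show "(\<integral>x. x \<partial>normal_law 0 \<sigma>) = 0"
    unfolding normal_law_eq_distr[OF assms] by (subst integral_distr[OF m]) (simp_all add: E1)
  show "integrable (normal_law 0 \<sigma>) (\<lambda>x. x\<^sup>2)"
    unfolding normal_law_eq_distr[OF assms]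
    by (subst integrable_distr_eq[OF m]) (simp_all add: power_mult_distrib I2)
  show "(\<integral>x. x\<^sup>2 \<partial>normal_law 0 \<sigma>) = \<sigma>\<^sup>2"
    unfolding normal_law_eq_distr[OF assms]
    by (subst integral_distr[OF m]) (simp_all add: power_mult_distrib E2)
  show "integrable (normal_law 0 \<sigma>) (\<lambda>x. x)"
    unfolding normal_law_eq_distr[OF assms]
    by (subst integrable_distr_eq[OF m]) (simp_all add: I1)
qed

text \<open>
  The centred Gaussian law with the second moments of \<open>\<xi>\<close>, described by its one-dimensional
  projections. Naming the random vector rather than a covariance matrix makes the notion stable under
  linear maps.
\<close>

definition gaussian_law_of ::
  "'a measure \<Rightarrow> ('a \<Rightarrow> 'e::euclidean_space) \<Rightarrow> 'e measure \<Rightarrow> bool" where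
  "gaussian_law_of M \<xi> L \<longleftrightarrow> prob_space L \<and> sets L = sets borel \<and>
     (\<forall>t. distr L borel (\<lambda>x. x \<bullet> t) = normal_law 0 (sqrt (\<integral>\<omega>. (\<xi> \<omega> \<bullet> t)\<^sup>2 \<partial>M)))"

text \<open>
  Along an orthonormal eigenbasis of the covariance operator take independent centred normal
  coordinates whose variances are the eigenvalues. Projections are sums of independent normals; they are identified by
  their characteristic functions, which also covers vanishing eigenvalues.
\<close>

lemma gaussian_law_exists_of_operator:
  fixes f :: "'e::euclidean_space \<Rightarrow> 'e"
  assumes lin: "linear f" and sa: "\<And>x y. f x \<bullet> y = x \<bullet> f y" and psd: "\<And>t. 0 \<le> t \<bullet> f t"
  shows "\<exists>L :: 'e measure. prob_space L \<and> sets L = sets borel \<and>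
    (\<forall>t. distr L borel (\<lambda>x. x \<bullet> t) = normal_law 0 (sqrt (t \<bullet> f t)))"
proof -
  interpret N: real_distribution std_normal_distribution by (rule real_dist_normal_dist)
  from selfadjoint_eigenbasis[OF lin sa, of UNIV] obtain B where B:
    "pairwise orthogonal B" "\<forall>x\<in>B. norm x = 1" "span B = UNIV" "\<forall>x\<in>B. f x = (x \<bullet> f x) *\<^sub>R x"
    by auto
  have fin: "finite B"
    using B(1,2) pairwise_orthogonal_imp_finite by blast
  have expand: "(\<Sum>v\<in>B. (x \<bullet> v) *\<^sub>R v) = x" for x
    using B fin by (intro orthonormal_basis_expand) auto
  define P where "P = PiM B (\<lambda>_ :: 'e. std_normal_distribution)"
  interpret P: prob_space P unfolding P_def by (intro prob_space_PiM N.prob_space_axioms)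
  have comp [measurable]: "(\<lambda>z. z v) \<in> borel_measurable P" if "v \<in> B" for v
    unfolding P_def using measurable_component_singleton[OF that, of "\<lambda>_. std_normal_distribution"] by simp
  have cdist: "distr P borel (\<lambda>z. z v) = std_normal_distribution" if "v \<in> B" for v
  proof -
    have "distr P borel (\<lambda>z. z v) = distr P std_normal_distribution (\<lambda>z. z v)"
      by (intro distr_cong) auto
    also have "\<dots> = std_normal_distribution"
      unfolding P_def by (rule distr_PiM_component[OF _ that]) (rule N.prob_space_axioms)
    finally show ?thesis .
  qed
  have ind: "P.indep_vars (\<lambda>_. borel) (\<lambda>v z. z v) B"
  proof (cases "B = {}")
    case True
    then show ?thesis by (simp add: P.indep_vars_def P.indep_sets_def)
  next
    case False
    have "distr P (PiM B (\<lambda>_. borel)) (\<lambda>z. \<lambda>v\<in>B. z v) = distr P P (\<lambda>z. z)"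
    proof (rule distr_cong)
      show "sets (PiM B (\<lambda>_ :: 'e. borel)) = sets P" unfolding P_def by (intro sets_PiM_cong) auto
      show "(\<lambda>v\<in>B. z v) = z" if "z \<in> space P" for z
        using that by (auto simp: P_def space_PiM PiE_restrict)
    qed simp
    also have "\<dots> = PiM B (\<lambda>v. distr P borel (\<lambda>z. z v))"
      unfolding distr_id by (simp add: P_def cong: PiM_cong) (intro PiM_cong refl cdist[symmetric, unfolded P_def])
    finally show ?thesis
      using False by (subst P.indep_vars_iff_distr_eq_PiM') auto
  qed
  define G where "G z = (\<Sum>v\<in>B. (sqrt (v \<bullet> f v) * z v) *\<^sub>R v)" for z
  have G [measurable]: "G \<in> borel_measurable P" unfolding G_def by measurable
  define L where "L = distr P borel G"
  have "distr L borel (\<lambda>x. x \<bullet> t) = normal_law 0 (sqrt (t \<bullet> f t))" for t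
  proof (rule Levy_uniqueness)
    define a where "a v = sqrt (v \<bullet> f v) * (v \<bullet> t)" for v
    have Gt: "G z \<bullet> t = (\<Sum>v\<in>B. a v * z v)" for z
      by (simp add: G_def inner_sum_left a_def mult_ac)
    have dist: "distr L borel (\<lambda>x. x \<bullet> t) = distr P borel (\<lambda>z. \<Sum>v\<in>B. a v * z v)"
      unfolding L_def by (subst distr_distr) (auto simp: o_def Gt)
    show "real_distribution (distr L borel (\<lambda>x. x \<bullet> t))"
      unfolding dist by (intro P.real_distribution_distr) measurable
    show "real_distribution (normal_law 0 (sqrt (t \<bullet> f t)))"
      by (intro real_distribution_normal_law) (simp add: psd)
    have var: "(\<Sum>v\<in>B. (a v)\<^sup>2) = t \<bullet> f t"
    proof -
      have "f t = f (\<Sum>v\<in>B. (t \<bullet> v) *\<^sub>R v)" by (simp only: expand)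
      also have "\<dots> = (\<Sum>v\<in>B. (t \<bullet> v) *\<^sub>R f v)"
        by (simp add: linear_sum[OF lin] linear_cmul[OF lin])
      also have "\<dots> = (\<Sum>v\<in>B. ((t \<bullet> v) * (v \<bullet> f v)) *\<^sub>R v)"
        using B(4) by (intro sum.cong refl) (metis scaleR_scaleR)
      finally have "t \<bullet> f t = (\<Sum>v\<in>B. (t \<bullet> v) * (v \<bullet> f v) * (t \<bullet> v))"
        by (simp add: inner_sum_right)
      then show ?thesis
        by (simp add: a_def power_mult_distrib psd inner_commute[of _ t] power2_eq_square mult_ac)
    qed
    have "char (distr L borel (\<lambda>x. x \<bullet> t)) s = char (normal_law 0 (sqrt (t \<bullet> f t))) s" for s
    proof -
      have ind': "P.indep_vars (\<lambda>_. borel) (\<lambda>v z. a v * z v) B"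
        using P.indep_vars_compose2[OF ind, of "\<lambda>v x. a v * x" "\<lambda>_. borel"] by simp
      have "char (distr P borel (\<lambda>z. a v * z v)) s = complex_of_real (exp (- ((a v * s)\<^sup>2) / 2))"
        if v: "v \<in> B" for v
      proof -
        have "distr P borel (\<lambda>z. a v * z v) = distr std_normal_distribution borel (\<lambda>x. a v * x)"
          unfolding cdist[OF v, symmetric] using comp[OF v] by (subst distr_distr) (auto simp: o_def)
        then have "char (distr P borel (\<lambda>z. a v * z v)) s = char std_normal_distribution (a v * s)"
          unfolding char_def by (simp add: integral_distr mult_ac)
        then show ?thesis by (simp add: char_std_normal_distribution)
      qed
      then have "char (distr L borel (\<lambda>x. x \<bullet> t)) s
          = (\<Prod>v\<in>B. complex_of_real (exp (- ((a v * s)\<^sup>2) / 2)))"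
        unfolding dist by (subst P.char_distr_sum[OF ind']) simp
      also have "\<dots> = complex_of_real (exp (\<Sum>v\<in>B. - ((a v * s)\<^sup>2) / 2))"
        using fin by (simp add: exp_sum)
      also have "(\<Sum>v\<in>B. - ((a v * s)\<^sup>2) / 2) = - ((sqrt (t \<bullet> f t) * s)\<^sup>2) / 2"
        by (simp add: var[symmetric] power_mult_distrib sum_nonneg sum_distrib_right sum_negf
            sum_divide_distrib[symmetric])
      finally show ?thesis by (simp add: char_normal_law psd)
    qed
    then show "char (distr L borel (\<lambda>x. x \<bullet> t)) = char (normal_law 0 (sqrt (t \<bullet> f t)))" by (rule ext)
  qed
  moreover have "prob_space L" unfolding L_def by (rule P.prob_space_distr) measurable
  ultimately show ?thesis by (intro exI[of _ L]) (simp add: L_def)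
qed

lemma integrable_inner_products:
  fixes \<xi> :: "'a \<Rightarrow> 'e::euclidean_space"
  assumes [measurable]: "\<xi> \<in> borel_measurable M" and sq: "integrable M (\<lambda>\<omega>. (norm (\<xi> \<omega>))\<^sup>2)"
  shows "integrable M (\<lambda>\<omega>. (\<xi> \<omega> \<bullet> s) * (\<xi> \<omega> \<bullet> t))"
proof (rule Bochner_Integration.integrable_bound)
  show "integrable M (\<lambda>\<omega>. norm s * norm t * (norm (\<xi> \<omega>))\<^sup>2)" using sq by simp
  have "\<bar>(\<xi> \<omega> \<bullet> s) * (\<xi> \<omega> \<bullet> t)\<bar> \<le> norm s * norm t * (norm (\<xi> \<omega>))\<^sup>2" for \<omega>
    using mult_mono[OF Cauchy_Schwarz_ineq2[of "\<xi> \<omega>" s] Cauchy_Schwarz_ineq2[of "\<xi> \<omega>" t]]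
    by (simp add: abs_mult power2_eq_square mult_ac)
  then show "AE \<omega> in M. norm ((\<xi> \<omega> \<bullet> s) * (\<xi> \<omega> \<bullet> t)) \<le> norm (norm s * norm t * (norm (\<xi> \<omega>))\<^sup>2)"
    by simp
qed measurable

lemma gaussian_law_of_exists:
  fixes \<xi> :: "'a \<Rightarrow> 'e::euclidean_space"
  assumes \<xi>: "\<xi> \<in> borel_measurable M" "integrable M (\<lambda>\<omega>. (norm (\<xi> \<omega>))\<^sup>2)"
  shows "\<exists>L. gaussian_law_of M \<xi> L"
proof -
  note int = integrable_inner_products[OF \<xi>]
  define f where "f s = (\<Sum>b\<in>Basis. (\<integral>\<omega>. (\<xi> \<omega> \<bullet> s) * (\<xi> \<omega> \<bullet> b) \<partial>M) *\<^sub>R b)" for s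
  have fst: "f s \<bullet> t = (\<integral>\<omega>. (\<xi> \<omega> \<bullet> s) * (\<xi> \<omega> \<bullet> t) \<partial>M)" for s t
  proof -
    have "f s \<bullet> t = (\<Sum>b\<in>Basis. (\<integral>\<omega>. (\<xi> \<omega> \<bullet> s) * (\<xi> \<omega> \<bullet> b) * (b \<bullet> t) \<partial>M))"
      by (simp add: f_def inner_sum_left)
    also have "\<dots> = (\<integral>\<omega>. (\<Sum>b\<in>Basis. (\<xi> \<omega> \<bullet> s) * (\<xi> \<omega> \<bullet> b) * (b \<bullet> t)) \<partial>M)"
      by (intro Bochner_Integration.integral_sum[symmetric] integrable_mult_left int)
    also have "\<dots> = (\<integral>\<omega>. (\<xi> \<omega> \<bullet> s) * (\<xi> \<omega> \<bullet> t) \<partial>M)"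
    proof (intro Bochner_Integration.integral_cong refl)
      fix \<omega>
      have "\<xi> \<omega> \<bullet> t = (\<Sum>b\<in>Basis. (\<xi> \<omega> \<bullet> b) * (b \<bullet> t))"
        unfolding euclidean_inner[of "\<xi> \<omega>" t] by (simp only: inner_commute)
      then show "(\<Sum>b\<in>Basis. (\<xi> \<omega> \<bullet> s) * (\<xi> \<omega> \<bullet> b) * (b \<bullet> t)) = (\<xi> \<omega> \<bullet> s) * (\<xi> \<omega> \<bullet> t)"
        by (simp only: sum_distrib_left mult.assoc)
    qed
    finally show ?thesis .
  qed
  have "linear f"
  proof (rule linearI)
    show "f (x + y) = f x + f y" for x y
      unfolding f_def by (simp add: inner_add_right distrib_right int scaleR_add_left sum.distrib)
    show "f (c *\<^sub>R x) = c *\<^sub>R f x" for c x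
      unfolding f_def by (simp add: scaleR_sum_right mult.assoc)
  qed
  moreover have "f x \<bullet> y = x \<bullet> f y" for x y
    using fst[of x y] fst[of y x] by (simp add: inner_commute[of x "f y"] mult.commute)
  moreover have sq: "t \<bullet> f t = (\<integral>\<omega>. (\<xi> \<omega> \<bullet> t)\<^sup>2 \<partial>M)" for t
    using fst[of t t] by (simp add: inner_commute[of t "f t"] power2_eq_square)
  ultimately show ?thesis
    using gaussian_law_exists_of_operator[of f] unfolding gaussian_law_of_def by auto
qed

lemma gaussian_law_of_linear_image:
  fixes g :: "'e::euclidean_space \<Rightarrow> 'f::euclidean_space"
  assumes L: "gaussian_law_of M \<xi> L" and g: "linear g"
  shows "gaussian_law_of M (\<lambda>\<omega>. g (\<xi> \<omega>)) (distr L borel g)"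
proof -
  have sL: "prob_space L" "sets L = sets borel" using L by (auto simp: gaussian_law_of_def)
  have gb: "g \<in> borel_measurable borel"
    using g linear_continuous_on linear_conv_bounded_linear by (blast intro: borel_measurable_continuous_onI)
  then have gm: "g \<in> borel_measurable L" by (simp add: measurable_cong_sets[OF sL(2) refl])
  have "distr (distr L borel g) borel (\<lambda>y. y \<bullet> t)
      = normal_law 0 (sqrt (\<integral>\<omega>. (g (\<xi> \<omega>) \<bullet> t)\<^sup>2 \<partial>M))" for t
  proof -
    have "distr (distr L borel g) borel (\<lambda>y. y \<bullet> t) = distr L borel (\<lambda>x. x \<bullet> adjoint g t)"
      using gm by (subst distr_distr) (auto simp: o_def adjoint_works[OF g])
    also have "\<dots> = normal_law 0 (sqrt (\<integral>\<omega>. (\<xi> \<omega> \<bullet> adjoint g t)\<^sup>2 \<partial>M))"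
      using L by (simp only: gaussian_law_of_def)
    finally show ?thesis by (simp only: adjoint_works[OF g])
  qed
  then show ?thesis
    using prob_space.prob_space_distr[OF sL(1) gm] by (simp add: gaussian_law_of_def)
qed

text \<open>
  Second moments of all projections are known, and mixed moments follow by polarisation.
\<close>

lemma gaussian_law_of_moments:
  assumes L: "gaussian_law_of M \<xi> L"
    and \<xi>: "\<xi> \<in> borel_measurable M" "integrable M (\<lambda>\<omega>. (norm (\<xi> \<omega>))\<^sup>2)"
  shows "(\<integral>x. x \<bullet> t \<partial>L) = 0"
    "(\<integral>x. (x \<bullet> s) * (x \<bullet> t) \<partial>L) = (\<integral>\<omega>. (\<xi> \<omega> \<bullet> s) * (\<xi> \<omega> \<bullet> t) \<partial>M)"
proof -
  have sL: "sets L = sets borel" and dist: "\<And>t. distr L borel (\<lambda>x. x \<bullet> t) =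
      normal_law 0 (sqrt (\<integral>\<omega>. (\<xi> \<omega> \<bullet> t)\<^sup>2 \<partial>M))"
    using L by (auto simp: gaussian_law_of_def)
  have m: "(\<lambda>x. x \<bullet> t) \<in> borel_measurable L" for t by (simp add: measurable_cong_sets[OF sL refl])
  have nn: "0 \<le> sqrt (\<integral>\<omega>. (\<xi> \<omega> \<bullet> t)\<^sup>2 \<partial>M)" for t by simp
  note mom = normal_law_moments[OF nn, folded dist]
  show "(\<integral>x. x \<bullet> t \<partial>L) = 0"
    using mom(1)[of t] m by (simp add: integral_distr)
  have I2: "integrable L (\<lambda>x. (x \<bullet> t)\<^sup>2)" and E2: "(\<integral>x. (x \<bullet> t)\<^sup>2 \<partial>L) = (\<integral>\<omega>. (\<xi> \<omega> \<bullet> t)\<^sup>2 \<partial>M)" for t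
    using mom(2,3)[of t] m by (simp_all add: integral_distr integrable_distr_eq)
  have polar: "a * b = ((a + b)\<^sup>2 - a\<^sup>2 - b\<^sup>2) / 2" for a b :: real
    by (simp add: power2_eq_square algebra_simps)
  have J2: "integrable M (\<lambda>\<omega>. (\<xi> \<omega> \<bullet> t)\<^sup>2)" for t
    using integrable_inner_products[OF \<xi>, of t t] by (simp add: power2_eq_square)
  have "(\<integral>x. (x \<bullet> s) * (x \<bullet> t) \<partial>L) = (\<integral>x. ((x \<bullet> (s + t))\<^sup>2 - (x \<bullet> s)\<^sup>2 - (x \<bullet> t)\<^sup>2) / 2 \<partial>L)"
    by (simp only: polar[of "_ \<bullet> s" "_ \<bullet> t"] inner_add_right)
  also have "\<dots> = ((\<integral>\<omega>. (\<xi> \<omega> \<bullet> (s + t))\<^sup>2 \<partial>M) - (\<integral>\<omega>. (\<xi> \<omega> \<bullet> s)\<^sup>2 \<partial>M) - (\<integral>\<omega>. (\<xi> \<omega> \<bullet> t)\<^sup>2 \<partial>M)) / 2"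
    by (simp add: I2 E2)
  also have "\<dots> = (\<integral>\<omega>. ((\<xi> \<omega> \<bullet> (s + t))\<^sup>2 - (\<xi> \<omega> \<bullet> s)\<^sup>2 - (\<xi> \<omega> \<bullet> t)\<^sup>2) / 2 \<partial>M)"
    by (simp add: J2)
  also have "\<dots> = (\<integral>\<omega>. (\<xi> \<omega> \<bullet> s) * (\<xi> \<omega> \<bullet> t) \<partial>M)"
    by (simp only: polar[of "_ \<bullet> s" "_ \<bullet> t"] inner_add_right)
  finally show "(\<integral>x. (x \<bullet> s) * (x \<bullet> t) \<partial>L) = (\<integral>\<omega>. (\<xi> \<omega> \<bullet> s) * (\<xi> \<omega> \<bullet> t) \<partial>M)" .
qed

lemma inner_axis_axis: "(G :: real^'k^'m) \<bullet> axis i (axis j 1) = G $ i $ j"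
  by (simp add: inner_axis)

lemma gaussian_law_of_matrix:
  fixes \<xi> :: "'a \<Rightarrow> real^'k^'m"
  assumes L: "gaussian_law_of M \<xi> L"
    and \<xi>: "\<xi> \<in> borel_measurable M" "integrable M (\<lambda>\<omega>. (norm (\<xi> \<omega>))\<^sup>2)"
  shows "centered_gaussian_matrix_law L (\<lambda>i j s t. \<integral>\<omega>. \<xi> \<omega> $ i $ j * \<xi> \<omega> $ s $ t \<partial>M)"
proof -
  note mom = gaussian_law_of_moments[OF L \<xi>]
  have "\<exists>\<mu> \<sigma>. 0 \<le> \<sigma> \<and>
      distr L borel (\<lambda>G. \<Sum>i\<in>UNIV. \<Sum>j\<in>UNIV. a i j * G $ i $ j) = normal_law \<mu> \<sigma>" for a
  proof -
    have "(\<Sum>i\<in>UNIV. \<Sum>j\<in>UNIV. a i j * G $ i $ j) = G \<bullet> (\<chi> i j. a i j)" for G :: "real^'k^'m"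
      by (simp add: inner_vec_def mult.commute)
    then show ?thesis
      using L unfolding gaussian_law_of_def
      by (intro exI[of _ 0] exI[of _ "sqrt (\<integral>\<omega>. (\<xi> \<omega> \<bullet> (\<chi> i j. a i j))\<^sup>2 \<partial>M)"]) simp
  qed
  then show ?thesis
    using L mom(1)[of "axis _ (axis _ 1)"] mom(2)[of "axis _ (axis _ 1)" "axis _ (axis _ 1)"]
    unfolding centered_gaussian_matrix_law_def gaussian_matrix_law_def gaussian_law_of_def
    by (simp add: inner_axis_axis)
qed

section \<open>Limit theorems for independent, identically distributed variables\<close>

lemma expectation_eq_of_distr_eq:
  fixes h :: "'b::topological_space \<Rightarrow> real"
  assumes "Y \<in> borel_measurable M" "Z \<in> borel_measurable M" "h \<in> borel_measurable borel"
    and eq: "distr M borel Y = distr M borel Z"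
  shows "(\<integral>\<omega>. h (Y \<omega>) \<partial>M) = (\<integral>\<omega>. h (Z \<omega>) \<partial>M)"
    "integrable M (\<lambda>\<omega>. h (Y \<omega>)) \<longleftrightarrow> integrable M (\<lambda>\<omega>. h (Z \<omega>))"
  using integral_distr[OF assms(1,3)] integral_distr[OF assms(2,3)]
    integrable_distr_eq[OF assms(1,3)] integrable_distr_eq[OF assms(2,3)] eq by simp_all

lemma distr_compose_eq:
  assumes "Y \<in> borel_measurable M" "Z \<in> borel_measurable M" "h \<in> borel_measurable borel"
    and eq: "distr M borel Y = distr M borel Z"
  shows "distr M borel (\<lambda>\<omega>. h (Y \<omega>)) = distr M borel (\<lambda>\<omega>. h (Z \<omega>))"
proof -
  have "distr M borel (\<lambda>\<omega>. h (Y \<omega>)) = distr (distr M borel Y) borel h"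
    using assms(1,3) by (simp add: distr_distr o_def)
  also have "\<dots> = distr M borel (\<lambda>\<omega>. h (Z \<omega>))"
    using assms(2,3) by (simp add: eq distr_distr o_def)
  finally show ?thesis .
qed

text \<open>
  The classical theorem for positive variance, together with the degenerate case, in which all
  summands vanish almost surely and the limit is a point mass.
\<close>

lemma (in prob_space) central_limit_theorem_1d:
  fixes Z :: "nat \<Rightarrow> 'a \<Rightarrow> real"
  assumes indep: "indep_vars (\<lambda>_. borel) Z UNIV"
    and dist: "\<And>i. distr M borel (Z i) = distr M borel (Z 0)"
    and sq: "integrable M (\<lambda>\<omega>. (Z 0 \<omega>)\<^sup>2)" and mean: "expectation (Z 0) = 0"
  shows "conv_in_distr M (\<lambda>n \<omega>. (\<Sum>i<n. Z i \<omega>) / sqrt (real n))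
    (normal_law 0 (sqrt (expectation (\<lambda>\<omega>. (Z 0 \<omega>)\<^sup>2))))"
proof -
  have Z [measurable]: "Z i \<in> borel_measurable M" for i using indep by (simp add: indep_vars_def2)
  define \<sigma> where "\<sigma> = sqrt (expectation (\<lambda>\<omega>. (Z 0 \<omega>)\<^sup>2))"
  have \<sigma>0: "\<sigma> \<ge> 0" by (simp add: \<sigma>_def)
  have \<sigma>2: "expectation (\<lambda>\<omega>. (Z 0 \<omega>)\<^sup>2) = \<sigma>\<^sup>2" by (simp add: \<sigma>_def)
  have sqi: "integrable M (\<lambda>\<omega>. (Z i \<omega>)\<^sup>2)" "expectation (\<lambda>\<omega>. (Z i \<omega>)\<^sup>2) = \<sigma>\<^sup>2" for i
    using expectation_eq_of_distr_eq[OF Z Z _ dist, of "\<lambda>x. x\<^sup>2" i] sq \<sigma>2 by simp_all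
  have mi: "expectation (Z i) = 0" for i
    using expectation_eq_of_distr_eq(1)[OF Z Z _ dist, of "\<lambda>x. x" i] mean by simp
  show ?thesis unfolding \<sigma>_def[symmetric]
  proof (cases "\<sigma> = 0")
    case True
    have "AE \<omega> in M. Z i \<omega> = 0" for i
      using sqi[of i] True by (simp add: integral_nonneg_eq_0_iff_AE)
    then have AE0: "AE \<omega> in M. \<forall>i. Z i \<omega> = 0" by (simp add: AE_all_countable)
    have "(\<integral>\<omega>. f ((\<Sum>i<n. Z i \<omega>) / sqrt (real n)) \<partial>M) = f 0"
      if f: "continuous_on UNIV f" for f :: "real \<Rightarrow> real" and n
    proof -
      have [measurable]: "f \<in> borel_measurable borel" by (rule borel_measurable_continuous_onI[OF f])
      have "AE \<omega> in M. f ((\<Sum>i<n. Z i \<omega>) / sqrt (real n)) = f 0"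
        using AE0 by eventually_elim simp
      then have "(\<integral>\<omega>. f ((\<Sum>i<n. Z i \<omega>) / sqrt (real n)) \<partial>M) = (\<integral>\<omega>. f 0 \<partial>M)"
        by (intro integral_cong_AE) auto
      then show ?thesis by (simp add: prob_space)
    qed
    moreover have "(\<integral>x. f x \<partial>return borel 0) = f 0"
      if "continuous_on UNIV f" for f :: "real \<Rightarrow> real"
      using borel_measurable_continuous_onI[OF that] by (simp add: integral_return)
    ultimately show "conv_in_distr M (\<lambda>n \<omega>. (\<Sum>i<n. Z i \<omega>) / sqrt (real n)) (normal_law 0 \<sigma>)"
      using True by (auto simp: conv_in_distr_def normal_law_def prob_space_return)
  next
    case False
    then have \<sigma>: "\<sigma> > 0" using \<sigma>0 by simp
    interpret N: real_distribution std_normal_distribution by (rule real_dist_normal_dist)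
    have "weak_conv_m (\<lambda>n. distr M borel (\<lambda>x. (\<Sum>i<n. Z i x) / sqrt (real n * \<sigma>\<^sup>2))) std_normal_distribution"
      by (rule central_limit_theorem_zero_mean[OF indep mi \<sigma> sqi(1) _ dist]) (simp add: mi sqi)
    then have "conv_in_distr M (\<lambda>n x. (\<Sum>i<n. Z i x) / sqrt (real n * \<sigma>\<^sup>2)) std_normal_distribution"
      by (subst conv_in_distr_iff_weak_conv_m) (auto intro: prob_space_axioms N.prob_space_axioms)
    from conv_in_distr_continuous_map[OF this, of "\<lambda>x. \<sigma> * x"]
    have "conv_in_distr M (\<lambda>n x. \<sigma> * ((\<Sum>i<n. Z i x) / sqrt (real n * \<sigma>\<^sup>2))) (normal_law 0 \<sigma>)"
      by (simp add: normal_law_eq_distr[OF \<sigma>0] continuous_on_mult_left)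
    moreover have "\<sigma> * (y / sqrt (real n * \<sigma>\<^sup>2)) = y / sqrt (real n)" for y n
      using \<sigma> by (simp add: real_sqrt_mult)
    ultimately show "conv_in_distr M (\<lambda>n \<omega>. (\<Sum>i<n. Z i \<omega>) / sqrt (real n)) (normal_law 0 \<sigma>)"
      by simp
  qed
qed

lemma (in prob_space) multivariate_central_limit_theorem:
  fixes \<xi> :: "nat \<Rightarrow> 'a \<Rightarrow> 'e::euclidean_space"
  assumes indep: "indep_vars (\<lambda>_. borel) \<xi> UNIV"
    and dist: "\<And>i. distr M borel (\<xi> i) = distr M borel (\<xi> 0)"
    and sq: "integrable M (\<lambda>\<omega>. (norm (\<xi> 0 \<omega>))\<^sup>2)" and mean: "\<And>t. expectation (\<lambda>\<omega>. \<xi> 0 \<omega> \<bullet> t) = 0"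
    and L: "gaussian_law_of M (\<xi> 0) L"
  shows "conv_in_distr M (\<lambda>n \<omega>. (1 / sqrt (real n)) *\<^sub>R (\<Sum>i<n. \<xi> i \<omega>)) L"
proof (rule cramer_wold)
  have [measurable]: "\<xi> i \<in> borel_measurable M" for i using indep by (simp add: indep_vars_def2)
  show "(\<lambda>\<omega>. (1 / sqrt (real n)) *\<^sub>R (\<Sum>i<n. \<xi> i \<omega>)) \<in> borel_measurable M" for n by measurable
  show "prob_space L" "sets L = sets borel" using L by (auto simp: gaussian_law_of_def)
  fix t
  have "conv_in_distr M (\<lambda>n \<omega>. (\<Sum>i<n. \<xi> i \<omega> \<bullet> t) / sqrt (real n))
    (normal_law 0 (sqrt (expectation (\<lambda>\<omega>. (\<xi> 0 \<omega> \<bullet> t)\<^sup>2))))"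
  proof (rule central_limit_theorem_1d)
    show "indep_vars (\<lambda>_. borel) (\<lambda>i \<omega>. \<xi> i \<omega> \<bullet> t) UNIV"
      using indep_vars_compose2[OF indep, of "\<lambda>_ x. x \<bullet> t" "\<lambda>_. borel"] by simp
    show "distr M borel (\<lambda>\<omega>. \<xi> i \<omega> \<bullet> t) = distr M borel (\<lambda>\<omega>. \<xi> 0 \<omega> \<bullet> t)" for i
      by (rule distr_compose_eq[OF _ _ _ dist, where h = "\<lambda>x. x \<bullet> t"]) auto
    show "integrable M (\<lambda>\<omega>. (\<xi> 0 \<omega> \<bullet> t)\<^sup>2)"
      using integrable_inner_products[OF _ sq, of t t] by (simp flip: power2_eq_square)
  qed (rule mean)
  then show "conv_in_distr M (\<lambda>n \<omega>. ((1 / sqrt (real n)) *\<^sub>R (\<Sum>i<n. \<xi> i \<omega>)) \<bullet> t) (distr L borel (\<lambda>x. x \<bullet> t))"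
    using L unfolding gaussian_law_of_def by (simp add: inner_sum_left)
qed

text \<open>
  By the central limit theorem the centred sums divided by \<open>sqrt n\<close> are tight, so dividing by another
  \<open>sqrt n\<close> sends them to \<open>0\<close>.
\<close>

lemma (in prob_space) weak_law_of_large_numbers_bounded:
  fixes Z :: "nat \<Rightarrow> 'a \<Rightarrow> real"
  assumes indep: "indep_vars (\<lambda>_. borel) Z UNIV"
    and dist: "\<And>i. distr M borel (Z i) = distr M borel (Z 0)"
    and bdd: "\<And>\<omega>. \<bar>Z 0 \<omega>\<bar> \<le> K"
  shows "((\<lambda>(n, \<omega>). (\<Sum>i<n. Z i \<omega>) / real n - expectation (Z 0)) \<longlongrightarrow> 0) (in_prob M)"
proof -
  have [measurable]: "Z i \<in> borel_measurable M" for i using indep by (simp add: indep_vars_def2)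
  define m where "m = expectation (Z 0)"
  have int: "integrable M (Z 0)" by (rule integrable_const_bound[of _ K]) (auto simp: bdd)
  have "conv_in_distr M (\<lambda>n \<omega>. (\<Sum>i<n. Z i \<omega> - m) / sqrt (real n))
    (normal_law 0 (sqrt (expectation (\<lambda>\<omega>. (Z 0 \<omega> - m)\<^sup>2))))"
  proof (rule central_limit_theorem_1d)
    show "indep_vars (\<lambda>_. borel) (\<lambda>i \<omega>. Z i \<omega> - m) UNIV"
      using indep_vars_compose2[OF indep, of "\<lambda>_ x. x - m" "\<lambda>_. borel"] by simp
    show "distr M borel (\<lambda>\<omega>. Z i \<omega> - m) = distr M borel (\<lambda>\<omega>. Z 0 \<omega> - m)" for i
      by (rule distr_compose_eq[OF _ _ _ dist, where h = "\<lambda>x. x - m"]) auto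
    have "\<bar>Z 0 \<omega> - m\<bar> \<le> K + \<bar>m\<bar>" for \<omega> using bdd[of \<omega>] by linarith
    then have "(Z 0 \<omega> - m)\<^sup>2 \<le> (K + \<bar>m\<bar>)\<^sup>2" for \<omega>
      using power_mono[of "\<bar>Z 0 \<omega> - m\<bar>" "K + \<bar>m\<bar>" 2] by simp
    then show "integrable M (\<lambda>\<omega>. (Z 0 \<omega> - m)\<^sup>2)"
      by (intro integrable_const_bound[of _ "(K + \<bar>m\<bar>)\<^sup>2"]) auto
    show "expectation (\<lambda>\<omega>. Z 0 \<omega> - m) = 0" using int by (simp add: m_def prob_space)
  qed
  from conv_in_distr_imp_tight[OF this]
  have tight: "tight_seq M (\<lambda>n \<omega>. (\<Sum>i<n. Z i \<omega> - m) / sqrt (real n))" .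
  have "((\<lambda>(n, \<omega>). 1 / sqrt (real n)) \<longlongrightarrow> 0) (in_prob M)"
  proof (rule tendstoI)
    fix e :: real assume "e > 0"
    moreover have "(\<lambda>n. 1 / sqrt (real n)) \<longlonglongrightarrow> 0"
      by (intro tendsto_divide_0[OF tendsto_const] filterlim_at_top_imp_at_infinity
          filterlim_compose[OF sqrt_at_top filterlim_real_sequentially])
    ultimately have "\<forall>\<^sub>F n in sequentially. dist (1 / sqrt (real n)) 0 < e" by (rule tendstoD[rotated])
    then show "\<forall>\<^sub>F x in in_prob M. dist (case x of (n, \<omega>) \<Rightarrow> 1 / sqrt (real n)) 0 < e"
      by (intro eventually_in_probI) simp
  qed
  from tight_seq_mult_tendsto_0[OF tight this]
  have "((\<lambda>(n, \<omega>). 1 / sqrt (real n) * \<bar>(\<Sum>i<n. Z i \<omega> - m) / sqrt (real n)\<bar>) \<longlongrightarrow> 0) (in_prob M)"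
    by simp
  moreover have "\<forall>\<^sub>F x in in_prob M. (case x of (n, \<omega>) \<Rightarrow> 1 / sqrt (real n) * \<bar>(\<Sum>i<n. Z i \<omega> - m) / sqrt (real n)\<bar>)
      = (case x of (n, \<omega>) \<Rightarrow> \<bar>(\<Sum>i<n. Z i \<omega>) / real n - m\<bar>)"
  proof (intro eventually_in_probI eventually_sequentiallyI[of 1] ballI, unfold case_prod_conv)
    fix n \<omega> assume "1 \<le> (n :: nat)"
    then have n: "real n > 0" by simp
    have "1 / sqrt (real n) * \<bar>(\<Sum>i<n. Z i \<omega> - m) / sqrt (real n)\<bar>
        = \<bar>\<Sum>i<n. Z i \<omega> - m\<bar> / (sqrt (real n) * sqrt (real n))"
      using n by (simp add: abs_divide)
    also have "\<dots> = \<bar>(\<Sum>i<n. Z i \<omega> - m) / real n\<bar>" using n by simp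
    also have "(\<Sum>i<n. Z i \<omega> - m) / real n = (\<Sum>i<n. Z i \<omega>) / real n - m"
      using n by (simp add: sum_subtractf diff_divide_distrib)
    finally show "1 / sqrt (real n) * \<bar>(\<Sum>i<n. Z i \<omega> - m) / sqrt (real n)\<bar>
        = \<bar>(\<Sum>i<n. Z i \<omega>) / real n - m\<bar>" .
  qed
  ultimately have "((\<lambda>(n, \<omega>). \<bar>(\<Sum>i<n. Z i \<omega>) / real n - m\<bar>) \<longlongrightarrow> 0) (in_prob M)"
    by (rule Lim_transform_eventually)
  then have "((\<lambda>x. \<bar>case x of (n, \<omega>) \<Rightarrow> (\<Sum>i<n. Z i \<omega>) / real n - m\<bar>) \<longlongrightarrow> 0) (in_prob M)"
    by (simp add: case_prod_unfold)
  then show ?thesis unfolding m_def[symmetric] by (rule tendsto_rabs_zero_cancel)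
qed

text \<open>
  Only a first moment is available for the diagonal blocks of the sample matrix. Truncation at a high
  level \<open>K\<close> reduces the claim to bounded variables; the averages of the remainders are small in mean,
  uniformly in \<open>n\<close>, and Markov's inequality applies.
\<close>

lemma (in prob_space) weak_law_of_large_numbers:
  fixes Z :: "nat \<Rightarrow> 'a \<Rightarrow> real"
  assumes indep: "indep_vars (\<lambda>_. borel) Z UNIV"
    and dist: "\<And>i. distr M borel (Z i) = distr M borel (Z 0)"
    and int: "integrable M (Z 0)"
  shows "((\<lambda>(n, \<omega>). (\<Sum>i<n. Z i \<omega>) / real n - expectation (Z 0)) \<longlongrightarrow> 0) (in_prob M)"
proof (rule tendsto_in_probI)
  have Z [measurable]: "Z i \<in> borel_measurable M" for i using indep by (simp add: indep_vars_def2)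
  fix e \<delta> :: real assume e: "e > 0" and \<delta>: "\<delta> > 0"
  define clip where "clip K x = max (- real K) (min (real K) x)" for K :: nat and x :: real
  define rest where "rest K x = x - clip K x" for K x
  have clip_meas [measurable]: "clip K \<in> borel_measurable borel" for K unfolding clip_def by measurable
  have rest_meas [measurable]: "rest K \<in> borel_measurable borel" for K unfolding rest_def by measurable
  have rest_le: "\<bar>rest K x\<bar> \<le> \<bar>x\<bar>" for K x by (auto simp: rest_def clip_def)
  have "(\<lambda>K. expectation (\<lambda>\<omega>. \<bar>rest K (Z 0 \<omega>)\<bar>)) \<longlonglongrightarrow> expectation (\<lambda>\<omega>. 0)"
  proof (rule integral_dominated_convergence[where w = "\<lambda>\<omega>. \<bar>Z 0 \<omega>\<bar>"])
    have "(\<lambda>K. \<bar>rest K x\<bar>) \<longlonglongrightarrow> 0" for x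
    proof (rule tendsto_eventually)
      obtain N where "\<bar>x\<bar> \<le> real N" using real_arch_simple by blast
      then show "\<forall>\<^sub>F K in sequentially. \<bar>rest K x\<bar> = 0"
        by (intro eventually_sequentiallyI[of N]) (auto simp: rest_def clip_def)
    qed
    then show "AE \<omega> in M. (\<lambda>K. \<bar>rest K (Z 0 \<omega>)\<bar>) \<longlonglongrightarrow> 0" by simp
  qed (auto simp: rest_le int)
  \<comment> \<open>the first bound controls the change of the mean, the second is Markov's inequality at level \<open>e / 4\<close> and probability \<open>\<delta> / 2\<close>\<close>
  moreover define \<eta> where "\<eta> = min (e / 4) (e * \<delta> / 8)"
  ultimately have "\<forall>\<^sub>F K in sequentially. expectation (\<lambda>\<omega>. \<bar>rest K (Z 0 \<omega>)\<bar>) < \<eta>"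
    using e \<delta> by (intro order_tendstoD(2)) auto
  then obtain K where K: "expectation (\<lambda>\<omega>. \<bar>rest K (Z 0 \<omega>)\<bar>) < \<eta>"
    using eventually_happens'[OF sequentially_bot] by blast
  have int0: "integrable M (\<lambda>\<omega>. rest K (Z 0 \<omega>))"
    using int by (rule Bochner_Integration.integrable_bound) (auto simp: rest_le)
  have inti: "integrable M (\<lambda>\<omega>. \<bar>rest K (Z i \<omega>)\<bar>)"
    "expectation (\<lambda>\<omega>. \<bar>rest K (Z i \<omega>)\<bar>) = expectation (\<lambda>\<omega>. \<bar>rest K (Z 0 \<omega>)\<bar>)" for i
    using expectation_eq_of_distr_eq[OF Z Z _ dist, of "\<lambda>x. \<bar>rest K x\<bar>" i] int0 by simp_all
  have clip_int: "integrable M (\<lambda>\<omega>. clip K (Z 0 \<omega>))"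
    by (rule integrable_const_bound[of _ "real K"]) (auto simp: clip_def)
  have mean_split: "expectation (Z 0) = expectation (\<lambda>\<omega>. clip K (Z 0 \<omega>)) + expectation (\<lambda>\<omega>. rest K (Z 0 \<omega>))"
    using Bochner_Integration.integral_add[OF clip_int int0] by (simp add: rest_def)
  have "\<bar>expectation (\<lambda>\<omega>. rest K (Z 0 \<omega>))\<bar> \<le> expectation (\<lambda>\<omega>. \<bar>rest K (Z 0 \<omega>)\<bar>)"
    by (rule integral_abs_bound)
  moreover have "\<eta> \<le> e / 4" by (simp add: \<eta>_def)
  ultimately have mean_rest: "\<bar>expectation (\<lambda>\<omega>. rest K (Z 0 \<omega>))\<bar> < e / 4" using K by linarith
  have "((\<lambda>(n, \<omega>). (\<Sum>i<n. clip K (Z i \<omega>)) / real n - expectation (\<lambda>\<omega>. clip K (Z 0 \<omega>))) \<longlongrightarrow> 0) (in_prob M)"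
  proof (rule weak_law_of_large_numbers_bounded[where K = "real K"])
    show "indep_vars (\<lambda>_. borel) (\<lambda>i \<omega>. clip K (Z i \<omega>)) UNIV"
      using indep_vars_compose2[OF indep, of "\<lambda>_. clip K" "\<lambda>_. borel"] by simp
    show "distr M borel (\<lambda>\<omega>. clip K (Z i \<omega>)) = distr M borel (\<lambda>\<omega>. clip K (Z 0 \<omega>))" for i
      by (rule distr_compose_eq[OF Z Z clip_meas dist])
  qed (auto simp: clip_def)
  from tendsto_in_probD[OF this, of "e / 4" "\<delta> / 2"] e \<delta>
  have "\<forall>\<^sub>F n in sequentially. rarely_fails M (\<delta> / 2) (\<lambda>\<omega>.
      \<bar>(\<Sum>i<n. clip K (Z i \<omega>)) / real n - expectation (\<lambda>\<omega>. clip K (Z 0 \<omega>))\<bar> < e / 4)" by simp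
  then show "\<forall>\<^sub>F n in sequentially. rarely_fails M \<delta> (\<lambda>\<omega>.
      norm ((\<Sum>i<n. Z i \<omega>) / real n - expectation (Z 0)) < e)"
    using eventually_gt_at_top[of "0 :: nat"]
  proof eventually_elim
    fix n
    assume core: "rarely_fails M (\<delta> / 2) (\<lambda>\<omega>.
        \<bar>(\<Sum>i<n. clip K (Z i \<omega>)) / real n - expectation (\<lambda>\<omega>. clip K (Z 0 \<omega>))\<bar> < e / 4)"
      and n: "0 < n"
    define r where "r \<omega> = (\<Sum>i<n. \<bar>rest K (Z i \<omega>)\<bar>) / real n" for \<omega>
    have "(\<Sum>i<n. expectation (\<lambda>\<omega>. \<bar>rest K (Z i \<omega>)\<bar>)) = (\<Sum>i<n. expectation (\<lambda>\<omega>. \<bar>rest K (Z 0 \<omega>)\<bar>))"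
      by (intro sum.cong refl inti(2))
    then have "expectation r = expectation (\<lambda>\<omega>. \<bar>rest K (Z 0 \<omega>)\<bar>)"
      unfolding r_def using inti(1) n by simp
    moreover have "\<eta> \<le> e / 4 * (\<delta> / 2)" by (simp add: \<eta>_def)
    ultimately have "expectation r < e / 4 * (\<delta> / 2)" using K by linarith
    moreover have "integrable M r" unfolding r_def using inti(1) by simp
    moreover have "0 \<le> r \<omega>" for \<omega> by (simp add: r_def sum_nonneg)
    ultimately have "rarely_fails M (\<delta> / 2) (\<lambda>\<omega>. r \<omega> < e / 4)"
      using e by (intro rarely_fails_markov) auto
    with core show "rarely_fails M \<delta> (\<lambda>\<omega>. norm ((\<Sum>i<n. Z i \<omega>) / real n - expectation (Z 0)) < e)"
    proof (rule rarely_fails_mono[OF rarely_fails_conj])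
      fix \<omega>
      assume \<omega>: "\<bar>(\<Sum>i<n. clip K (Z i \<omega>)) / real n - expectation (\<lambda>\<omega>. clip K (Z 0 \<omega>))\<bar> < e / 4
        \<and> r \<omega> < e / 4"
      have "(\<Sum>i<n. Z i \<omega>) / real n = (\<Sum>i<n. clip K (Z i \<omega>)) / real n + (\<Sum>i<n. rest K (Z i \<omega>)) / real n"
        by (simp add: rest_def sum_subtractf diff_divide_distrib)
      moreover have "\<bar>(\<Sum>i<n. rest K (Z i \<omega>)) / real n\<bar> \<le> r \<omega>"
        by (simp add: r_def abs_divide divide_right_mono sum_abs)
      ultimately show "norm ((\<Sum>i<n. Z i \<omega>) / real n - expectation (Z 0)) < e"
        using mean_split mean_rest \<omega> unfolding real_norm_def by linarith
    qed
  qed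
qed

lemma (in prob_space) indep_vars_reindex:
  assumes indep: "indep_vars (\<lambda>_. N) X (f ` I)" and inj: "inj_on f I"
  shows "indep_vars (\<lambda>_. N) (\<lambda>i. X (f i)) I"
  unfolding indep_vars_def2 indep_sets_def
proof (intro conjI ballI allI impI)
  show "random_variable N (X (f i))" if "i \<in> I" for i using indep that by (auto simp: indep_vars_def2)
  show "{X (f i) -` A \<inter> space M |A. A \<in> sets N} \<subseteq> events" if "i \<in> I" for i
    using indep that by (auto simp: indep_vars_def2 intro: measurable_sets)
  fix J A assume J: "J \<subseteq> I" "J \<noteq> {}" "finite J"
    and A: "A \<in> (\<Pi> j\<in>J. {X (f j) -` A \<inter> space M |A. A \<in> sets N})"
  have injJ: "inj_on f J" using inj J(1) by (rule inj_on_subset)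
  define A' where "A' = A \<circ> the_inv_into J f"
  have A': "A' (f j) = A j" if "j \<in> J" for j
    using that injJ by (simp add: A'_def the_inv_into_f_f)
  have "A' \<in> (\<Pi> j\<in>f ` J. {X j -` A \<inter> space M |A. A \<in> sets N})"
    using A A' by (auto simp: Pi_iff)
  moreover have "f ` J \<subseteq> f ` I" "f ` J \<noteq> {}" "finite (f ` J)" using J by auto
  ultimately have "prob (\<Inter>j\<in>f ` J. A' j) = (\<Prod>j\<in>f ` J. prob (A' j))"
    using indep unfolding indep_vars_def2 indep_sets_def by blast
  then show "prob (\<Inter>j\<in>J. A j) = (\<Prod>j\<in>J. prob (A j))"
    using A' injJ by (simp add: prod.reindex)
qed

section \<open>Sample second moments\<close>

lemma (in prob_space) indep_vars_Suc:
  assumes "indep_vars (\<lambda>_. N) X {1..}"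
  shows "indep_vars (\<lambda>_. N) (\<lambda>i. X (Suc i)) UNIV"
proof (rule indep_vars_reindex[where f = Suc])
  have "range Suc = {1..}" by (auto simp: image_iff Suc_le_eq gr0_conv_Suc)
  with assms show "indep_vars (\<lambda>_. N) X (range Suc)" by simp
qed simp

lemma (in prob_space) emp_second_moment_tendsto:
  fixes X :: "'a \<Rightarrow> real^'d"
  assumes X [measurable]: "X \<in> borel_measurable M"
    and indep: "indep_vars (\<lambda>_. borel) Xs {1..}"
    and dist: "\<And>i. i \<ge> 1 \<Longrightarrow> distr M borel (Xs i) = distr M borel X"
    and sq: "integrable M (\<lambda>\<omega>. (norm (X \<omega>))\<^sup>2)"
  shows "((\<lambda>(n, \<omega>). emp_second_moment Xs n \<omega>) \<longlongrightarrow> second_moment M X) (in_prob M)"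
proof (intro vec_tendstoI)
  fix r c :: 'd
  have Xs: "Xs (Suc i) \<in> borel_measurable M" for i using indep by (auto simp: indep_vars_def2)
  note indep' = indep_vars_Suc[OF indep]
  define h where "h x = x $ r * x $ c" for x :: "real^'d"
  have h [measurable]: "h \<in> borel_measurable borel" unfolding h_def by measurable
  have io: "integrable M (\<lambda>\<omega>. outer (X \<omega>))" by (rule integrable_outer[OF X sq])
  have bl: "bounded_linear (\<lambda>A :: real^'d^'d. A $ r $ c)"
    by (rule bounded_linear_compose[OF bounded_linear_vec_nth bounded_linear_vec_nth])
  have hX: "integrable M (\<lambda>\<omega>. h (X \<omega>))" "expectation (\<lambda>\<omega>. h (X \<omega>)) = second_moment M X $ r $ c"
    using integrable_bounded_linear[OF bl io] integral_bounded_linear[OF bl io]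
    by (simp_all add: h_def outer_def second_moment_def)
  have d: "distr M borel (Xs (Suc i)) = distr M borel X" for i by (rule dist) simp
  note eq = expectation_eq_of_distr_eq[OF Xs X h d]
  have "((\<lambda>(n, \<omega>). (\<Sum>i<n. h (Xs (Suc i) \<omega>)) / real n - expectation (\<lambda>\<omega>. h (Xs (Suc 0) \<omega>))) \<longlongrightarrow> 0) (in_prob M)"
  proof (rule weak_law_of_large_numbers)
    show "indep_vars (\<lambda>_. borel) (\<lambda>i \<omega>. h (Xs (Suc i) \<omega>)) UNIV"
      using indep_vars_compose2[OF indep', of "\<lambda>_. h" "\<lambda>_. borel"] by simp
    show "distr M borel (\<lambda>\<omega>. h (Xs (Suc i) \<omega>)) = distr M borel (\<lambda>\<omega>. h (Xs (Suc 0) \<omega>))" for i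
      by (rule distr_compose_eq[OF Xs Xs h]) (simp add: d)
    show "integrable M (\<lambda>\<omega>. h (Xs (Suc 0) \<omega>))" using eq hX by simp
  qed
  then have "((\<lambda>x. (\<Sum>i<fst x. h (Xs (Suc i) (snd x))) / real (fst x) - second_moment M X $ r $ c) \<longlongrightarrow> 0) (in_prob M)"
    using eq(1) hX(2) by (simp add: case_prod_unfold)
  then have "((\<lambda>x. (\<Sum>i<fst x. h (Xs (Suc i) (snd x))) / real (fst x)) \<longlongrightarrow> second_moment M X $ r $ c) (in_prob M)"
    by (simp only: LIM_zero_iff)
  moreover have "emp_second_moment Xs n \<omega> $ r $ c = (\<Sum>i<n. h (Xs (Suc i) \<omega>)) / real n" for n \<omega>
    by (simp add: emp_second_moment_def sum.atLeast1_atMost_eq outer_def h_def)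
  ultimately show "((\<lambda>x. (case x of (n, \<omega>) \<Rightarrow> emp_second_moment Xs n \<omega>) $ r $ c)
      \<longlongrightarrow> second_moment M X $ r $ c) (in_prob M)"
    by (simp add: case_prod_unfold)
qed

text \<open>
  The cross block of the sample error is the average of the matrices \<open>W\<^sup>T x x\<^sup>T V\<close>, which are centred
  because \<open>W\<^sup>T S V = 0\<close>, so that the multivariate central limit theorem applies.
\<close>

lemma (in prob_space) cross_block_clt:
  fixes X :: "'a \<Rightarrow> real^'d" and V :: "real^'k^'d" and W :: "real^'m^'d"
  defines "\<xi> x \<equiv> transpose W ** outer x ** V"
  assumes X [measurable]: "X \<in> borel_measurable M"
    and indep: "indep_vars (\<lambda>_. borel) Xs {1..}"
    and dist: "\<And>i. i \<ge> 1 \<Longrightarrow> distr M borel (Xs i) = distr M borel X"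
    and sq: "integrable M (\<lambda>\<omega>. (norm (X \<omega>))\<^sup>2)"
    and centered: "transpose W ** second_moment M X ** V = 0"
    and \<xi>sq: "integrable M (\<lambda>\<omega>. (norm (\<xi> (X \<omega>)))\<^sup>2)"
    and L: "gaussian_law_of M (\<lambda>\<omega>. \<xi> (X \<omega>)) L"
  shows "conv_in_distr M (\<lambda>n \<omega>. sqrt (real n) *\<^sub>R
    (transpose W ** (emp_second_moment Xs n \<omega> - second_moment M X) ** V)) L"
proof -
  have Xs: "Xs (Suc i) \<in> borel_measurable M" for i using indep by (auto simp: indep_vars_def2)
  note indep' = indep_vars_Suc[OF indep]
  have bl: "bounded_linear (\<lambda>A :: real^'d^'d. transpose W ** A ** V)"
    by (rule bounded_linear_compose[OF matrix_mult.bounded_linear_left matrix_mult.bounded_linear_right])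
  have \<xi> [measurable]: "\<xi> \<in> borel_measurable borel"
    unfolding \<xi>_def
    by (intro borel_measurable_continuous_onI continuous_on_compose2[OF linear_continuous_on[OF bl] continuous_on_outer]) auto
  have d: "distr M borel (Xs (Suc i)) = distr M borel X" for i by (rule dist) simp
  have "conv_in_distr M (\<lambda>n \<omega>. (1 / sqrt (real n)) *\<^sub>R (\<Sum>i<n. \<xi> (Xs (Suc i) \<omega>))) L"
  proof (rule multivariate_central_limit_theorem)
    show "indep_vars (\<lambda>_. borel) (\<lambda>i \<omega>. \<xi> (Xs (Suc i) \<omega>)) UNIV"
      using indep_vars_compose2[OF indep', of "\<lambda>_. \<xi>" "\<lambda>_. borel"] by simp
    show "distr M borel (\<lambda>\<omega>. \<xi> (Xs (Suc i) \<omega>)) = distr M borel (\<lambda>\<omega>. \<xi> (Xs (Suc 0) \<omega>))" for i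
      by (rule distr_compose_eq[OF Xs Xs \<xi>]) (simp add: d)
    have n: "(\<lambda>x. (norm (\<xi> x))\<^sup>2) \<in> borel_measurable borel" by measurable
    show "integrable M (\<lambda>\<omega>. (norm (\<xi> (Xs (Suc 0) \<omega>)))\<^sup>2)"
      using expectation_eq_of_distr_eq(2)[OF Xs X n d] \<xi>sq by simp
    show "expectation (\<lambda>\<omega>. \<xi> (Xs (Suc 0) \<omega>) \<bullet> t) = 0" for t
    proof -
      have bt: "bounded_linear (\<lambda>A :: real^'d^'d. (transpose W ** A ** V) \<bullet> t)"
        by (rule bounded_linear_compose[OF bounded_linear_inner_left bl])
      have m: "(\<lambda>x. \<xi> x \<bullet> t) \<in> borel_measurable borel" by measurable
      have "expectation (\<lambda>\<omega>. \<xi> (Xs (Suc 0) \<omega>) \<bullet> t) = expectation (\<lambda>\<omega>. \<xi> (X \<omega>) \<bullet> t)"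
        by (rule expectation_eq_of_distr_eq(1)[OF Xs X m d])
      also have "\<dots> = (transpose W ** second_moment M X ** V) \<bullet> t"
        unfolding \<xi>_def second_moment_def
        by (rule integral_bounded_linear[OF bt integrable_outer[OF X sq]])
      finally show ?thesis by (simp add: centered)
    qed
    show "gaussian_law_of M (\<lambda>\<omega>. \<xi> (Xs (Suc 0) \<omega>)) L"
    proof -
      have "expectation (\<lambda>\<omega>. (\<xi> (Xs (Suc 0) \<omega>) \<bullet> t)\<^sup>2) = expectation (\<lambda>\<omega>. (\<xi> (X \<omega>) \<bullet> t)\<^sup>2)" for t
      proof -
        have m: "(\<lambda>x. (\<xi> x \<bullet> t)\<^sup>2) \<in> borel_measurable borel" by measurable
        show ?thesis by (rule expectation_eq_of_distr_eq(1)[OF Xs X m d])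
      qed
      then show ?thesis using L unfolding gaussian_law_of_def by simp
    qed
  qed
  moreover have "sqrt (real n) *\<^sub>R (transpose W ** (emp_second_moment Xs n \<omega> - second_moment M X) ** V)
      = (1 / sqrt (real n)) *\<^sub>R (\<Sum>i<n. \<xi> (Xs (Suc i) \<omega>))" for n \<omega>
  proof -
    interpret bl: bounded_linear "\<lambda>A :: real^'d^'d. transpose W ** A ** V" by (rule bl)
    have "transpose W ** (emp_second_moment Xs n \<omega> - second_moment M X) ** V
        = (1 / real n) *\<^sub>R (\<Sum>i<n. \<xi> (Xs (Suc i) \<omega>))"
      by (simp only: bl.diff centered emp_second_moment_def bl.scaleR bl.sum \<xi>_def
          One_nat_def sum.atLeast1_atMost_eq diff_zero)
    moreover have "sqrt (real n) * (1 / real n) = 1 / sqrt (real n)"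
      using sqrt_divide_self_eq[of "real n"] by (simp add: inverse_eq_divide)
    ultimately show ?thesis by (simp only: scaleR_scaleR)
  qed
  ultimately show ?thesis by simp
qed

section \<open>Consistency, asymptotic normality and excess risk\<close>

theorem theorem1:
  fixes M :: "'a measure"
    and X :: "'a \<Rightarrow> real^'d"
    and Xs :: "nat \<Rightarrow> 'a \<Rightarrow> real^'d"
    and u :: "nat \<Rightarrow> real^'d"
    and lam :: "nat \<Rightarrow> real"
    and uemp :: "nat \<Rightarrow> 'a \<Rightarrow> nat \<Rightarrow> real^'d"
    and Ustar :: "real^'k::{finite,linorder}^'d"
    and Uperp :: "real^'m::{finite,linorder}^'d"
    and Uemp Ln :: "nat \<Rightarrow> 'a \<Rightarrow> real^'k::{finite,linorder}^'d"
    and Lambda :: "'m::{finite,linorder} \<Rightarrow> 'k::{finite,linorder} \<Rightarrow> 'm::{finite,linorder} \<Rightarrow> 'k::{finite,linorder} \<Rightarrow> real"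
    and delta :: "'m::{finite,linorder} \<Rightarrow> 'k::{finite,linorder} \<Rightarrow> real"
  assumes dim: "CARD('d) = CARD('k) + CARD('m)"
    and prob: "prob_space M"
    and X_meas: "X \<in> borel_measurable M"
    and Xs_indep: "prob_space.indep_vars M (\<lambda>_. borel) Xs {1..}"
    and Xs_distr: "\<And>i. i \<ge> 1 \<Longrightarrow> distr M borel (Xs i) = distr M borel X"
    and X_sq: "integrable M (\<lambda>\<omega>. (norm (X \<omega>))\<^sup>2)"
    and eig: "ordered_eigenbasis (second_moment M X) u lam"
    and gap: "lam CARD('k) > lam (CARD('k) + 1)"
    and Lambda_finite: "\<And>(i::'m::{finite,linorder}) (j::'k::{finite,linorder}) (s::'m::{finite,linorder}) (t::'k::{finite,linorder}). integrable M (\<lambda>\<omega>.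
          (u (CARD('k) + pos i) \<bullet> X \<omega>) * (u (pos j) \<bullet> X \<omega>) *
          (u (CARD('k) + pos s) \<bullet> X \<omega>) * (u (pos t) \<bullet> X \<omega>))"
    and Lambda: "\<And>i j s t. Lambda i j s t = (\<integral>\<omega>.
          (u (CARD('k) + pos i) \<bullet> X \<omega>) * (u (pos j) \<bullet> X \<omega>) *
          (u (CARD('k) + pos s) \<bullet> X \<omega>) * (u (pos t) \<bullet> X \<omega>) \<partial>M)"
    and delta: "\<And>i j. delta i j = lam (pos j) - lam (CARD('k) + pos i)"
    and eig_n: "\<And>n \<omega>. n \<ge> 1 \<Longrightarrow> \<omega> \<in> space M \<Longrightarrow>
          \<exists>\<mu>. ordered_eigenbasis (emp_second_moment Xs n \<omega>) (uemp n \<omega>) \<mu>"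
    and Ustar: "Ustar = cols_from 0 u"
    and Uperp: "Uperp = cols_from CARD('k) u"
    and Uemp: "\<And>n \<omega>. Uemp n \<omega> = cols_from 0 (uemp n \<omega>)"
    and Uemp_meas: "\<And>n. Uemp n \<in> borel_measurable M"
    \<comment> \<open>\<open>Ln\<close> is the lifted logarithm, with arbitrary values where the largest angle is \<open>pi / 2\<close>\<close>
    and Ln: "\<And>n \<omega>. n \<ge> 1 \<Longrightarrow> \<omega> \<in> space M \<Longrightarrow>
          largest_angle (gr Ustar) (gr (Uemp n \<omega>)) < pi / 2 \<Longrightarrow>
          Ln n \<omega> = lift_log Ustar (gr (Uemp n \<omega>))"
    and Ln_meas: "\<And>n. Ln n \<in> borel_measurable M"
  shows "(\<forall>\<epsilon>>0. (\<lambda>n. measure M {\<omega> \<in> space M. gr_dist (gr (Uemp n \<omega>)) (gr Ustar) > \<epsilon>}) \<longlonglongrightarrow> 0)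
    \<and> (\<exists>L :: (real^'k::{finite,linorder}^'m::{finite,linorder}) measure.
          centered_gaussian_matrix_law L
            (\<lambda>i j s t. Lambda i j s t / (delta i j * delta s t)) \<and>
          conv_in_distr M (\<lambda>n \<omega>. sqrt (real n) *\<^sub>R Ln n \<omega>) (distr L borel (\<lambda>G. Uperp ** G)))
    \<and> (\<exists>L :: (real^'k::{finite,linorder}^'m::{finite,linorder}) measure.
          centered_gaussian_matrix_law L
            (\<lambda>i j s t. Lambda i j s t / sqrt (delta i j * delta s t)) \<and>
          conv_in_distr M
            (\<lambda>n \<omega>. real n * (recon_risk M X (gr (Uemp n \<omega>)) - recon_risk M X (gr Ustar)))
            (distr L borel (\<lambda>H. 1/2 * (norm H)\<^sup>2)))"
proof -
  interpret prob_space M by (rule prob)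
  define S where "S = second_moment M X"
  define \<mu> :: "real^'k::{finite,linorder}" where "\<mu> = (\<chi> j. lam (pos j))"
  define \<nu> :: "real^'m::{finite,linorder}" where "\<nu> = (\<chi> i. lam (CARD('k) + pos i))"
  define \<gamma> where "\<gamma> = lam CARD('k) - lam (CARD('k) + 1)"
  have \<gamma>: "\<gamma> > 0" using gap by (simp add: \<gamma>_def)
  have cardkd: "CARD('k) \<le> CARD('d)" using dim by simp
  interpret eigen_splitting Ustar Uperp S \<mu> \<nu>
    unfolding Ustar Uperp S_def \<mu>_def \<nu>_def by (rule eigenbasis_splitting[OF dim eig])
  have pos_k: "1 \<le> pos j" "pos j \<le> CARD('k)" for j :: "'k::{finite,linorder}"
    using bij_betw_pos[where 'n='k] by (auto simp: bij_betw_def)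
  have pos_m: "1 \<le> pos i" "pos i \<le> CARD('m)" for i :: "'m::{finite,linorder}"
    using bij_betw_pos[where 'n='m] by (auto simp: bij_betw_def)
  have m1: "1 \<le> CARD('m)" by (simp add: Suc_le_eq)
  have k1: "1 \<le> CARD('k)" by (simp add: Suc_le_eq)
  have lead: "\<kappa> CARD('k) \<le> \<kappa> (pos j)" and trail: "\<kappa> (CARD('k) + pos i) \<le> \<kappa> (CARD('k) + 1)"
    and between: "\<kappa> (CARD('k) + 1) \<le> \<kappa> CARD('k)"
    if "ordered_eigenbasis A v \<kappa>" for A :: "real^'d^'d" and v \<kappa>
      and j :: "'k::{finite,linorder}" and i :: "'m::{finite,linorder}"
    using that pos_k[of j] pos_m[of i] dim m1 k1 unfolding ordered_eigenbasis_def by auto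
  have \<mu>_ge: "lam CARD('k) \<le> \<mu> $ j" for j using lead[OF eig] by (simp add: \<mu>_def)
  have \<nu>_le: "\<nu> $ i \<le> lam (CARD('k) + 1)" for i using trail[OF eig] by (simp add: \<nu>_def)
  have \<delta>_ge: "\<gamma> \<le> \<mu> $ j - \<nu> $ i" for i j using \<mu>_ge[of j] \<nu>_le[of i] by (simp add: \<gamma>_def)
  have delta_eq: "delta i j = \<mu> $ j - \<nu> $ i" for i j by (simp add: delta \<mu>_def \<nu>_def)

  \<comment> \<open>pairs \<open>x = (n, \<omega>)\<close>; \<open>T\<close> is the graph map of the empirical subspace wherever \<open>transpose Ustar ** U x\<close> is invertible\<close>
  define E where "E x = emp_second_moment Xs (fst x) (snd x) - S" for x
  define U where "U x = Uemp (fst x) (snd x)" for x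
  define B where "B x = transpose Uperp ** U x" for x
  define T where "T x = B x ** matrix_inv (transpose Ustar ** U x)" for x
  define Y where "Y n \<omega> = sqrt (real n) *\<^sub>R (transpose Uperp ** E (n, \<omega>) ** Ustar)" for n \<omega>
  define \<rho> where "\<rho> x = norm (transpose Uperp ** E x ** Uperp) + norm (transpose Ustar ** E x ** Ustar)
    + norm (transpose Ustar ** E x ** Uperp) * norm (T x)" for x
  let ?F = "in_prob M"
  let ?k = "real CARD('k)"

  have sample: "\<forall>\<^sub>F x in ?F. 1 \<le> fst x \<and> snd x \<in> space M"
    by (intro eventually_in_probI eventually_sequentiallyI[of 1]) simp
  have perturbed: "transpose (U x) ** U x = mat 1 \<and> (\<exists>D. (E x + S) ** U x = U x ** D)
      \<and> \<gamma> * (norm (B x))\<^sup>2 \<le> 2 * ?k * norm (E x)"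
    if x: "1 \<le> fst x" "snd x \<in> space M" for x
  proof -
    obtain \<kappa> where \<kappa>: "ordered_eigenbasis (emp_second_moment Xs (fst x) (snd x)) (uemp (fst x) (snd x)) \<kappa>"
      using eig_n[OF x] by blast
    have U_eq: "U x = cols_from 0 (uemp (fst x) (snd x))" by (simp add: U_def Uemp)
    have Sn: "emp_second_moment Xs (fst x) (snd x) = E x + S" by (simp add: E_def)
    note P = eigenbasis_splitting[OF dim \<kappa>, folded U_eq, unfolded Sn]
    have "(lam CARD('k) - lam (CARD('k) + 1)) * (norm (transpose Uperp ** U x))\<^sup>2
        \<le> 2 * ?k * norm (E x + S - S)"
      using lead[OF \<kappa>] trail[OF \<kappa>] between[OF \<kappa>]
      by (intro leading_subspace_perturbation[OF P, where c = "\<kappa> CARD('k)"] \<mu>_ge \<nu>_le)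
        (auto intro: order.trans)
    then show ?thesis
      using eigen_splitting.VV[OF P] eigen_splitting.SV[OF P] by (auto simp: B_def \<gamma>_def)
  qed

  have E_lim: "(E \<longlongrightarrow> 0) ?F"
    using emp_second_moment_tendsto[OF X_meas Xs_indep Xs_distr X_sq]
    unfolding E_def S_def by (intro LIM_zero) (simp add: case_prod_unfold)
  have B_lim: "((\<lambda>x. (norm (B x))\<^sup>2) \<longlongrightarrow> 0) ?F"
  proof (rule tendsto_sandwich[of "\<lambda>_. 0"])
    show "\<forall>\<^sub>F x in ?F. (norm (B x))\<^sup>2 \<le> 2 * ?k / \<gamma> * norm (E x)"
      using sample by eventually_elim (use perturbed \<gamma> in \<open>simp add: field_simps\<close>)
    show "((\<lambda>x. 2 * ?k / \<gamma> * norm (E x)) \<longlongrightarrow> 0) ?F"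
      by (rule tendsto_mult_right_zero[OF tendsto_norm_zero[OF E_lim]])
  qed auto
  have B_small: "\<forall>\<^sub>F x in ?F. (norm (B x))\<^sup>2 < 1 / 2"
    using order_tendstoD(2)[OF B_lim, of "1 / 2"] by simp

  have coords: "graph_coordinates Ustar Uperp S \<mu> \<nu> (U x) (matrix_inv (transpose Ustar ** U x)) (T x)"
    if "1 \<le> fst x" "snd x \<in> space M" "(norm (B x))\<^sup>2 < 1 / 2" for x
    unfolding T_def B_def using perturbed[OF that(1,2)] that(3)
    by (intro graph_coordinates_exist) (auto simp: B_def)
  have T_sq_lim: "((\<lambda>x. (norm (T x))\<^sup>2) \<longlongrightarrow> 0) ?F"
  proof (rule tendsto_sandwich[of "\<lambda>_. 0"])
    show "\<forall>\<^sub>F x in ?F. (norm (T x))\<^sup>2 \<le> 2 * ?k * (norm (B x))\<^sup>2"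
      using sample B_small
    proof eventually_elim
      fix x assume x: "1 \<le> fst x \<and> snd x \<in> space M" "(norm (B x))\<^sup>2 < 1 / 2"
      then interpret G: graph_coordinates Ustar Uperp S \<mu> \<nu> "U x" "matrix_inv (transpose Ustar ** U x)" "T x"
        by (intro coords) auto
      have "(norm (T x))\<^sup>2 * (1 / 2) \<le> (norm (T x))\<^sup>2 * (1 - (norm (B x))\<^sup>2)"
        using x(2) by (intro mult_left_mono) auto
      also have "\<dots> \<le> ?k * (norm (B x))\<^sup>2" using G.norm_graph_le by (simp add: B_def)
      finally show "(norm (T x))\<^sup>2 \<le> 2 * ?k * (norm (B x))\<^sup>2" by simp
    qed
    show "((\<lambda>x. 2 * ?k * (norm (B x))\<^sup>2) \<longlongrightarrow> 0) ?F"
      by (rule tendsto_mult_right_zero[OF B_lim])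
  qed auto
  have T_lim: "((\<lambda>x. norm (T x)) \<longlongrightarrow> 0) ?F"
    using tendsto_real_sqrt[OF T_sq_lim] by simp
  have \<rho>_lim: "(\<rho> \<longlongrightarrow> 0) ?F"
  proof -
    have blk: "((\<lambda>x. norm (transpose P ** E x ** Q)) \<longlongrightarrow> 0) ?F" for P :: "real^'p^'d" and Q :: "real^'q^'d"
      by (intro tendsto_norm_zero matrix_mult.tendsto_left_zero matrix_mult.tendsto_right_zero E_lim)
    have "((\<lambda>x. norm (transpose Uperp ** E x ** Uperp) + norm (transpose Ustar ** E x ** Ustar)
      + norm (transpose Ustar ** E x ** Uperp) * norm (T x)) \<longlongrightarrow> 0 + 0 + 0 * 0) ?F"
      by (intro tendsto_add tendsto_mult blk T_lim)
    then show ?thesis by (simp add: \<rho>_def[abs_def])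
  qed
  \<comment> \<open>the absorption threshold of the first-order expansion\<close>
  have \<rho>_small: "\<forall>\<^sub>F x in ?F. \<rho> x \<le> \<gamma> / 2"
    using order_tendstoD(2)[OF \<rho>_lim, of "\<gamma> / 2"] \<gamma> by (auto elim: eventually_mono)
  have good: "\<forall>\<^sub>F x in ?F. 1 \<le> fst x \<and> snd x \<in> space M \<and> (norm (B x))\<^sup>2 < 1 / 2 \<and> \<rho> x \<le> \<gamma> / 2"
    using sample B_small \<rho>_small by eventually_elim auto

  \<comment> \<open>consistency: all principal angles are bounded by a continuous function of \<open>B\<close> vanishing at \<open>0\<close>\<close>
  have overlap: "?k - (norm (transpose Ustar ** U x))\<^sup>2 = (norm (B x))\<^sup>2"
    if "1 \<le> fst x" "snd x \<in> space M" for x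
    using norm_decompose[of "U x"] norm_stiefel_sq[of "U x"] perturbed[OF that] by (simp add: B_def)
  have dist_lim: "((\<lambda>x. gr_dist (gr (U x)) (gr Ustar)) \<longlongrightarrow> 0) ?F"
  proof (rule tendsto_sandwich[of "\<lambda>_. 0"])
    have bound: "0 \<le> gr_dist (gr (U x)) (gr Ustar) \<and>
        gr_dist (gr (U x)) (gr Ustar) \<le> sqrt ?k * arccos (sqrt (1 - (norm (B x))\<^sup>2))"
      if x: "1 \<le> fst x \<and> snd x \<in> space M" "(norm (B x))\<^sup>2 < 1 / 2" for x
    proof -
      have "norm (transpose (U x) ** Ustar) = norm (transpose Ustar ** U x)"
        using norm_transpose[of "transpose Ustar ** U x"] by (simp add: matrix_transpose_mul)
      then have "?k - (norm (transpose (U x) ** Ustar))\<^sup>2 \<le> (norm (B x))\<^sup>2"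
        using overlap x(1) by simp
      then show ?thesis
        using perturbed x VV by (intro conjI gr_dist_le) auto
    qed
    show "\<forall>\<^sub>F x in ?F. 0 \<le> gr_dist (gr (U x)) (gr Ustar)"
      using sample B_small by eventually_elim (use bound in blast)
    show "\<forall>\<^sub>F x in ?F. gr_dist (gr (U x)) (gr Ustar) \<le> sqrt ?k * arccos (sqrt (1 - (norm (B x))\<^sup>2))"
      using sample B_small by eventually_elim (use bound in blast)
    have "((\<lambda>x. sqrt (1 - (norm (B x))\<^sup>2)) \<longlongrightarrow> sqrt (1 - 0)) ?F"
      by (intro tendsto_intros B_lim)
    then have "((\<lambda>x. arccos (sqrt (1 - (norm (B x))\<^sup>2))) \<longlongrightarrow> arccos (sqrt (1 - 0))) ?F"
    proof (rule continuous_on_tendsto_compose[OF continuous_on_arccos'])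
      show "\<forall>\<^sub>F x in ?F. sqrt (1 - (norm (B x))\<^sup>2) \<in> {- 1..1}"
        using B_small
      proof eventually_elim
        fix x assume "(norm (B x))\<^sup>2 < 1 / 2"
        then have "0 \<le> sqrt (1 - (norm (B x))\<^sup>2)" "sqrt (1 - (norm (B x))\<^sup>2) \<le> 1" by auto
        then show "sqrt (1 - (norm (B x))\<^sup>2) \<in> {- 1..1}"
          unfolding atLeastAtMost_iff by linarith
      qed
    qed auto
    then show "((\<lambda>x. sqrt ?k * arccos (sqrt (1 - (norm (B x))\<^sup>2))) \<longlongrightarrow> 0) ?F"
      by (intro tendsto_mult_right_zero) simp
  qed auto
  have part1: "(\<lambda>n. measure M {\<omega> \<in> space M. gr_dist (gr (Uemp n \<omega>)) (gr Ustar) > \<epsilon>}) \<longlonglongrightarrow> 0"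
    if "\<epsilon> > 0" for \<epsilon>
  proof -
    have "\<forall>\<^sub>F x in ?F. \<not> gr_dist (gr (U x)) (gr Ustar) > \<epsilon>"
      using order_tendstoD(2)[OF dist_lim that] by (auto elim: eventually_mono)
    from eventually_in_prob_measure[OF this] show ?thesis by (simp add: U_def)
  qed

  \<comment> \<open>the only source of randomness at scale \<open>sqrt n\<close> is the cross block \<open>Y\<close>\<close>
  define \<xi> where "\<xi> \<omega> = transpose Uperp ** outer (X \<omega>) ** Ustar" for \<omega>
  have \<xi>_nth: "\<xi> \<omega> $ i $ j = (u (CARD('k) + pos i) \<bullet> X \<omega>) * (u (pos j) \<bullet> X \<omega>)" for \<omega> i j
    by (simp add: \<xi>_def mult_outer_mult_entry Uperp Ustar column_cols_from)
  have \<xi>_meas: "\<xi> \<in> borel_measurable M"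
  proof -
    have bl: "bounded_linear (\<lambda>A :: real^'d^'d. transpose Uperp ** A ** Ustar)"
      by (rule bounded_linear_compose[OF matrix_mult.bounded_linear_left matrix_mult.bounded_linear_right])
    have "(\<lambda>x. transpose Uperp ** outer x ** Ustar) \<in> borel_measurable borel"
      by (intro borel_measurable_continuous_onI
          continuous_on_compose2[OF linear_continuous_on[OF bl] continuous_on_outer]) auto
    from measurable_compose[OF X_meas this] show ?thesis by (simp add: \<xi>_def[abs_def])
  qed
  have cov: "Lambda i j s t = (\<integral>\<omega>. \<xi> \<omega> $ i $ j * \<xi> \<omega> $ s $ t \<partial>M)" for i j s t
    by (simp add: Lambda \<xi>_nth mult.assoc)
  have \<xi>_entry_sq: "integrable M (\<lambda>\<omega>. (\<xi> \<omega> $ i $ j)\<^sup>2)" for i j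
    using Lambda_finite[of i j i j] by (simp add: \<xi>_nth power2_eq_square mult.assoc)
  have \<xi>_sq: "integrable M (\<lambda>\<omega>. (norm (\<xi> \<omega>))\<^sup>2)"
    unfolding norm_matrix_sq by (intro Bochner_Integration.integrable_sum \<xi>_entry_sq)
  obtain L0 where L0: "gaussian_law_of M \<xi> L0" using gaussian_law_of_exists[OF \<xi>_meas \<xi>_sq] by blast
  have "transpose Uperp ** S ** Ustar = transpose Uperp ** (S ** Ustar)" by (simp add: matrix_mul_assoc)
  also have "\<dots> = 0" by (simp add: SV matrix_mul_assoc WV matrix_mult.zero_left)
  finally have centered: "transpose Uperp ** S ** Ustar = 0" .
  have clt: "conv_in_distr M Y L0"
    using cross_block_clt[OF X_meas Xs_indep Xs_distr X_sq centered[unfolded S_def]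
        \<xi>_sq[unfolded \<xi>_def] L0[unfolded \<xi>_def[abs_def]]]
    by (simp add: Y_def[abs_def] E_def S_def)
  have tight: "tight_seq M Y" by (rule conv_in_distr_imp_tight[OF clt])
  have scaled_law: "centered_gaussian_matrix_law (distr L0 borel (scale_entries c))
      (\<lambda>i j s t. c i j * c s t * Lambda i j s t)" for c
  proof -
    let ?\<xi> = "\<lambda>\<omega>. scale_entries c (\<xi> \<omega>)"
    have bl: "bounded_linear (scale_entries c :: real^'k::{finite,linorder}^'m::{finite,linorder} \<Rightarrow> real^'k::{finite,linorder}^'m::{finite,linorder})"
      using linear_scale_entries by (simp add: linear_conv_bounded_linear)
    have "gaussian_law_of M ?\<xi> (distr L0 borel (scale_entries c))"
      by (rule gaussian_law_of_linear_image[OF L0 linear_scale_entries])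
    moreover have "?\<xi> \<in> borel_measurable M"
      using \<xi>_meas borel_measurable_continuous_onI[OF linear_continuous_on[OF bl]] by (rule measurable_compose)
    moreover have "integrable M (\<lambda>\<omega>. (norm (?\<xi> \<omega>))\<^sup>2)"
      unfolding norm_matrix_sq scale_entries_nth power_mult_distrib
      by (intro Bochner_Integration.integrable_sum integrable_mult_right \<xi>_entry_sq)
    ultimately have "centered_gaussian_matrix_law (distr L0 borel (scale_entries c))
        (\<lambda>i j s t. \<integral>\<omega>. ?\<xi> \<omega> $ i $ j * ?\<xi> \<omega> $ s $ t \<partial>M)"
      by (rule gaussian_law_of_matrix)
    moreover have "(\<integral>\<omega>. ?\<xi> \<omega> $ i $ j * ?\<xi> \<omega> $ s $ t \<partial>M) = c i j * c s t * Lambda i j s t" for i j s t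
    proof -
      have "(\<integral>\<omega>. ?\<xi> \<omega> $ i $ j * ?\<xi> \<omega> $ s $ t \<partial>M)
          = (\<integral>\<omega>. (c i j * c s t) * (\<xi> \<omega> $ i $ j * \<xi> \<omega> $ s $ t) \<partial>M)"
        by (intro Bochner_Integration.integral_cong refl) (simp only: scale_entries_nth mult_ac)
      then show ?thesis by (simp only: integral_mult_right_zero cov)
    qed
    ultimately show ?thesis by (simp only:)
  qed
  have scale_meas: "scale_entries c \<in> borel_measurable L0" for c
  proof -
    have "bounded_linear (scale_entries c :: real^'k::{finite,linorder}^'m::{finite,linorder} \<Rightarrow> real^'k::{finite,linorder}^'m::{finite,linorder})"
      using linear_scale_entries by (simp add: linear_conv_bounded_linear)
    then have "scale_entries c \<in> borel_measurable (borel :: (real^'k::{finite,linorder}^'m::{finite,linorder}) measure)"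
      by (intro borel_measurable_continuous_onI linear_continuous_on)
    moreover have sets_L0: "sets L0 = sets borel" using L0 by (simp add: gaussian_law_of_def)
    ultimately show ?thesis by (simp add: measurable_cong_sets[OF sets_L0 refl])
  qed
  have Y_norm: "sqrt (real (fst x)) * norm (transpose Uperp ** E x ** Ustar) = norm (Y (fst x) (snd x))" for x
    by (simp add: Y_def)
  have scale_lin: "scale_entries c (a *\<^sub>R G) = a *\<^sub>R scale_entries c G" for c a and G :: "real^'k::{finite,linorder}^'m::{finite,linorder}"
    by (rule linear_cmul[OF linear_scale_entries])

  \<comment> \<open>asymptotic normality: the logarithm is a fixed linear image of \<open>Y\<close> up to \<open>r x * norm Y\<close> with \<open>r\<close> tending to \<open>0\<close>\<close>
  have part2: "\<exists>L :: (real^'k::{finite,linorder}^'m::{finite,linorder}) measure.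
      centered_gaussian_matrix_law L (\<lambda>i j s t. Lambda i j s t / (delta i j * delta s t)) \<and>
      conv_in_distr M (\<lambda>n \<omega>. sqrt (real n) *\<^sub>R Ln n \<omega>) (distr L borel (\<lambda>G. Uperp ** G))"
  proof (intro exI conjI)
    let ?c = "\<lambda>i j. 1 / delta i j"
    let ?L = "distr L0 borel (scale_entries ?c)"
    show "centered_gaussian_matrix_law ?L (\<lambda>i j s t. Lambda i j s t / (delta i j * delta s t))"
      using scaled_law[of ?c] by simp
    define g where "g G = Uperp ** scale_entries ?c G" for G
    have blg: "bounded_linear g"
      unfolding g_def using linear_scale_entries
      by (intro bounded_linear_compose[OF matrix_mult.bounded_linear_right]) (simp add: linear_conv_bounded_linear)
    define r where "r x = 2 / \<gamma> * (norm (T x))\<^sup>2 + 2 / \<gamma>\<^sup>2 * \<rho> x" for x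
    have "((\<lambda>x. 2 / \<gamma> * (norm (T x))\<^sup>2 + 2 / \<gamma>\<^sup>2 * \<rho> x) \<longlongrightarrow> 2 / \<gamma> * 0 + 2 / \<gamma>\<^sup>2 * 0) ?F"
      by (intro tendsto_intros T_sq_lim \<rho>_lim)
    then have "((\<lambda>(n, \<omega>). r (n, \<omega>)) \<longlongrightarrow> 0) ?F" by (simp add: r_def[abs_def] case_prod_unfold)
    from tight_seq_mult_tendsto_0[OF tight this]
    have r_lim: "((\<lambda>x. r x * norm (Y (fst x) (snd x))) \<longlongrightarrow> 0) ?F" by (simp add: case_prod_unfold)
    have "((\<lambda>x. norm (sqrt (real (fst x)) *\<^sub>R Ln (fst x) (snd x) - g (Y (fst x) (snd x)))) \<longlongrightarrow> 0) ?F"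
    proof (rule tendsto_sandwich[OF _ _ tendsto_const r_lim])
      show "\<forall>\<^sub>F x in ?F. norm (sqrt (real (fst x)) *\<^sub>R Ln (fst x) (snd x) - g (Y (fst x) (snd x)))
          \<le> r x * norm (Y (fst x) (snd x))"
        using good
      proof eventually_elim
        fix x assume x: "1 \<le> fst x \<and> snd x \<in> space M \<and> (norm (B x))\<^sup>2 < 1 / 2 \<and> \<rho> x \<le> \<gamma> / 2"
        obtain D where D: "(E x + S) ** U x = U x ** D" using perturbed x by blast
        have "largest_angle (gr Ustar) (gr (U x)) < pi / 2"
          using perturbed x VV overlap[of x] by (intro largest_angle_less) auto
        then have Ln_eq: "Ln (fst x) (snd x) = lift_log Ustar (gr (U x))"
          using x Ln[of "fst x" "snd x"] by (simp add: U_def)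
        let ?Y = "transpose Uperp ** E x ** Ustar"
        have "norm (lift_log Ustar (gr (U x)) - g ?Y) \<le> r x * norm ?Y"
          using lift_log_first_order[OF coords[of x] cardkd D \<delta>_ge \<gamma>, of "\<rho> x" ?Y] x
          unfolding g_def r_def delta_eq by (simp add: \<rho>_def)
        then have "sqrt (real (fst x)) * norm (lift_log Ustar (gr (U x)) - g ?Y)
            \<le> sqrt (real (fst x)) * (r x * norm ?Y)" by (intro mult_left_mono) auto
        moreover have "sqrt (real (fst x)) *\<^sub>R Ln (fst x) (snd x) - g (Y (fst x) (snd x))
            = sqrt (real (fst x)) *\<^sub>R (lift_log Ustar (gr (U x)) - g ?Y)"
          by (simp add: Y_def Ln_eq linear_cmul[OF bounded_linear.linear[OF blg]] scaleR_diff_right)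
        ultimately show "norm (sqrt (real (fst x)) *\<^sub>R Ln (fst x) (snd x) - g (Y (fst x) (snd x)))
          \<le> r x * norm (Y (fst x) (snd x))"
          unfolding Y_norm[symmetric] by (simp add: mult_ac)
      qed
    qed simp
    then have diff: "((\<lambda>(n, \<omega>). norm (sqrt (real n) *\<^sub>R Ln n \<omega> - g (Y n \<omega>))) \<longlongrightarrow> 0) ?F"
      by (simp only: case_prod_unfold)
    have Z_meas: "(\<lambda>\<omega>. sqrt (real n) *\<^sub>R Ln n \<omega>) \<in> borel_measurable M" for n
      by (rule borel_measurable_scaleR[OF borel_measurable_const Ln_meas])
    have gc: "continuous_on UNIV g" by (rule linear_continuous_on[OF blg])
    have "conv_in_distr M (\<lambda>n \<omega>. sqrt (real n) *\<^sub>R Ln n \<omega>) (distr L0 borel g)"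
      by (rule slutsky[OF conv_in_distr_continuous_map[OF clt gc] Z_meas diff])
    moreover have "distr ?L borel (\<lambda>G. Uperp ** G) = distr L0 borel g"
    proof -
      have "(\<lambda>G :: real^'k::{finite,linorder}^'m::{finite,linorder}. Uperp ** G) \<in> borel_measurable borel"
        by (intro borel_measurable_continuous_onI linear_continuous_on matrix_mult.bounded_linear_right)
      from distr_distr[OF this scale_meas] show ?thesis by (simp add: o_def g_def[abs_def])
    qed
    ultimately show "conv_in_distr M (\<lambda>n \<omega>. sqrt (real n) *\<^sub>R Ln n \<omega>) (distr ?L borel (\<lambda>G. Uperp ** G))"
      by simp
  qed

  \<comment> \<open>excess risk: a quadratic function of \<open>Y\<close> up to \<open>r x * (norm Y)\<^sup>2\<close>; taking \<open>sqrt r\<close> reduces the error to the linear case\<close>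
  have part3: "\<exists>L :: (real^'k::{finite,linorder}^'m::{finite,linorder}) measure.
      centered_gaussian_matrix_law L (\<lambda>i j s t. Lambda i j s t / sqrt (delta i j * delta s t)) \<and>
      conv_in_distr M (\<lambda>n \<omega>. real n * (recon_risk M X (gr (Uemp n \<omega>)) - recon_risk M X (gr Ustar)))
        (distr L borel (\<lambda>H. 1/2 * (norm H)\<^sup>2))"
  proof (intro exI conjI)
    let ?c = "\<lambda>i j. 1 / sqrt (delta i j)"
    let ?L = "distr L0 borel (scale_entries ?c)"
    show "centered_gaussian_matrix_law ?L (\<lambda>i j s t. Lambda i j s t / sqrt (delta i j * delta s t))"
      using scaled_law[of ?c] by (simp add: real_sqrt_mult)
    define h where "h G = 1/2 * (norm (scale_entries ?c G))\<^sup>2" for G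
    have bl: "bounded_linear (scale_entries ?c :: real^'k::{finite,linorder}^'m::{finite,linorder} \<Rightarrow> real^'k::{finite,linorder}^'m::{finite,linorder})"
      using linear_scale_entries by (simp add: linear_conv_bounded_linear)
    have hc: "continuous_on UNIV h"
      unfolding h_def by (intro continuous_intros linear_continuous_on[OF bl])
    define Z where "Z n \<omega> = real n * (recon_risk M X (gr (Uemp n \<omega>)) - recon_risk M X (gr Ustar))" for n \<omega>
    have Z_eq: "Z (fst x) (snd x) = real (fst x) * (1/2 * (Ustar \<bullet> (S ** Ustar) - U x \<bullet> (S ** U x)))"
      if "1 \<le> fst x" "snd x \<in> space M" for x
    proof -
      have "recon_risk M X (gr (U x)) - recon_risk M X (gr Ustar)
          = 1/2 * (Ustar \<bullet> (S ** Ustar) - U x \<bullet> (S ** U x))"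
        using recon_risk_eq[OF X_meas X_sq, of "U x"] recon_risk_eq[OF X_meas X_sq VV] perturbed[OF that]
        by (simp add: S_def)
      then show ?thesis unfolding Z_def U_def by simp
    qed
    have Z_meas: "Z n \<in> borel_measurable M" for n
    proof (cases "1 \<le> n")
      case True
      let ?q = "\<lambda>U :: real^'k::{finite,linorder}^'d. real n * (1/2 * (Ustar \<bullet> (S ** Ustar) - U \<bullet> (S ** U)))"
      have "continuous_on UNIV (\<lambda>U :: real^'k::{finite,linorder}^'d. S ** U)"
        by (rule linear_continuous_on[OF matrix_mult.bounded_linear_right])
      then have "continuous_on UNIV ?q" by (intro continuous_intros)
      from measurable_compose[OF Uemp_meas borel_measurable_continuous_onI[OF this]]
      have "(\<lambda>\<omega>. real n * (1/2 * (Ustar \<bullet> (S ** Ustar) - Uemp n \<omega> \<bullet> (S ** Uemp n \<omega>)))) \<in> borel_measurable M" .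
      moreover have Z_n: "Z n \<omega> = real n * (1/2 * (Ustar \<bullet> (S ** Ustar) - Uemp n \<omega> \<bullet> (S ** Uemp n \<omega>)))"
        if "\<omega> \<in> space M" for \<omega>
        using Z_eq[of "(n, \<omega>)"] True that by (simp add: U_def)
      ultimately show ?thesis by (simp only: measurable_cong[OF Z_n])
    next
      case False
      \<comment> \<open>at time \<open>0\<close> the frame is arbitrary, but the factor \<open>real n\<close> vanishes\<close>
      then have "n = 0" by simp
      then show ?thesis by (simp add: Z_def[abs_def])
    qed
    let ?C = "?k * (norm (diag_mat \<mu>) + norm (diag_mat \<nu>)) * (4 / \<gamma>\<^sup>2)"
    define r where "r x = ?C * (norm (T x))\<^sup>2 + 6 / \<gamma>\<^sup>2 * \<rho> x" for x
    have \<rho>0: "0 \<le> \<rho> x" for x by (simp add: \<rho>_def)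
    have r0: "0 \<le> r x" for x using \<rho>0[of x] by (simp add: r_def)
    have "((\<lambda>x. ?C * (norm (T x))\<^sup>2 + 6 / \<gamma>\<^sup>2 * \<rho> x) \<longlongrightarrow> ?C * 0 + 6 / \<gamma>\<^sup>2 * 0) ?F"
      by (intro tendsto_intros T_sq_lim \<rho>_lim)
    then have "(r \<longlongrightarrow> 0) ?F" by (simp add: r_def[abs_def])
    from tendsto_real_sqrt[OF this]
    have "((\<lambda>(n, \<omega>). sqrt (r (n, \<omega>))) \<longlongrightarrow> 0) ?F" by (simp add: case_prod_unfold)
    from tendsto_power[OF tight_seq_mult_tendsto_0[OF tight this], of 2]
    have r_lim: "((\<lambda>x. r x * (norm (Y (fst x) (snd x)))\<^sup>2) \<longlongrightarrow> 0) ?F"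
      using r0 by (simp add: case_prod_unfold power_mult_distrib)
    have "((\<lambda>x. norm (Z (fst x) (snd x) - h (Y (fst x) (snd x)))) \<longlongrightarrow> 0) ?F"
    proof (rule tendsto_sandwich[OF _ _ tendsto_const r_lim])
      show "\<forall>\<^sub>F x in ?F. norm (Z (fst x) (snd x) - h (Y (fst x) (snd x))) \<le> r x * (norm (Y (fst x) (snd x)))\<^sup>2"
        using good
      proof eventually_elim
        fix x assume x: "1 \<le> fst x \<and> snd x \<in> space M \<and> (norm (B x))\<^sup>2 < 1 / 2 \<and> \<rho> x \<le> \<gamma> / 2"
        obtain D where D: "(E x + S) ** U x = U x ** D" using perturbed x by blast
        let ?Y = "transpose Uperp ** E x ** Ustar"
        let ?e = "Ustar \<bullet> (S ** Ustar) - U x \<bullet> (S ** U x) - (norm (scale_entries ?c ?Y))\<^sup>2"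
        interpret G: graph_coordinates Ustar Uperp S \<mu> \<nu> "U x" "matrix_inv (transpose Ustar ** U x)" "T x"
          using x by (intro coords) auto
        have e: "\<bar>?e\<bar> \<le> r x * (norm ?Y)\<^sup>2"
          using G.risk_first_order[OF D \<delta>_ge \<gamma>, of "\<rho> x" ?Y] x
          unfolding r_def delta_eq by (simp add: \<rho>_def)
        have "Z (fst x) (snd x) - h (Y (fst x) (snd x)) = real (fst x) * (1/2 * ?e)"
          using x by (simp add: Z_eq h_def Y_def scale_lin power_mult_distrib algebra_simps)
        then have "norm (Z (fst x) (snd x) - h (Y (fst x) (snd x))) = real (fst x) * (1/2 * \<bar>?e\<bar>)"
          by (simp only: real_norm_def abs_mult abs_of_nat)
        also have "\<dots> \<le> real (fst x) * \<bar>?e\<bar>" by (intro mult_left_mono) auto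
        also have "\<dots> \<le> real (fst x) * (r x * (norm ?Y)\<^sup>2)" using e by (intro mult_left_mono) auto
        also have "\<dots> = r x * (norm (Y (fst x) (snd x)))\<^sup>2"
          unfolding Y_norm[symmetric] by (simp add: power_mult_distrib)
        finally show "norm (Z (fst x) (snd x) - h (Y (fst x) (snd x))) \<le> r x * (norm (Y (fst x) (snd x)))\<^sup>2" .
      qed
    qed simp
    then have diff: "((\<lambda>(n, \<omega>). norm (Z n \<omega> - h (Y n \<omega>))) \<longlongrightarrow> 0) ?F"
      by (simp only: case_prod_unfold)
    have "conv_in_distr M Z (distr L0 borel h)"
      by (rule slutsky[OF conv_in_distr_continuous_map[OF clt hc] Z_meas diff])
    moreover have "distr ?L borel (\<lambda>H. 1/2 * (norm H)\<^sup>2) = distr L0 borel h"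
    proof -
      have "(\<lambda>H :: real^'k::{finite,linorder}^'m::{finite,linorder}. 1/2 * (norm H)\<^sup>2) \<in> borel_measurable borel"
        by measurable
      from distr_distr[OF this scale_meas] show ?thesis by (simp add: o_def h_def[abs_def])
    qed
    ultimately show "conv_in_distr M
        (\<lambda>n \<omega>. real n * (recon_risk M X (gr (Uemp n \<omega>)) - recon_risk M X (gr Ustar)))
        (distr ?L borel (\<lambda>H. 1/2 * (norm H)\<^sup>2))"
      by (simp add: Z_def[abs_def])
  qed
  show ?thesis using part1 part2 part3 by blast
qed

end
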